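(* There is a constant $K>0$ such that the following holds. Let $x\in B_4$ be a braid which is pseudo-Anosov and rigid with respect to the dual Garside structure $BKL_4$. Then the set of sliding circuits $SC(x)$ with respect to $BKL_4$ satisfies $\#SC(x)\le K\,\ell(x)^2$.
   Context: Dual (Birman–Ko–Lee) Garside structure $BKL_4$ on $B_4$. - Generators: the braids $a_{p,q}$ ($1\le p<q\le4$) given by $a_{p,p+1}=\sigma_p$, $a_{1,3}=\sigma_2^{-1}\sigma_1\sigma_2$, $a_{2,4}=\sigma_3^{-1}\sigma_2\sigma_3$ and $a_{1,4}=\sigma_3^{-1}\sigma_2^{-1}\sigma_1\sigma_2\sigma_3$. - Order: $x\preccurlyeq y$ iff $x^{-1}y$ lies in the monoid generated by the $a_{p,q}$. This order is a lattice order, and $\wedge$ denotes the greatest common prefix. - Garside element: $\delta=\sigma_1\sigma_2\sigma_3$. The simple elements are the $s$ with $1\preccurlyeq s\preccurlyeq\delta$. - Notation: $\tau(u)=\delta^{-1}u\delta$, $\partial(s)=s^{-1}\delta$, and $x^z=z^{-1}xz$. - Left-weighted pair: a pair $s_1s_2$ of simple elements is left-weighted if $\partial(s_1)\wedge s_2=1$. - Normal form: every $x$ has a unique left normal form $x=\delta^p x_1\cdots x_r$, where $p$ is maximal with $\delta^p\preccurlyeq x$, the $x_i$ are simple and different from $1$ and $\delta$, and each pair $x_ix_{i+1}$ is left-weighted. One sets $\inf(x)=p$ and calls $\ell(x)=r$ the canonical length. - For $r\ge1$: $\iota(x)=\tau^{-p}(x_1)$ and $\varphi(x)=x_r$. -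 Rigidity: $x$ is rigid if $r\ge1$ and the pair $\varphi(x)\iota(x)$ is left-weighted. - Cyclic sliding: $\mathfrak s(x)=x^{\mathfrak p(x)}$ with $\mathfrak p(x)=\iota(x)\wedge\partial(\varphi(x))$, and $\mathfrak s(x)=x$ if $r=0$. - Sliding circuits: $SC(x)$ is the set of conjugates $y$ of $x$ with $\mathfrak s^k(y)=y$ for some $k\ge1$. - Pseudo-Anosov: in the sense of the Nielsen–Thurston classification of $B_4$ as the mapping class group of the 4-punctured disk. *)

theory Defs
  imports Complex_Main
begin

datatype sgen = S1 | S2 | S3

fun sidx :: "sgen \<Rightarrow> nat" where
  "sidx S1 = 1" | "sidx S2 = 2" | "sidx S3 = 3"

type_synonym bword = "(sgen \<times> bool) list"

text \<open>formal inverse of a word (letters are (generator, sign), True = positive)\<close>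
definition winv :: "('a \<times> bool) list \<Rightarrow> ('a \<times> bool) list" where
  "winv w = rev (map (\<lambda>(g,b). (g, \<not> b)) w)"

inductive beq :: "bword \<Rightarrow> bword \<Rightarrow> bool" where
  brefl: "beq u u"
| bsym: "beq u v \<Longrightarrow> beq v u"
| btrans: "beq u v \<Longrightarrow> beq v w \<Longrightarrow> beq u w"
| bcong: "beq u u' \<Longrightarrow> beq v v' \<Longrightarrow> beq (u @ v) (u' @ v')"
| binv_cong: "beq u v \<Longrightarrow> beq (winv u) (winv v)"
| bcancel: "beq [(g,b),(g,\<not> b)] []"
| bcomm: "beq [(S1,True),(S3,True)] [(S3,True),(S1,True)]"
| bbr12: "beq [(S1,True),(S2,True),(S1,True)] [(S2,True),(S1,True),(S2,True)]"
| bbr23: "beq [(S2,True),(S3,True),(S2,True)] [(S3,True),(S2,True),(S3,True)]"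

lemma beq_equivp: "equivp beq"
  by (auto intro!: equivpI reflpI sympI transpI intro: beq.intros)

quotient_type braid = bword / beq
  by (rule beq_equivp)

lift_definition bone :: braid is "[]" .
lift_definition bmult :: "braid \<Rightarrow> braid \<Rightarrow> braid" (infixl "\<cdot>" 70) is "(@)"
  by (rule beq.bcong)
lift_definition binv :: "braid \<Rightarrow> braid" is winv
  by (rule beq.binv_cong)
lift_definition sigma :: "sgen \<Rightarrow> braid" is "\<lambda>g. [(g,True)]" .

definition bprod :: "braid list \<Rightarrow> braid" where
  "bprod l = foldr bmult l bone"

definition bpow :: "braid \<Rightarrow> nat \<Rightarrow> braid" where
  "bpow x n = bprod (replicate n x)"

definition delta :: braid where
  "delta = sigma S1 \<cdot> sigma S2 \<cdot> sigma S3"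

definition dpow :: "int \<Rightarrow> braid" where
  "dpow p = (if p \<ge> 0 then bpow delta (nat p) else bpow (binv delta) (nat (- p)))"

definition bkl_a :: "nat \<Rightarrow> nat \<Rightarrow> braid" where
  "bkl_a p q =
    (if (p,q) = (1,2) then sigma S1
     else if (p,q) = (2,3) then sigma S2
     else if (p,q) = (3,4) then sigma S3
     else if (p,q) = (1,3) then binv (sigma S2) \<cdot> sigma S1 \<cdot> sigma S2
     else if (p,q) = (2,4) then binv (sigma S3) \<cdot> sigma S2 \<cdot> sigma S3
     else binv (sigma S3) \<cdot> binv (sigma S2) \<cdot> sigma S1 \<cdot> sigma S2 \<cdot> sigma S3)"

definition bkl_gens :: "braid set" where
  "bkl_gens = {bkl_a p q | p q. 1 \<le> p \<and> p < q \<and> q \<le> 4}"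

definition bkl_monoid :: "braid set" where
  "bkl_monoid = {bprod l | l. set l \<subseteq> bkl_gens}"

definition prefix :: "braid \<Rightarrow> braid \<Rightarrow> bool" (infix "\<preccurlyeq>" 50) where
  "x \<preccurlyeq> y \<longleftrightarrow> binv x \<cdot> y \<in> bkl_monoid"

definition simple :: "braid \<Rightarrow> bool" where
  "simple s \<longleftrightarrow> bone \<preccurlyeq> s \<and> s \<preccurlyeq> delta"

definition meet :: "braid \<Rightarrow> braid \<Rightarrow> braid" where
  "meet x y = (THE m. m \<preccurlyeq> x \<and> m \<preccurlyeq> y \<and> (\<forall>z. z \<preccurlyeq> x \<and> z \<preccurlyeq> y \<longrightarrow> z \<preccurlyeq> m))"

definition bconj :: "braid \<Rightarrow> braid \<Rightarrow> braid" where
  "bconj x z = binv z \<cdot> x \<cdot> z"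

definition tau_pow :: "int \<Rightarrow> braid \<Rightarrow> braid" where
  "tau_pow k u = bconj u (dpow k)"

definition bpartial :: "braid \<Rightarrow> braid" where
  "bpartial s = binv s \<cdot> delta"

definition left_weighted :: "braid \<Rightarrow> braid \<Rightarrow> bool" where
  "left_weighted s1 s2 \<longleftrightarrow> meet (bpartial s1) s2 = bone"

definition is_lnf :: "braid \<Rightarrow> int \<Rightarrow> braid list \<Rightarrow> bool" where
  "is_lnf x p xs \<longleftrightarrow>
     x = dpow p \<cdot> bprod xs \<and>
     dpow p \<preccurlyeq> x \<and> \<not> dpow (p + 1) \<preccurlyeq> x \<and>
     (\<forall>s \<in> set xs. simple s \<and> s \<noteq> bone \<and> s \<noteq> delta) \<and>
     (\<forall>i. Suc i < length xs \<longrightarrow> left_weighted (xs ! i) (xs ! Suc i))"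

definition lnf :: "braid \<Rightarrow> int \<times> braid list" where
  "lnf x = (THE (p, xs). is_lnf x p xs)"

definition binf :: "braid \<Rightarrow> int" where
  "binf x = fst (lnf x)"

definition clen :: "braid \<Rightarrow> nat" where
  "clen x = length (snd (lnf x))"

definition iota :: "braid \<Rightarrow> braid" where
  "iota x = tau_pow (- binf x) (hd (snd (lnf x)))"

definition varphi :: "braid \<Rightarrow> braid" where
  "varphi x = last (snd (lnf x))"

definition rigid :: "braid \<Rightarrow> bool" where
  "rigid x \<longleftrightarrow> clen x \<ge> 1 \<and> left_weighted (varphi x) (iota x)"

definition pfac :: "braid \<Rightarrow> braid" where
  "pfac x = meet (iota x) (bpartial (varphi x))"

definition cslide :: "braid \<Rightarrow> braid" where
  "cslide x = (if clen x = 0 then x else bconj x (pfac x))"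

definition conjugate :: "braid \<Rightarrow> braid \<Rightarrow> bool" where
  "conjugate y x \<longleftrightarrow> (\<exists>z. y = bconj x z)"

definition SC :: "braid \<Rightarrow> braid set" where
  "SC x = {y. conjugate y x \<and> (\<exists>k \<ge> 1. (cslide ^^ k) y = y)}"

type_synonym fword = "(nat \<times> bool) list"

fun red_step :: "nat \<times> bool \<Rightarrow> fword \<Rightarrow> fword" where
  "red_step a [] = [a]"
| "red_step (a, b) ((c, d) # r) = (if a = c \<and> b \<noteq> d then r else (a, b) # (c, d) # r)"

definition freduce :: "fword \<Rightarrow> fword" where
  "freduce w = foldr red_step w []"

definition free_eq :: "fword \<Rightarrow> fword \<Rightarrow> bool" where
  "free_eq u v \<longleftrightarrow> freduce u = freduce v"

definition fconj :: "fword \<Rightarrow> fword \<Rightarrow> bool" where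
  "fconj u v \<longleftrightarrow> (\<exists>g. free_eq (g @ u @ winv g) v)"

text \<open>Artin's action of sigma_i^{+-1} on the generators x_1..x_4 of F_4\<close>
fun art :: "sgen \<times> bool \<Rightarrow> nat \<Rightarrow> fword" where
  "art (g, True) j = (let i = sidx g in
      if j = i then [(i,True),(i+1,True),(i,False)]
      else if j = i + 1 then [(i,True)] else [(j,True)])"
| "art (g, False) j = (let i = sidx g in
      if j = i then [(i+1,True)]
      else if j = i + 1 then [(i+1,False),(i,True),(i+1,True)] else [(j,True)])"

definition fsubst :: "(nat \<Rightarrow> fword) \<Rightarrow> fword \<Rightarrow> fword" where
  "fsubst f w = concat (map (\<lambda>(j,b). if b then f j else winv (f j)) w)"

fun artin_act :: "bword \<Rightarrow> fword \<Rightarrow> fword" where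
  "artin_act [] v = v"
| "artin_act (l # w) v = fsubst (art l) (artin_act w v)"

text \<open>round curves enclosing punctures i..j (2 or 3 punctures), as elements x_i...x_j\<close>
definition round_curves :: "fword set" where
  "round_curves = {map (\<lambda>k. (k, True)) [i..<Suc j] | i j.
      1 \<le> i \<and> i < j \<and> j \<le> 4 \<and> \<not> (i = 1 \<and> j = 4)}"

text \<open>essential simple closed curves in the 4-punctured disk (as free group elements,
  up to conjugacy): images of round curves under braids\<close>
definition ess_curves :: "fword set" where
  "ess_curves = {artin_act w c | w c. c \<in> round_curves}"

text \<open>pseudo-Anosov: no essential simple closed curve is periodic (up to isotopy)\<close>
definition pseudo_anosov :: "braid \<Rightarrow> bool" where
  "pseudo_anosov x \<longleftrightarrow>
     (\<forall>w. abs_braid w = x \<longrightarrow>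
        \<not> (\<exists>k \<ge> (1::nat). \<exists>c \<in> ess_curves.
              fconj (artin_act (concat (replicate k w)) c) c))"

end

theory Submission
  imports Defs
begin

text \<open>
  Everything in \<open>SC(x)\<close> is rigid with the same infimum and length as \<open>x\<close>. The fourth power of a rigid braid is,
  up to the central element \<open>\<delta>\<^sup>4\<close>, the product of a cyclic left-weighted word, and by convexity the rigid
  conjugates of such a word are joined by conjugations by simple elements. Unless all letters are atoms, or all
  have length two (which reduces to atoms by inverting), these conjugations only rotate the word and apply \<open>\<tau>\<close>.
  For words of atoms a nontrivial conjugation is a strip of lcm squares running along the word, and
  non-backtracking sequences of strips tile an annulus. Local analysis of annuli shows that in an annulus higher than
  the length \<open>R\<close> of the word plus a constant some row preserves an essential curve, contradicting the
  pseudo-Anosov assumption. As strips hardly ever branch, there are \<open>O(R)\<close> words up to rotation and \<open>\<tau>\<close>,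
  and each of them accounts for at most \<open>4R\<close> words.
\<close>

section \<open>The simple elements\<close>

text \<open>The local statements concern finitely many configurations of simple elements and are
  decided by evaluation. They become global because a quantity that is monotone along a periodic
  word is constant; therefore words are periodic functions and most local rules are implications
  from one position to a neighbouring one. Since a braid is given only as a class of words,
  uniqueness of normal forms is obtained by letting the generators act on normal forms and verifying
  the braid relations for this action.

  The height bound for annuli comes from two Boolean patterns on the rows. One is the same in every
  row, the other advances one position per row, so within R rows every end of a run of the second
  meets every beginning of a run of the first. The local rules forbid such a meeting; hence one
  pattern is constant, and that leads to a reducible row.

  Branching is rare because an irreducible row with three strips has one special shape. If such a
  row can be reached, the search starts there and ends after two layers; otherwise no strip has two
  continuations.\<close>

datatype sim = E0 | A12 | A13 | A14 | A23 | A24 | A34 | T123 | T124 | T134 | T234 | P12 | P14 | DL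

text \<open>The simple elements are the fourteen noncrossing partitions of four points on a circle:
  \<open>Apq\<close> joins two points, \<open>Tpqr\<close> three, \<open>P12\<close> and
  \<open>P14\<close> are the partitions into two pairs, \<open>E0\<close> and \<open>DL\<close> the
  trivial and the full one. As a list they can be enumerated by evaluation.\<close>

definition sims :: "sim list" where
  "sims = [E0, A12, A13, A14, A23, A24, A34, T123, T124, T134, T234, P12, P14, DL]"

definition slen :: "sim \<Rightarrow> nat" where
  "slen s = (case s of E0 \<Rightarrow> 0 | A12 \<Rightarrow> 1 | A13 \<Rightarrow> 1 | A14 \<Rightarrow> 1 | A23 \<Rightarrow> 1 | A24 \<Rightarrow> 1 | A34 \<Rightarrow> 1 | T123 \<Rightarrow> 2 | T124 \<Rightarrow> 2 | T134 \<Rightarrow> 2 | T234 \<Rightarrow> 2 | P12 \<Rightarrow> 2 | P14 \<Rightarrow> 2 | DL \<Rightarrow> 3)"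

text \<open>The Kreweras complement of the partition, standing for s^-1 \<delta>. Its square is the
  rotation \<open>stau\<close>.\<close>

definition sdual :: "sim \<Rightarrow> sim" where
  "sdual s = (case s of E0 \<Rightarrow> DL | A12 \<Rightarrow> T234 | A13 \<Rightarrow> P12 | A14 \<Rightarrow> T123 | A23 \<Rightarrow> T134 | A24 \<Rightarrow> P14 | A34 \<Rightarrow> T124 | T123 \<Rightarrow> A34 | T124 \<Rightarrow> A23 | T134 \<Rightarrow> A12 | T234 \<Rightarrow> A14 | P12 \<Rightarrow> A24 | P14 \<Rightarrow> A13 | DL \<Rightarrow> E0)"

definition stau :: "sim \<Rightarrow> sim" where
  "stau s = (case s of E0 \<Rightarrow> E0 | A12 \<Rightarrow> A14 | A13 \<Rightarrow> A24 | A14 \<Rightarrow> A34 | A23 \<Rightarrow> A12 | A24 \<Rightarrow> A13 | A34 \<Rightarrow> A23 | T123 \<Rightarrow> T124 | T124 \<Rightarrow> T134 | T134 \<Rightarrow> T234 | T234 \<Rightarrow> T123 | P12 \<Rightarrow> P14 | P14 \<Rightarrow> P12 | DL \<Rightarrow> DL)"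

definition smeet :: "sim \<Rightarrow> sim \<Rightarrow> sim" where
  "smeet s t = (case s of E0 \<Rightarrow> E0
     | A12 \<Rightarrow> (case t of A12 \<Rightarrow> A12 | T123 \<Rightarrow> A12 | T124 \<Rightarrow> A12 | P12 \<Rightarrow> A12 | DL \<Rightarrow> A12 | _ \<Rightarrow> E0)
     | A13 \<Rightarrow> (case t of A13 \<Rightarrow> A13 | T123 \<Rightarrow> A13 | T134 \<Rightarrow> A13 | DL \<Rightarrow> A13 | _ \<Rightarrow> E0)
     | A14 \<Rightarrow> (case t of A14 \<Rightarrow> A14 | T124 \<Rightarrow> A14 | T134 \<Rightarrow> A14 | P14 \<Rightarrow> A14 | DL \<Rightarrow> A14 | _ \<Rightarrow> E0)
     | A23 \<Rightarrow> (case t of A23 \<Rightarrow> A23 | T123 \<Rightarrow> A23 | T234 \<Rightarrow> A23 | P14 \<Rightarrow> A23 | DL \<Rightarrow> A23 | _ \<Rightarrow> E0)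
     | A24 \<Rightarrow> (case t of A24 \<Rightarrow> A24 | T124 \<Rightarrow> A24 | T234 \<Rightarrow> A24 | DL \<Rightarrow> A24 | _ \<Rightarrow> E0)
     | A34 \<Rightarrow> (case t of A34 \<Rightarrow> A34 | T134 \<Rightarrow> A34 | T234 \<Rightarrow> A34 | P12 \<Rightarrow> A34 | DL \<Rightarrow> A34 | _ \<Rightarrow> E0)
     | T123 \<Rightarrow> (case t of A12 \<Rightarrow> A12 | A13 \<Rightarrow> A13 | A23 \<Rightarrow> A23 | T123 \<Rightarrow> T123 | T124 \<Rightarrow> A12 | T134 \<Rightarrow> A13 | T234 \<Rightarrow> A23 | P12 \<Rightarrow> A12 | P14 \<Rightarrow> A23 | DL \<Rightarrow> T123 | _ \<Rightarrow> E0)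
     | T124 \<Rightarrow> (case t of A12 \<Rightarrow> A12 | A14 \<Rightarrow> A14 | A24 \<Rightarrow> A24 | T123 \<Rightarrow> A12 | T124 \<Rightarrow> T124 | T134 \<Rightarrow> A14 | T234 \<Rightarrow> A24 | P12 \<Rightarrow> A12 | P14 \<Rightarrow> A14 | DL \<Rightarrow> T124 | _ \<Rightarrow> E0)
     | T134 \<Rightarrow> (case t of A13 \<Rightarrow> A13 | A14 \<Rightarrow> A14 | A34 \<Rightarrow> A34 | T123 \<Rightarrow> A13 | T124 \<Rightarrow> A14 | T134 \<Rightarrow> T134 | T234 \<Rightarrow> A34 | P12 \<Rightarrow> A34 | P14 \<Rightarrow> A14 | DL \<Rightarrow> T134 | _ \<Rightarrow> E0)
     | T234 \<Rightarrow> (case t of A23 \<Rightarrow> A23 | A24 \<Rightarrow> A24 | A34 \<Rightarrow> A34 | T123 \<Rightarrow> A23 | T124 \<Rightarrow> A24 | T134 \<Rightarrow> A34 | T234 \<Rightarrow> T234 | P12 \<Rightarrow> A34 | P14 \<Rightarrow> A23 | DL \<Rightarrow> T234 | _ \<Rightarrow> E0)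
     | P12 \<Rightarrow> (case t of A12 \<Rightarrow> A12 | A34 \<Rightarrow> A34 | T123 \<Rightarrow> A12 | T124 \<Rightarrow> A12 | T134 \<Rightarrow> A34 | T234 \<Rightarrow> A34 | P12 \<Rightarrow> P12 | DL \<Rightarrow> P12 | _ \<Rightarrow> E0)
     | P14 \<Rightarrow> (case t of A14 \<Rightarrow> A14 | A23 \<Rightarrow> A23 | T123 \<Rightarrow> A23 | T124 \<Rightarrow> A14 | T134 \<Rightarrow> A14 | T234 \<Rightarrow> A23 | P14 \<Rightarrow> P14 | DL \<Rightarrow> P14 | _ \<Rightarrow> E0)
     | DL \<Rightarrow> t)"

text \<open>A partial product made total: the value is meaningful when \<open>t\<close> lies below
  \<open>sdual s\<close>, that is, when the product is simple; otherwise the default is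
  \<open>DL\<close>. Likewise \<open>sdiv\<close> defaults to \<open>E0\<close> where
  \<open>s\<close> does not divide \<open>t\<close>.\<close>

definition smul :: "sim \<Rightarrow> sim \<Rightarrow> sim" where
  "smul s t = (case s of E0 \<Rightarrow> t
     | A12 \<Rightarrow> (case t of E0 \<Rightarrow> A12 | A23 \<Rightarrow> T123 | A24 \<Rightarrow> T124 | A34 \<Rightarrow> P12 | _ \<Rightarrow> DL)
     | A13 \<Rightarrow> (case t of E0 \<Rightarrow> A13 | A12 \<Rightarrow> T123 | A34 \<Rightarrow> T134 | _ \<Rightarrow> DL)
     | A14 \<Rightarrow> (case t of E0 \<Rightarrow> A14 | A12 \<Rightarrow> T124 | A13 \<Rightarrow> T134 | A23 \<Rightarrow> P14 | _ \<Rightarrow> DL)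
     | A23 \<Rightarrow> (case t of E0 \<Rightarrow> A23 | A13 \<Rightarrow> T123 | A14 \<Rightarrow> P14 | A34 \<Rightarrow> T234 | _ \<Rightarrow> DL)
     | A24 \<Rightarrow> (case t of E0 \<Rightarrow> A24 | A14 \<Rightarrow> T124 | A23 \<Rightarrow> T234 | _ \<Rightarrow> DL)
     | A34 \<Rightarrow> (case t of E0 \<Rightarrow> A34 | A12 \<Rightarrow> P12 | A14 \<Rightarrow> T134 | A24 \<Rightarrow> T234 | _ \<Rightarrow> DL)
     | T123 \<Rightarrow> (case t of E0 \<Rightarrow> T123 | _ \<Rightarrow> DL)
     | T124 \<Rightarrow> (case t of E0 \<Rightarrow> T124 | _ \<Rightarrow> DL)
     | T134 \<Rightarrow> (case t of E0 \<Rightarrow> T134 | _ \<Rightarrow> DL)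
     | T234 \<Rightarrow> (case t of E0 \<Rightarrow> T234 | _ \<Rightarrow> DL)
     | P12 \<Rightarrow> (case t of E0 \<Rightarrow> P12 | _ \<Rightarrow> DL)
     | P14 \<Rightarrow> (case t of E0 \<Rightarrow> P14 | _ \<Rightarrow> DL)
     | DL \<Rightarrow> DL)"

definition sdiv :: "sim \<Rightarrow> sim \<Rightarrow> sim" where
  "sdiv s t = (case s of E0 \<Rightarrow> (case t of A12 \<Rightarrow> A12 | A13 \<Rightarrow> A13 | A14 \<Rightarrow> A14 | A23 \<Rightarrow> A23 | A24 \<Rightarrow> A24 | A34 \<Rightarrow> A34 | T123 \<Rightarrow> T123 | T124 \<Rightarrow> T124 | T134 \<Rightarrow> T134 | T234 \<Rightarrow> T234 | P12 \<Rightarrow> P12 | P14 \<Rightarrow> P14 | DL \<Rightarrow> DL | _ \<Rightarrow> E0)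
     | A12 \<Rightarrow> (case t of T123 \<Rightarrow> A23 | T124 \<Rightarrow> A24 | P12 \<Rightarrow> A34 | DL \<Rightarrow> T234 | _ \<Rightarrow> E0)
     | A13 \<Rightarrow> (case t of T123 \<Rightarrow> A12 | T134 \<Rightarrow> A34 | DL \<Rightarrow> P12 | _ \<Rightarrow> E0)
     | A14 \<Rightarrow> (case t of T124 \<Rightarrow> A12 | T134 \<Rightarrow> A13 | P14 \<Rightarrow> A23 | DL \<Rightarrow> T123 | _ \<Rightarrow> E0)
     | A23 \<Rightarrow> (case t of T123 \<Rightarrow> A13 | T234 \<Rightarrow> A34 | P14 \<Rightarrow> A14 | DL \<Rightarrow> T134 | _ \<Rightarrow> E0)
     | A24 \<Rightarrow> (case t of T124 \<Rightarrow> A14 | T234 \<Rightarrow> A23 | DL \<Rightarrow> P14 | _ \<Rightarrow> E0)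
     | A34 \<Rightarrow> (case t of T134 \<Rightarrow> A14 | T234 \<Rightarrow> A24 | P12 \<Rightarrow> A12 | DL \<Rightarrow> T124 | _ \<Rightarrow> E0)
     | T123 \<Rightarrow> (case t of DL \<Rightarrow> A34 | _ \<Rightarrow> E0)
     | T124 \<Rightarrow> (case t of DL \<Rightarrow> A23 | _ \<Rightarrow> E0)
     | T134 \<Rightarrow> (case t of DL \<Rightarrow> A12 | _ \<Rightarrow> E0)
     | T234 \<Rightarrow> (case t of DL \<Rightarrow> A14 | _ \<Rightarrow> E0)
     | P12 \<Rightarrow> (case t of DL \<Rightarrow> A24 | _ \<Rightarrow> E0)
     | P14 \<Rightarrow> (case t of DL \<Rightarrow> A13 | _ \<Rightarrow> E0)
     | DL \<Rightarrow> E0)"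

lemma in_sims: "s \<in> set sims"
  by (cases s) (simp_all add: sims_def)

lemma all_simsI: "list_all P sims \<Longrightarrow> P s"
  using in_sims by (auto simp: list_all_iff)

definition sle :: "sim \<Rightarrow> sim \<Rightarrow> bool" where
  "sle s t \<longleftrightarrow> smeet s t = s"

definition lw :: "sim \<Rightarrow> sim \<Rightarrow> bool" where
  "lw s t \<longleftrightarrow> smeet (sdual s) t = E0"

text \<open>Moves the largest possible piece of the second factor into the first, so that the pair
  becomes left-weighted. All computations of normal forms iterate this step.\<close>

definition snorm :: "sim \<Rightarrow> sim \<Rightarrow> sim \<times> sim" where
  "snorm s t = (let m = smeet (sdual s) t in (smul s m, sdiv m t))"

definition proper :: "sim \<Rightarrow> bool" where
  "proper s \<longleftrightarrow> s \<noteq> E0 \<and> s \<noteq> DL"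

lemma unary_tables:
  "stau (stau (stau (stau s))) = s"
  "sdual (sdual s) = stau s"
  "stau (sdual s) = sdual (stau s)"
  "slen (stau s) = slen s"
  "slen s + slen (sdual s) = 3"
  "(stau s = E0) = (s = E0)" "(stau s = DL) = (s = DL)"
  "(sdual s = E0) = (s = DL)" "(sdual s = DL) = (s = E0)"
  "smeet s E0 = E0" "smeet E0 s = E0" "smeet s DL = s" "smeet DL s = s" "smeet s s = s"
  "smul s E0 = s" "smul E0 s = s" "sdiv E0 s = s" "sdiv s s = E0" "smul s (sdual s) = DL"
  "sdiv s DL = sdual s"
  "(slen s = 0) = (s = E0)" "slen s \<le> 3" "(slen s = 3) = (s = DL)"
  by (cases s; simp add: slen_def sdual_def stau_def smeet_def smul_def sdiv_def)+

lemma binary_tables_check: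
  "list_all (\<lambda>s. list_all (\<lambda>t.
      smeet s t = smeet t s
    \<and> smeet (stau s) (stau t) = stau (smeet s t)
    \<and> snorm (stau s) (stau t) = map_prod stau stau (snorm s t)
    \<and> smul (stau s) (stau t) = stau (smul s t)
    \<and> (sle s t \<longrightarrow> smul s (sdiv s t) = t \<and> slen s + slen (sdiv s t) = slen t \<and> sle (sdiv s t) (sdual s))
    \<and> (sle t (sdual s) \<longrightarrow> sle s (smul s t) \<and> sdiv s (smul s t) = t \<and> slen (smul s t) = slen s + slen t)
    \<and> sle (smeet s t) s \<and> sle (smeet s t) t
    \<and> lw (fst (snorm s t)) (snd (snorm s t))
    \<and> sle s (fst (snorm s t))
    \<and> (lw s t \<longrightarrow> snorm s t = (s, t) \<and> lw (sdual t) (stau (sdual s)))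
    \<and> slen (fst (snorm s t)) + slen (snd (snorm s t)) = slen s + slen t
    \<and> snorm s DL = (DL, stau s) \<and> snorm s E0 = (s, E0)
    \<and> (sle t (sdual s) \<longrightarrow> snorm s t = (smul s t, E0))) sims) sims"
  by code_simp

text \<open>The facts on triples behind the normal form: taking heads of products respects meets;
  pushing a simple element through a left-weighted pair leaves the outputs left-weighted; at most
  one \<delta> is created; and two successive insertions with simple product amount to one insertion
  of the product.\<close>

lemma ternary_tables_check:
  "list_all (\<lambda>s. list_all (\<lambda>t. list_all (\<lambda>u.
      smeet (smeet s t) u = smeet s (smeet t u)
    \<and> fst (snorm s (smeet t u)) = smeet (fst (snorm s t)) (fst (snorm s u))
    \<and> (lw t u \<longrightarrow> lw (fst (snorm s t)) (fst (snorm (snd (snorm s t)) u)))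
    \<and> (lw t u \<longrightarrow> proper t \<longrightarrow> proper u \<longrightarrow> fst (snorm s t) = DL \<longrightarrow> fst (snorm (snd (snorm s t)) u) \<noteq> DL)
    \<and> (sle t (sdual s) \<longrightarrow>
         (let (t', u') = snorm t u; (s'', t'') = snorm s t' in
           sle u' (sdual t'') \<and> snorm (smul s t) u = (s'', smul t'' u')))) sims) sims) sims"
  by code_simp

section \<open>Group arithmetic and powers of \<delta>\<close>

lemma bmult_assoc: "(x \<cdot> y) \<cdot> z = x \<cdot> (y \<cdot> z)"
  by transfer (simp add: beq.brefl)

lemma bone_left: "bone \<cdot> x = x" and bone_right: "x \<cdot> bone = x"
  by (transfer, simp add: beq.brefl)+

lemma winv_append: "winv (u @ v) = winv v @ winv u"
  by (simp add: winv_def)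

lemma winv_winv: "winv (winv w) = w"
  by (induction w) (auto simp: winv_def)

lemma beq_winv_right: "beq (w @ winv w) []"
proof (induction w)
  case Nil
  show ?case by (simp add: winv_def beq.brefl)
next
  case (Cons l w)
  obtain g b where l: "l = (g, b)" by (cases l)
  have "beq ([l] @ (w @ winv w) @ [(g, \<not> b)]) ([l] @ [] @ [(g, \<not> b)])"
    by (intro beq.bcong beq.brefl Cons.IH)
  moreover have "beq ([l] @ [] @ [(g, \<not> b)]) []"
    using beq.bcancel[of g b] by (simp add: l)
  ultimately show ?case
    by (auto simp: l winv_def intro: beq.btrans)
qed

lemma binv_right: "x \<cdot> binv x = bone"
  by transfer (rule beq_winv_right)

lemma binv_left: "binv x \<cdot> x = bone"
  by transfer (metis beq_winv_right winv_winv)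

lemma binv_right_assoc: "x \<cdot> (binv x \<cdot> y) = y"
  by (simp add: bmult_assoc[symmetric] binv_right bone_left)

lemma binv_left_assoc: "binv x \<cdot> (x \<cdot> y) = y"
  by (simp add: bmult_assoc[symmetric] binv_left bone_left)

lemma binv_unique: "x \<cdot> y = bone \<Longrightarrow> y = binv x"
  by (metis binv_left_assoc bone_right)

lemma binv_binv: "binv (binv x) = x"
  by (metis binv_left binv_unique)

lemma binv_mult: "binv (x \<cdot> y) = binv y \<cdot> binv x"
  by (rule binv_unique[symmetric]) (simp add: bmult_assoc binv_right_assoc binv_right)

lemma binv_bone: "binv bone = bone"
  by (metis binv_unique bone_left)

lemmas gsimps = bmult_assoc bone_left bone_right binv_right binv_left binv_right_assoc
  binv_left_assoc binv_binv binv_mult binv_bone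

lemma bmult_left_cancel: "x \<cdot> y = x \<cdot> z \<longleftrightarrow> y = z"
  by (metis binv_left_assoc)

lemma bprod_simps: "bprod [] = bone" "bprod (x # xs) = x \<cdot> bprod xs"
  by (simp_all add: bprod_def)

lemma bprod_append: "bprod (xs @ ys) = bprod xs \<cdot> bprod ys"
  by (induction xs) (simp_all add: bprod_simps gsimps)

lemma bpow_simps: "bpow x 0 = bone" "bpow x (Suc n) = x \<cdot> bpow x n"
  by (simp_all add: bpow_def bprod_simps)

lemma bpow_add: "bpow x (m + n) = bpow x m \<cdot> bpow x n"
  by (induction m) (simp_all add: bpow_simps gsimps)

lemma bpow_commute: "bpow x n \<cdot> x = x \<cdot> bpow x n"
  by (metis bpow_add bpow_simps bone_right plus_1_eq_Suc add.commute One_nat_def)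

lemma dpow_0: "dpow 0 = bone"
  by (simp add: dpow_def bpow_simps)

lemma dpow_Suc: "dpow (k + 1) = delta \<cdot> dpow k"
proof (cases "k \<ge> 0")
  case True
  then show ?thesis by (simp add: dpow_def nat_add_distrib bpow_simps)
next
  case False
  then obtain n where n: "k = - int (Suc n)"
    by (metis not_le nat_int nonneg_int_cases minus_minus neg_0_less_iff_less not0_implies_Suc of_nat_0 less_irrefl le_cases neg_0_le_iff_le)
  have "dpow (k + 1) = bpow (binv delta) n"
    by (auto simp: dpow_def n bpow_simps)
  moreover have "dpow k = binv delta \<cdot> bpow (binv delta) n"
    by (simp add: dpow_def n bpow_simps nat_add_distrib)
  ultimately show ?thesis by (simp add: gsimps)
qed

lemma dpow_1: "dpow 1 = delta"
  using dpow_Suc[of 0] by (simp add: dpow_0 gsimps)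

lemma dpow_add: "dpow (j + k) = dpow j \<cdot> dpow k"
proof (induction j rule: int_induct[where k = 0])
  case base
  show ?case by (simp add: dpow_0 gsimps)
next
  case (step1 i)
  then show ?case
    using dpow_Suc[of "i + k"] dpow_Suc[of i] by (simp add: gsimps algebra_simps)
next
  case (step2 i)
  have "delta \<cdot> dpow (i - 1 + k) = delta \<cdot> (dpow (i - 1) \<cdot> dpow k)"
    using step2 dpow_Suc[of "i - 1 + k"] dpow_Suc[of "i - 1"] by (simp add: gsimps algebra_simps)
  then show ?case by (simp add: bmult_left_cancel)
qed

lemma binv_dpow: "binv (dpow k) = dpow (- k)"
  by (rule binv_unique[symmetric]) (simp add: dpow_add[symmetric] dpow_0)

lemma dpow_cancel: "dpow j \<cdot> (dpow k \<cdot> x) = dpow (j + k) \<cdot> x"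
  by (simp add: dpow_add gsimps)

lemma braid_relations:
  "sigma S1 \<cdot> (sigma S2 \<cdot> sigma S1) = sigma S2 \<cdot> (sigma S1 \<cdot> sigma S2)"
  "sigma S2 \<cdot> (sigma S3 \<cdot> sigma S2) = sigma S3 \<cdot> (sigma S2 \<cdot> sigma S3)"
  "sigma S3 \<cdot> sigma S1 = sigma S1 \<cdot> sigma S3"
  by (transfer, simp add: beq.bbr12 beq.bbr23 beq.bsym[OF beq.bcomm])+

lemma sigma_delta:
  "sigma S2 \<cdot> delta = delta \<cdot> sigma S1" "sigma S3 \<cdot> delta = delta \<cdot> sigma S2"
  using braid_relations
  by (simp_all add: delta_def) (metis bmult_assoc)+

section \<open>The simple elements as braids\<close>

definition br :: "sim \<Rightarrow> braid" where
  "br s = (case s of E0 \<Rightarrow> bone | A12 \<Rightarrow> bkl_a 1 2 | A13 \<Rightarrow> bkl_a 1 3 | A14 \<Rightarrow> bkl_a 1 4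
     | A23 \<Rightarrow> bkl_a 2 3 | A24 \<Rightarrow> bkl_a 2 4 | A34 \<Rightarrow> bkl_a 3 4
     | T123 \<Rightarrow> bkl_a 1 2 \<cdot> bkl_a 2 3 | T124 \<Rightarrow> bkl_a 1 2 \<cdot> bkl_a 2 4 | T134 \<Rightarrow> bkl_a 1 3 \<cdot> bkl_a 3 4
     | T234 \<Rightarrow> bkl_a 2 3 \<cdot> bkl_a 3 4 | P12 \<Rightarrow> bkl_a 1 2 \<cdot> bkl_a 3 4 | P14 \<Rightarrow> bkl_a 1 4 \<cdot> bkl_a 2 3
     | DL \<Rightarrow> delta)"

lemma br_simps:
  "br E0 = bone" "br DL = delta"
  "br A12 = sigma S1" "br A23 = sigma S2" "br A34 = sigma S3"
  "br A13 = binv (sigma S2) \<cdot> (sigma S1 \<cdot> sigma S2)"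
  "br A24 = binv (sigma S3) \<cdot> (sigma S2 \<cdot> sigma S3)"
  "br A14 = binv (sigma S3) \<cdot> (binv (sigma S2) \<cdot> (sigma S1 \<cdot> (sigma S2 \<cdot> sigma S3)))"
  by (simp_all add: br_def bkl_a_def gsimps)

lemma br_len2:
  "br T123 = br A12 \<cdot> br A23" "br T124 = br A12 \<cdot> br A24" "br T134 = br A13 \<cdot> br A34"
  "br T234 = br A23 \<cdot> br A34" "br P12 = br A12 \<cdot> br A34" "br P14 = br A14 \<cdot> br A23"
  by (simp_all add: br_def)

abbreviation btau :: "braid \<Rightarrow> braid" where
  "btau x \<equiv> binv delta \<cdot> (x \<cdot> delta)"

lemma btau_mult: "btau (x \<cdot> y) = btau x \<cdot> btau y"
  by (simp add: gsimps)

lemma btau_atoms: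
  "btau (br A23) = br A12" "btau (br A34) = br A23" "btau (br A12) = br A14"
  "btau (br A14) = br A34" "btau (br A13) = br A24" "btau (br A24) = br A13"
proof -
  let ?a = "sigma S1" and ?b = "sigma S2" and ?c = "sigma S3"
  note sd = sigma_delta
  show "btau (br A23) = br A12" "btau (br A34) = br A23"
    by (simp_all add: br_simps sd gsimps)
  show a14: "btau (br A12) = br A14"
    by (simp add: br_simps delta_def gsimps)
  have bd: "delta \<cdot> (?a \<cdot> w) = ?b \<cdot> (delta \<cdot> w)" "delta \<cdot> (?b \<cdot> w) = ?c \<cdot> (delta \<cdot> w)" for w
    by (metis bmult_assoc sd(1), metis bmult_assoc sd(2))
  have "br A14 \<cdot> delta = binv ?c \<cdot> (binv ?b \<cdot> (delta \<cdot> delta))"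
    by (simp add: br_simps delta_def gsimps)
  also have "\<dots> = binv ?c \<cdot> (binv ?b \<cdot> (delta \<cdot> (?a \<cdot> (?b \<cdot> ?c))))"
    by (simp add: delta_def gsimps)
  also have "\<dots> = delta \<cdot> ?c"
    by (simp add: bd gsimps)
  finally show "btau (br A14) = br A34"
    by (simp add: br_simps gsimps)
  have A24': "br A24 = binv ?c \<cdot> (?b \<cdot> ?c)" by (simp add: br_simps)
  have bd': "?b \<cdot> (delta \<cdot> w) = delta \<cdot> (?a \<cdot> w)" "?c \<cdot> (delta \<cdot> w) = delta \<cdot> (?b \<cdot> w)"
    "binv ?c \<cdot> (delta \<cdot> w) = delta \<cdot> (binv ?b \<cdot> w)" "binv ?b \<cdot> (delta \<cdot> w) = delta \<cdot> (binv ?a \<cdot> w)" for w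
    using bd by (simp, simp, metis binv_left_assoc binv_right_assoc, metis binv_left_assoc binv_right_assoc)
  have "br A24 \<cdot> delta = delta \<cdot> br A13"
    by (simp add: br_simps gsimps sd bd')
  then show "btau (br A24) = br A13" by (simp add: gsimps)
  have "?a \<cdot> delta = delta \<cdot> br A14" using a14 by (simp add: br_simps gsimps) (metis binv_right_assoc)
  moreover have "br A14 \<cdot> ?a = binv ?c \<cdot> (binv ?b \<cdot> (delta \<cdot> ?a))"
    by (simp add: br_simps delta_def gsimps)
  then have "br A14 \<cdot> ?a = binv ?c \<cdot> delta"
    by (simp add: sd(1)[symmetric] gsimps)
  ultimately have "?a \<cdot> (?b \<cdot> delta) = delta \<cdot> (binv ?c \<cdot> delta)"
    by (simp add: sd) (metis bmult_assoc)
  then have "br A13 \<cdot> delta = binv ?b \<cdot> (delta \<cdot> (binv ?c \<cdot> delta))"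
    by (simp add: br_simps gsimps)
  also have "\<dots> = delta \<cdot> (binv ?a \<cdot> (binv ?c \<cdot> (?a \<cdot> (?b \<cdot> ?c))))"
    by (simp add: bd' gsimps) (simp add: delta_def gsimps)
  also have "binv ?a \<cdot> (binv ?c \<cdot> (?a \<cdot> (?b \<cdot> ?c))) = br A24"
    using braid_relations(3) by (simp add: br_simps) (metis binv_left_assoc bmult_assoc binv_mult)
  finally show "btau (br A13) = br A24" by (simp add: gsimps)
qed

text \<open>The braid relations give the factorizations of one triangle and the commutation of one
  pair; conjugation by \<delta> rotates these to all others.\<close>

lemma atom_products:
  "br A12 \<cdot> br A23 = br T123" "br A23 \<cdot> br A13 = br T123" "br A13 \<cdot> br A12 = br T123"
  "br A14 \<cdot> br A12 = br T124" "br A12 \<cdot> br A24 = br T124" "br A24 \<cdot> br A14 = br T124"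
  "br A34 \<cdot> br A14 = br T134" "br A14 \<cdot> br A13 = br T134" "br A13 \<cdot> br A34 = br T134"
  "br A23 \<cdot> br A34 = br T234" "br A34 \<cdot> br A24 = br T234" "br A24 \<cdot> br A23 = br T234"
  "br A12 \<cdot> br A34 = br P12" "br A34 \<cdot> br A12 = br P12"
  "br A14 \<cdot> br A23 = br P14" "br A23 \<cdot> br A14 = br P14"
proof -
  have t0: "br A12 \<cdot> br A23 = br T123" "br A23 \<cdot> br A13 = br T123" "br A13 \<cdot> br A12 = br T123"
    using braid_relations(1) by (simp_all add: br_len2 br_simps gsimps)
  then show "br A12 \<cdot> br A23 = br T123" "br A23 \<cdot> br A13 = br T123" "br A13 \<cdot> br A12 = br T123"
    by simp_all
  have step: "btau (br a) \<cdot> btau (br b) = btau (br c) \<cdot> btau (br d)" if "br a \<cdot> br b = br c \<cdot> br d" for a b c d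
    using that by (metis btau_mult)
  have t1: "br A14 \<cdot> br A12 = br A12 \<cdot> br A24" "br A12 \<cdot> br A24 = br A24 \<cdot> br A14"
    using step[of A12 A23 A23 A13] step[of A23 A13 A13 A12] t0 unfolding btau_atoms by simp_all
  have t2: "br A34 \<cdot> br A14 = br A14 \<cdot> br A13" "br A14 \<cdot> br A13 = br A13 \<cdot> br A34"
    using step[of A14 A12 A12 A24] step[of A12 A24 A24 A14] t1 unfolding btau_atoms by simp_all
  have t3: "br A23 \<cdot> br A34 = br A34 \<cdot> br A24" "br A34 \<cdot> br A24 = br A24 \<cdot> br A23"
    using step[of A34 A14 A14 A13] step[of A14 A13 A13 A34] t2 unfolding btau_atoms by simp_all
  have p: "br A12 \<cdot> br A34 = br A34 \<cdot> br A12"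
    using braid_relations(3) by (simp add: br_simps)
  have q: "br A14 \<cdot> br A23 = br A23 \<cdot> br A14"
    using step[of A12 A34 A34 A12] p unfolding btau_atoms by simp
  show "br A14 \<cdot> br A12 = br T124" "br A12 \<cdot> br A24 = br T124" "br A24 \<cdot> br A14 = br T124"
    "br A34 \<cdot> br A14 = br T134" "br A14 \<cdot> br A13 = br T134" "br A13 \<cdot> br A34 = br T134"
    "br A23 \<cdot> br A34 = br T234" "br A34 \<cdot> br A24 = br T234" "br A24 \<cdot> br A23 = br T234"
    "br A12 \<cdot> br A34 = br P12" "br A34 \<cdot> br A12 = br P12"
    "br A14 \<cdot> br A23 = br P14" "br A23 \<cdot> br A14 = br P14"
    using t1 t2 t3 p q by (simp_all add: br_len2)
qed

lemma btau_br: "btau (br s) = br (stau s)"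
proof -
  have len2: "btau (br u) = br (stau u)"
    if "br a \<cdot> br b = br u" "btau (br a) = br a'" "btau (br b) = br b'" "br a' \<cdot> br b' = br (stau u)" for a b a' b' u
    using that by (metis btau_mult)
  show ?thesis
  proof (cases s)
    case T123
    show ?thesis unfolding T123
      by (rule len2[OF atom_products(1) btau_atoms(3) btau_atoms(1)]) (simp add: stau_def atom_products)
  next
    case T124
    show ?thesis unfolding T124
      by (rule len2[OF atom_products(4) btau_atoms(4) btau_atoms(3)]) (simp add: stau_def atom_products)
  next
    case T134
    show ?thesis unfolding T134
      by (rule len2[OF atom_products(7) btau_atoms(2) btau_atoms(4)]) (simp add: stau_def atom_products)
  next
    case T234
    show ?thesis unfolding T234
      by (rule len2[OF atom_products(10) btau_atoms(1) btau_atoms(2)]) (simp add: stau_def atom_products)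
  next
    case P12
    show ?thesis unfolding P12
      by (rule len2[OF atom_products(13) btau_atoms(3) btau_atoms(2)]) (simp add: stau_def atom_products)
  next
    case P14
    show ?thesis unfolding P14
      by (rule len2[OF atom_products(15) btau_atoms(4) btau_atoms(1)]) (simp add: stau_def atom_products)
  qed (simp_all only: btau_atoms stau_def sim.case, simp_all add: br_simps gsimps)
qed

text \<open>If u v = \<delta>, then also \<tau>(u) \<tau>(v) = \<delta> and v \<tau>(u) = \<delta>.
  Hence one factorization into a triangle and a side and one into a pair and a diagonal generate all
  nontrivial ones.\<close>

lemma br_sdual: "br s \<cdot> br (sdual s) = delta"
proof -
  have conj: "br (stau u) \<cdot> br (stau v) = delta" if "br u \<cdot> br v = delta" for u v
    using that by (simp add: btau_br[symmetric] gsimps) (metis binv_left_assoc bmult_assoc)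
  have flip: "br v \<cdot> br (stau u) = delta" if "br u \<cdot> br v = delta" for u v
    using that by (simp add: btau_br[symmetric] gsimps) (metis binv_left_assoc binv_right_assoc bmult_assoc)
  have t0: "br T123 \<cdot> br A34 = delta"
    by (simp add: br_len2 br_simps delta_def gsimps)
  have p0: "br P12 \<cdot> br A24 = delta"
    by (simp add: br_len2 br_simps delta_def gsimps)
  have t1: "br T124 \<cdot> br A23 = delta" using conj[OF t0] by (simp add: stau_def)
  have t2: "br T134 \<cdot> br A12 = delta" using conj[OF t1] by (simp add: stau_def)
  have t3: "br T234 \<cdot> br A14 = delta" using conj[OF t2] by (simp add: stau_def)
  have p1: "br P14 \<cdot> br A13 = delta" using conj[OF p0] by (simp add: stau_def)
  show ?thesis
    using t0 t1 t2 t3 p0 p1 flip[OF t0] flip[OF t1] flip[OF t2] flip[OF t3] flip[OF p0] flip[OF p1]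
    by (cases s) (simp_all add: sdual_def stau_def br_simps(1,2) gsimps)
qed

lemma br_smul: "sle t (sdual s) \<Longrightarrow> br s \<cdot> br t = br (smul s t)"
  using br_sdual[of s]
  by (cases s; cases t) (simp_all add: sle_def smeet_def sdual_def smul_def atom_products br_simps(1,2) gsimps)

section \<open>Normal forms\<close>

text \<open>As \<tau> has order four on simple elements, reducing the exponent modulo 4 yields
  negative powers as well.\<close>

definition taup :: "int \<Rightarrow> sim \<Rightarrow> sim" where
  "taup p s = (stau ^^ nat (p mod 4)) s"

lemma stau_pow4: "(stau ^^ 4) s = s"
  by (simp add: unary_tables numeral_eq_Suc)

lemma stau_funpow_mod: "(stau ^^ (n mod 4)) s = (stau ^^ n) s"
  by (rule funpow_mod_eq) (rule stau_pow4)

lemma taup_0: "taup 0 s = s"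
  by (simp add: taup_def)

lemma taup_Suc: "taup (p + 1) s = stau (taup p s)"
proof -
  have "nat ((p + 1) mod 4) = Suc (nat (p mod 4)) mod 4"
  proof -
    have "(p + 1) mod 4 = (p mod 4 + 1) mod 4" by (simp add: mod_simps)
    moreover have "p mod 4 = 0 \<or> p mod 4 = 1 \<or> p mod 4 = 2 \<or> p mod 4 = 3" by presburger
    ultimately show ?thesis by auto
  qed
  then show ?thesis
    unfolding taup_def using stau_funpow_mod[of "Suc (nat (p mod 4))" s] by simp
qed

lemma taup_1: "taup 1 s = stau s"
  using taup_Suc[of 0 s] by (simp add: taup_0)

lemma taup_add: "taup (p + q) s = taup p (taup q s)"
proof (induction p rule: int_induct[where k = 0])
  case base
  show ?case by (simp add: taup_0)
next
  case (step1 i)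
  then show ?case using taup_Suc[of "i + q" s] taup_Suc[of i "taup q s"] by (simp add: algebra_simps)
next
  case (step2 i)
  have "stau (taup (i - 1 + q) s) = stau (taup (i - 1) (taup q s))"
    using step2 taup_Suc[of "i - 1 + q" s] taup_Suc[of "i - 1" "taup q s"] by (simp add: algebra_simps)
  then show ?case by (metis unary_tables(1))
qed

lemma taup_neg: "taup p (taup (- p) s) = s" "taup (- p) (taup p s) = s"
  using taup_add[of p "- p" s] taup_add[of "- p" p s] by (simp_all add: taup_0)

lemma taup_4: "4 dvd p \<Longrightarrow> taup p s = s"
  by (simp add: taup_def dvd_eq_mod_eq_0)

lemma binary_tables:
  "smeet s t = smeet t s"
  "smeet (stau s) (stau t) = stau (smeet s t)"
  "snorm (stau s) (stau t) = map_prod stau stau (snorm s t)"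
  "smul (stau s) (stau t) = stau (smul s t)"
  "sle s t \<Longrightarrow> smul s (sdiv s t) = t" "sle s t \<Longrightarrow> slen s + slen (sdiv s t) = slen t"
  "sle s t \<Longrightarrow> sle (sdiv s t) (sdual s)"
  "sle t (sdual s) \<Longrightarrow> sle s (smul s t)" "sle t (sdual s) \<Longrightarrow> sdiv s (smul s t) = t"
  "sle t (sdual s) \<Longrightarrow> slen (smul s t) = slen s + slen t"
  "sle (smeet s t) s" "sle (smeet s t) t"
  "lw (fst (snorm s t)) (snd (snorm s t))"
  "sle s (fst (snorm s t))"
  "lw s t \<Longrightarrow> snorm s t = (s, t)" "lw s t \<Longrightarrow> lw (sdual t) (stau (sdual s))"
  "slen (fst (snorm s t)) + slen (snd (snorm s t)) = slen s + slen t"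
  "snorm s DL = (DL, stau s)" "snorm s E0 = (s, E0)"
  "sle t (sdual s) \<Longrightarrow> snorm s t = (smul s t, E0)"
  using all_simsI[OF all_simsI[OF binary_tables_check, of s], of t] by blast+

lemma ternary_tables:
  "smeet (smeet s t) u = smeet s (smeet t u)"
  "fst (snorm s (smeet t u)) = smeet (fst (snorm s t)) (fst (snorm s u))"
  "lw t u \<Longrightarrow> lw (fst (snorm s t)) (fst (snorm (snd (snorm s t)) u))"
  "lw t u \<Longrightarrow> proper t \<Longrightarrow> proper u \<Longrightarrow> fst (snorm s t) = DL \<Longrightarrow> fst (snorm (snd (snorm s t)) u) \<noteq> DL"
  "sle t (sdual s) \<Longrightarrow> sle (snd (snorm t u)) (sdual (snd (snorm s (fst (snorm t u)))))"
  "sle t (sdual s) \<Longrightarrow> snorm (smul s t) u =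
     (fst (snorm s (fst (snorm t u))), smul (snd (snorm s (fst (snorm t u)))) (snd (snorm t u)))"
  using all_simsI[OF all_simsI[OF all_simsI[OF ternary_tables_check, of s], of t], of u]
  by (auto simp: Let_def split: prod.splits)

lemma sle_simps: "sle E0 s" "sle s DL" "sle s s" "sle s E0 \<longleftrightarrow> s = E0" "sle DL s \<longleftrightarrow> s = DL"
  by (auto simp: sle_def unary_tables)

lemma stau_E0: "stau E0 = E0"
  by (simp add: stau_def)

lemma snorm_E0: "snorm E0 t = (t, E0)"
  by (cases t; simp add: snorm_def Let_def sdual_def smeet_def smul_def sdiv_def)

lemma lw_simps: "lw s E0" "lw DL s" "lw s DL \<longleftrightarrow> s = DL" "lw E0 s \<longleftrightarrow> s = E0"
  by (cases s; simp add: lw_def sdual_def smeet_def)+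

lemma lw_stau: "lw (stau s) (stau t) \<longleftrightarrow> lw s t"
  by (simp only: lw_def unary_tables(3)[symmetric] binary_tables(2) unary_tables(6))

lemma taup_induct:
  assumes "\<And>x y. P x y \<Longrightarrow> P (stau x) (stau y)" "P s t"
  shows "P (taup p s) (taup p t)"
proof -
  have "P ((stau ^^ n) s) ((stau ^^ n) t)" for n
    by (induction n) (auto simp: assms)
  then show ?thesis by (simp add: taup_def)
qed

lemma lw_taup: "lw (taup p s) (taup p t) \<longleftrightarrow> lw s t"
  using taup_induct[where P = lw and p = p, of s t]
    taup_induct[where P = lw and p = "- p", of "taup p s" "taup p t"]
  by (auto simp: lw_stau taup_neg)

lemma taup_inj: "taup p s = taup p t \<longleftrightarrow> s = t"
  by (metis taup_neg(2))

lemma taup_const: "taup p E0 = E0" "taup p DL = DL"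
proof -
  have "(stau ^^ n) E0 = E0" "(stau ^^ n) DL = DL" for n
    by (induction n) (auto simp: unary_tables)
  then show "taup p E0 = E0" "taup p DL = DL" by (simp_all add: taup_def)
qed

lemma proper_taup: "proper (taup p s) \<longleftrightarrow> proper s"
  unfolding proper_def by (metis taup_const taup_neg(2))

lemma slen_taup: "slen (taup p s) = slen s"
proof -
  have "slen ((stau ^^ n) s) = slen s" for n
    by (induction n) (auto simp: unary_tables)
  then show ?thesis by (simp add: taup_def)
qed

lemma sdual_taup: "sdual (taup p s) = taup p (sdual s)"
proof -
  have "sdual ((stau ^^ n) s) = (stau ^^ n) (sdual s)" for n
    by (induction n) (auto simp: unary_tables(3)[symmetric])
  then show ?thesis by (simp add: taup_def)
qed

lemma smeet_taup: "smeet (taup p s) (taup p t) = taup p (smeet s t)"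
proof -
  have "smeet ((stau ^^ n) s) ((stau ^^ n) t) = (stau ^^ n) (smeet s t)" for n
    by (induction n) (auto simp: binary_tables(2))
  then show ?thesis by (simp add: taup_def)
qed

lemma sle_taup: "sle (taup p s) (taup p t) \<longleftrightarrow> sle s t"
  by (simp add: sle_def smeet_taup taup_inj)

lemma smul_taup: "smul (taup p s) (taup p t) = taup p (smul s t)"
proof -
  have "smul ((stau ^^ n) s) ((stau ^^ n) t) = (stau ^^ n) (smul s t)" for n
    by (induction n) (auto simp: binary_tables(4))
  then show ?thesis by (simp add: taup_def)
qed

lemma br_delta: "br s \<cdot> delta = delta \<cdot> br (stau s)"
  by (simp add: btau_br[symmetric] gsimps)

lemma br_dpow: "br s \<cdot> dpow p = dpow p \<cdot> br (taup p s)"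
proof (induction p arbitrary: s rule: int_induct[where k = 0])
  case base
  show ?case by (simp add: dpow_0 taup_0 gsimps)
next
  case (step1 i)
  have "br s \<cdot> dpow (i + 1) = delta \<cdot> (br (stau s) \<cdot> dpow i)"
    by (simp add: dpow_Suc bmult_assoc[symmetric] br_delta)
  also have "\<dots> = dpow (i + 1) \<cdot> br (taup (i + 1) s)"
    using step1.IH[of "stau s"] by (simp add: dpow_Suc gsimps taup_add taup_1)
  finally show ?case .
next
  case (step2 i)
  let ?t = "taup (- 1) s"
  have st: "stau ?t = s" using taup_add[of 1 "-1" s] by (simp add: taup_0 taup_1)
  have "delta \<cdot> (br s \<cdot> dpow (i - 1)) = br ?t \<cdot> dpow i"
    using dpow_Suc[of "i - 1"] br_delta[of ?t] by (simp add: st) (metis bmult_assoc)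
  also have "\<dots> = delta \<cdot> (dpow (i - 1) \<cdot> br (taup i ?t))"
    using step2.IH[of ?t] dpow_Suc[of "i - 1"] by (simp add: gsimps)
  finally show ?case by (simp add: bmult_left_cancel taup_add[symmetric])
qed

text \<open>Left multiplication of a left-weighted word by a simple element: each letter is
  normalized with the incoming one, and the remainder travels on. Stopping at \<open>E0\<close>
  keeps trivial letters out of the word.\<close>

fun ins :: "sim \<Rightarrow> sim list \<Rightarrow> sim list" where
  "ins s [] = (if s = E0 then [] else [s])"
| "ins s (y # ys) = (if s = E0 then y # ys else fst (snorm s y) # ins (snd (snorm s y)) ys)"

definition hdE :: "sim list \<Rightarrow> sim" where
  "hdE xs = (case xs of [] \<Rightarrow> E0 | x # _ \<Rightarrow> x)"

lemma hdE_simps: "hdE [] = E0" "hdE (x # xs) = x"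
  by (simp_all add: hdE_def)

lemma successively_lw_Cons: "successively lw (x # xs) \<longleftrightarrow> lw x (hdE xs) \<and> successively lw xs"
  by (cases xs) (simp_all add: hdE_simps lw_simps)

lemma hdE_ins: "hdE (ins s ys) = fst (snorm s (hdE ys))"
  by (cases ys) (auto simp: hdE_simps snorm_E0 binary_tables(19))

lemma ins_E0: "ins E0 ys = ys"
  by (cases ys) simp_all

lemma fst_snorm_E0: "fst (snorm s t) = E0 \<Longrightarrow> s = E0"
  using binary_tables(14)[of s t] by (simp add: sle_simps)

lemma ins_not_E0: "E0 \<notin> set ys \<Longrightarrow> E0 \<notin> set (ins s ys)"
  by (induction ys arbitrary: s) (auto dest: fst_snorm_E0[OF sym])

lemma ins_lw: "successively lw ys \<Longrightarrow> successively lw (ins s ys)"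
proof (induction ys arbitrary: s)
  case Nil
  then show ?case by simp
next
  case (Cons y ys)
  then show ?case
    using ternary_tables(3)[of y "hdE ys" s]
    by (simp add: successively_lw_Cons hdE_ins)
qed

lemma lw_not_DL: "successively lw (x # xs) \<Longrightarrow> x \<noteq> DL \<Longrightarrow> DL \<notin> set xs"
proof (induction xs arbitrary: x)
  case (Cons a xs)
  then have "a \<noteq> DL" by (auto simp: lw_simps)
  then show ?case using Cons.IH[of a] Cons.prems by auto
qed simp

definition nform :: "int \<times> sim list \<Rightarrow> bool" where
  "nform \<omega> \<longleftrightarrow> list_all proper (snd \<omega>) \<and> successively lw (snd \<omega>)"

definition pull :: "int \<Rightarrow> sim list \<Rightarrow> int \<times> sim list" where
  "pull p xs = (if hdE xs = DL then (p + 1, tl xs) else (p, xs))"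

text \<open>In front of \<delta>^p w, the letter \<open>s\<close> passes \<delta>^p at the cost of p
  rotations and is inserted into w; a \<delta> that appears in front is absorbed by the
  exponent.\<close>

definition act :: "sim \<Rightarrow> int \<times> sim list \<Rightarrow> int \<times> sim list" where
  "act s \<omega> = pull (fst \<omega>) (ins (taup (fst \<omega>) s) (snd \<omega>))"

definition val :: "int \<times> sim list \<Rightarrow> braid" where
  "val \<omega> = dpow (fst \<omega>) \<cdot> bprod (map br (snd \<omega>))"

lemma list_all_proper: "list_all proper xs \<longleftrightarrow> E0 \<notin> set xs \<and> DL \<notin> set xs"
  by (auto simp: list_all_iff proper_def)

text \<open>After a leading \<delta> no second one can follow: by lengths if the word ends there, by
  the tables on triples otherwise. Further inside none can appear because the result is
  left-weighted.\<close>

lemma ins_proper_tl: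
  assumes "list_all proper ys" "successively lw ys"
  shows "list_all proper (tl (ins s ys))"
proof (cases ys)
  case Nil
  then show ?thesis by simp
next
  case (Cons y zs)
  have nE: "E0 \<notin> set (ins s ys)" and lw: "successively lw (ins s ys)"
    using assms ins_not_E0 ins_lw by (auto simp: list_all_proper)
  show ?thesis
  proof (cases "s = E0")
    case True
    then show ?thesis using assms Cons by simp
  next
    case s: False
    then obtain x xs where x: "ins s ys = x # xs" by (simp add: Cons)
    show ?thesis
    proof (cases "x = DL")
      case False
      then show ?thesis using lw nE lw_not_DL[of x xs] by (simp add: x list_all_proper)
    next
      case True
      then have d: "fst (snorm s y) = DL" and xs: "xs = ins (snd (snorm s y)) zs"
        using x s Cons by auto
      have "hdE xs \<noteq> DL"
      proof (cases zs)
        case Nil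
        have "slen (snd (snorm s y)) \<noteq> 3"
          using binary_tables(17)[of s y] d assms(1) Cons unary_tables(22)[of s] unary_tables(23)[of y]
            unary_tables(22)[of y]
          by (auto simp: slen_def proper_def split: sim.splits)
        then have "snd (snorm s y) \<noteq> DL" by (auto simp: slen_def)
        then show ?thesis by (simp add: xs Nil hdE_def)
      next
        case (Cons z zs')
        then have "lw y z" "proper y" "proper z"
          using assms \<open>ys = y # zs\<close> by auto
        then have "fst (snorm (snd (snorm s y)) z) \<noteq> DL"
          using ternary_tables(4) d by blast
        then show ?thesis unfolding xs hdE_ins Cons hdE_simps .
      qed
      then show ?thesis
        using lw nE lw_not_DL[of "hd xs" "tl xs"] by (cases xs) (auto simp: x list_all_proper hdE_simps proper_def)
    qed
  qed
qed

lemma nform_act: "nform \<omega> \<Longrightarrow> nform (act s \<omega>)"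
proof -
  assume n: "nform \<omega>"
  let ?zs = "ins (taup (fst \<omega>) s) (snd \<omega>)"
  have tl: "list_all proper (tl ?zs)" and lw: "successively lw ?zs" and nE: "E0 \<notin> set ?zs"
    using n ins_proper_tl ins_lw ins_not_E0 by (auto simp: nform_def list_all_proper)
  show ?thesis
    using tl lw nE
    by (cases ?zs) (auto simp: nform_def act_def pull_def hdE_simps successively_lw_Cons list_all_proper)
qed

lemma bprod_ins: "bprod (map br (ins s ys)) = br s \<cdot> bprod (map br ys)"
proof (induction ys arbitrary: s)
  case Nil
  then show ?case by (simp add: bprod_simps br_simps gsimps)
next
  case (Cons y ys)
  let ?m = "smeet (sdual s) y"
  have "br s \<cdot> br y = br s \<cdot> (br ?m \<cdot> br (sdiv ?m y))"
    using br_smul[of "sdiv ?m y" ?m] binary_tables(5,7)[of ?m y] binary_tables(12)[of "sdual s" y] by simp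
  also have "\<dots> = br (fst (snorm s y)) \<cdot> br (snd (snorm s y))"
    using br_smul[of ?m s] binary_tables(11)[of "sdual s" y]
    by (simp add: snorm_def Let_def bmult_assoc[symmetric])
  finally show ?case
    using Cons.IH by (simp add: bprod_simps br_simps gsimps) (metis bmult_assoc)
qed

lemma val_act: "val (act s \<omega>) = br s \<cdot> val \<omega>"
proof -
  let ?p = "fst \<omega>" and ?zs = "ins (taup (fst \<omega>) s) (snd \<omega>)"
  have "val (pull ?p ?zs) = dpow ?p \<cdot> bprod (map br ?zs)"
    using dpow_add[of ?p 1]
    by (cases ?zs) (auto simp: val_def pull_def hdE_simps bprod_simps br_simps dpow_1 gsimps)
  then show ?thesis
    using br_dpow[of s ?p] by (simp add: act_def bprod_ins val_def bmult_assoc[symmetric])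
qed

text \<open>Pushing \<open>t\<close> and then \<open>s\<close> past a letter leaves two remainders
  with simple product, and this product is the remainder left by \<open>smul s t\<close>. The tables
  on triples supply exactly this induction step.\<close>

lemma ins_comp:
  assumes "sle t (sdual s)" "E0 \<notin> set ys"
  shows "ins s (ins t ys) = ins (smul s t) ys"
  using assms
proof (induction ys arbitrary: s t)
  case Nil
  have "slen (smul s t) = slen s + slen t" using Nil binary_tables(10) by simp
  then have "s \<noteq> E0 \<Longrightarrow> smul s t \<noteq> E0" by (metis unary_tables(21) add_is_0)
  then show ?case
    using Nil binary_tables(20)[of t s] by (auto simp: unary_tables)
next
  case (Cons y ys)
  have "slen (smul s t) = slen s + slen t" using Cons.prems binary_tables(10) by simp
  then have ne: "s \<noteq> E0 \<Longrightarrow> smul s t \<noteq> E0" by (metis unary_tables(21) add_is_0)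
  show ?case
  proof (cases "t = E0 \<or> s = E0")
    case True
    then show ?thesis by (auto simp: unary_tables ins_E0)
  next
    case False
    then show ?thesis
      using ternary_tables(5,6)[of t s y] Cons ne by simp
  qed
qed

lemma ins_id: "successively lw (y # ys) \<Longrightarrow> E0 \<notin> set (y # ys) \<Longrightarrow> ins y ys = y # ys"
  by (induction ys arbitrary: y) (auto simp: binary_tables(15))

lemma act_DL: "nform \<omega> \<Longrightarrow> act DL \<omega> = (fst \<omega> + 1, snd \<omega>)"
proof -
  assume "nform \<omega>"
  moreover have "ins DL xs = DL # xs" if "successively lw xs" "E0 \<notin> set xs" for xs
    using that ins_id[of DL xs] by (auto simp: successively_lw_Cons lw_simps)
  ultimately show ?thesis
    by (simp add: act_def taup_const nform_def list_all_proper pull_def hdE_simps)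
qed

lemma act_shift: "act s (fst \<omega> + k, snd \<omega>) = (fst (act (taup k s) \<omega>) + k, snd (act (taup k s) \<omega>))"
  by (simp add: act_def taup_add) (simp add: pull_def)

lemma act_comp:
  assumes "nform \<omega>" "sle t (sdual s)"
  shows "act s (act t \<omega>) = act (smul s t) \<omega>"
proof -
  let ?p = "fst \<omega>" and ?xs = "snd \<omega>"
  let ?s = "taup ?p s" and ?t = "taup ?p t"
  have xs: "list_all proper ?xs" "successively lw ?xs" "E0 \<notin> set ?xs"
    using assms by (auto simp: nform_def list_all_proper)
  have eq: "ins ?s (ins ?t ?xs) = ins (taup ?p (smul s t)) ?xs"
    using ins_comp[of ?t ?s ?xs] assms xs by (simp add: sdual_taup sle_taup smul_taup)
  show ?thesis
  proof (cases "hdE (ins ?t ?xs) = DL")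
    case False
    then show ?thesis using eq by (simp add: act_def pull_def)
  next
    case True
    then obtain zs where zs: "ins ?t ?xs = DL # zs" by (cases "ins ?t ?xs") (auto simp: hdE_simps)
    have e: "ins (taup ?p (smul s t)) ?xs = DL # ins (stau ?s) zs"
      using eq zs
      by (cases "?s = E0") (auto simp: binary_tables(18) stau_E0 ins_E0)
    then have "list_all proper (ins (stau ?s) zs)"
      using ins_proper_tl[OF xs(1,2), of "taup ?p (smul s t)"] by simp
    then have "hdE (ins (stau ?s) zs) \<noteq> DL"
      by (cases "ins (stau ?s) zs") (auto simp: hdE_simps proper_def)
    moreover have "taup (?p + 1) s = stau ?s" by (rule taup_Suc)
    ultimately show ?thesis
      by (simp add: act_def[of _ "(_, _)"] act_def[of t] act_def[of "smul s t"] zs e pull_def hdE_simps)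
  qed
qed

section \<open>The action of braid words on normal forms\<close>

definition satom :: "sgen \<Rightarrow> sim" where
  "satom g = (case g of S1 \<Rightarrow> A12 | S2 \<Rightarrow> A23 | S3 \<Rightarrow> A34)"

text \<open>The inverse of an atom is its complement times \<delta>^-1. An inverse generator
  therefore lowers the exponent and then multiplies by the complement.\<close>

definition gact :: "sgen \<times> bool \<Rightarrow> int \<times> sim list \<Rightarrow> int \<times> sim list" where
  "gact l \<omega> = (if snd l then act (satom (fst l)) \<omega>
     else act (sdual (satom (fst l))) (fst \<omega> - 1, snd \<omega>))"

definition wact :: "bword \<Rightarrow> int \<times> sim list \<Rightarrow> int \<times> sim list" where
  "wact w \<omega> = foldr gact w \<omega>"

lemma nform_shift: "nform (p, snd \<omega>) = nform \<omega>"
  by (simp add: nform_def)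

lemma nform_wact: "nform \<omega> \<Longrightarrow> nform (wact w \<omega>)"
  by (induction w) (auto simp: wact_def gact_def nform_shift intro!: nform_act)

lemma br_satom: "br (satom g) = sigma g"
  by (cases g) (simp_all add: satom_def br_simps)

lemma val_shift: "val (fst \<omega> + k, snd \<omega>) = dpow k \<cdot> val \<omega>"
  by (simp add: val_def add.commute[of _ k] dpow_add gsimps)

lemma val_gact: "val (gact (g, b) \<omega>) = (if b then sigma g else binv (sigma g)) \<cdot> val \<omega>"
proof -
  have "sigma g \<cdot> (br (sdual (satom g)) \<cdot> binv delta) = bone"
    using br_sdual[of "satom g"] by (simp add: br_satom bmult_assoc[symmetric] binv_right)
  then have "br (sdual (satom g)) \<cdot> binv delta = binv (sigma g)"
    by (rule binv_unique)
  then show ?thesis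
    using val_shift[of \<omega> "- 1"] binv_dpow[of 1]
    by (auto simp: gact_def val_act br_satom dpow_1 bmult_assoc[symmetric])
qed

lemma gact_inverse:
  assumes "nform \<omega>"
  shows "gact (g, b) (gact (g, \<not> b) \<omega>) = \<omega>"
proof -
  let ?a = "satom g"
  have 1: "act ?a (act (sdual ?a) (fst \<omega> - 1, snd \<omega>)) = \<omega>"
    using act_comp[of "(fst \<omega> - 1, snd \<omega>)" "sdual ?a" ?a] act_DL[of "(fst \<omega> - 1, snd \<omega>)"] assms
    by (simp add: nform_shift sle_simps unary_tables)
  let ?w = "act ?a \<omega>" and ?t = "taup (- 1) (sdual ?a)"
  have sc: "sdual ?t = ?a"
  proof -
    have "stau ?t = sdual ?a"
      using taup_Suc[of "-1" "sdual ?a"] by (simp add: taup_0)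
    then have "stau (sdual ?t) = stau ?a"
      by (simp only: unary_tables(2,3))
    then show ?thesis by (metis unary_tables(1))
  qed
  have "act ?t ?w = (fst \<omega> + 1, snd \<omega>)"
    using act_comp[of \<omega> ?a ?t] unary_tables(19)[of ?t] act_DL[OF assms] assms
    by (simp add: sc sle_simps)
  then have 2: "act (sdual ?a) (fst ?w - 1, snd ?w) = \<omega>"
    using act_shift[of "sdual ?a" ?w "- 1"] by simp
  show ?thesis using 1 2 by (cases b) (simp_all add: gact_def)
qed

lemma wact_append: "wact (u @ v) \<omega> = wact u (wact v \<omega>)"
  by (simp add: wact_def)

lemma wact_winv: "nform \<omega> \<Longrightarrow> wact (winv w) (wact w \<omega>) = \<omega>"
proof (induction w arbitrary: \<omega>)
  case Nil
  then show ?case by (simp add: winv_def wact_def)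
next
  case (Cons l w)
  obtain g b where l: "l = (g, b)" by (cases l)
  have "wact (winv (l # w)) (wact (l # w) \<omega>) = wact (winv w) (gact (g, \<not> b) (gact (g, b) (wact w \<omega>)))"
    by (simp add: wact_def winv_def l)
  also have "gact (g, \<not> b) (gact (g, b) (wact w \<omega>)) = wact w \<omega>"
    using gact_inverse[of "wact w \<omega>" g "\<not> b"] nform_wact[OF Cons.prems] by simp
  finally show ?case using Cons by simp
qed

text \<open>The source of uniqueness of normal forms: generators act by mutually inverse maps that
  respect the braid relations, so the action depends on the braid only. Applying a braid to the
  trivial normal form then reads off its own.\<close>

lemma wact_beq: "beq u v \<Longrightarrow> nform \<omega> \<Longrightarrow> wact u \<omega> = wact v \<omega>"
proof (induction arbitrary: \<omega> rule: beq.induct)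
  case (bcong u u' v v')
  then show ?case by (simp add: wact_append nform_wact)
next
  case (binv_cong u v)
  let ?w = "wact (winv v) \<omega>"
  have n: "nform ?w" by (rule nform_wact[OF binv_cong.prems])
  have "wact v ?w = \<omega>"
    using wact_winv[OF binv_cong.prems, of "winv v"] by (simp add: winv_winv)
  then have "wact (winv u) \<omega> = wact (winv u) (wact u ?w)"
    using binv_cong.IH[OF n] by simp
  then show ?case using wact_winv[OF n] by simp
next
  case (bcancel g b)
  then show ?case using gact_inverse by (simp add: wact_def)
next
  case bcomm
  then show ?case
    using act_comp[of \<omega> A34 A12] act_comp[of \<omega> A12 A34]
    by (simp add: wact_def gact_def satom_def sle_def smeet_def sdual_def smul_def)
next
  case bbr12
  have n: "nform (act A12 \<omega>)" using bbr12 nform_act by blast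
  show ?case
    using act_comp[OF n, of A23 A12] act_comp[OF n, of A13 A23] act_comp[OF bbr12, of A23 A12]
      act_comp[OF bbr12, of A12 A13]
    by (simp add: wact_def gact_def satom_def sle_def smeet_def sdual_def smul_def)
next
  case bbr23
  have n: "nform (act A23 \<omega>)" using bbr23 nform_act by blast
  show ?case
    using act_comp[OF n, of A34 A23] act_comp[OF n, of A24 A34] act_comp[OF bbr23, of A34 A23]
      act_comp[OF bbr23, of A23 A24]
    by (simp add: wact_def gact_def satom_def sle_def smeet_def sdual_def smul_def)
qed simp_all

lift_definition nf :: "braid \<Rightarrow> int \<times> sim list" is "\<lambda>w. wact w (0, [])"
  by (rule wact_beq) (simp_all add: nform_def)

lemma nform_nf: "nform (nf x)"
  by transfer (rule nform_wact, simp add: nform_def)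

lemma nf_bone: "nf bone = (0, [])"
  by transfer (simp add: wact_def)

lemma nf_sigma: "nf (sigma g \<cdot> x) = act (satom g) (nf x)"
  by transfer (simp add: wact_def gact_def)

lemma nf_binv_sigma: "nf (binv (sigma g) \<cdot> x) = gact (g, False) (nf x)"
  by transfer (simp add: wact_def winv_def)

lemma val_nf: "val (nf x) = x"
proof (induction x rule: braid.abs_induct)
  case (1 w)
  have "val (wact w (0, [])) = abs_braid w" for w
  proof (induction w)
    case Nil
    then show ?case by (simp add: wact_def val_def dpow_0 bprod_simps gsimps bone_def[symmetric])
  next
    case (Cons l w)
    obtain g b where l: "l = (g, b)" by (cases l)
    have "(if b then sigma g else binv (sigma g)) = abs_braid [(g, b)]"
      by (auto simp: sigma_def binv.abs_eq winv_def)
    then show ?case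
      using Cons by (simp add: wact_def l val_gact bmult.abs_eq)
  qed
  then show ?case by (simp add: nf.abs_eq)
qed

lemma nf_atom_mult:
  "nf (br A12 \<cdot> x) = act A12 (nf x)" "nf (br A23 \<cdot> x) = act A23 (nf x)" "nf (br A34 \<cdot> x) = act A34 (nf x)"
  "nf (br A13 \<cdot> x) = act A13 (nf x)" "nf (br A24 \<cdot> x) = act A24 (nf x)" "nf (br A14 \<cdot> x) = act A14 (nf x)"
proof -
  note n = nform_nf[of x]
  show s: "nf (br A12 \<cdot> x) = act A12 (nf x)" "nf (br A23 \<cdot> x) = act A23 (nf x)" "nf (br A34 \<cdot> x) = act A34 (nf x)" for x
    using nf_sigma[of S1 x] nf_sigma[of S2 x] nf_sigma[of S3 x] by (simp_all add: br_simps satom_def)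
  have cancel: "gact (g, False) (act (satom g) (act u (nf x))) = act u (nf x)" for g u
    using gact_inverse[OF nform_act[OF n], of g False u] by (simp add: gact_def)
  note comp = act_comp[OF n]
  show a13: "nf (br A13 \<cdot> x) = act A13 (nf x)"
    using nf_binv_sigma[of S2 "br A12 \<cdot> (br A23 \<cdot> x)"] s cancel[of S2 A13] comp[of A23 A12] comp[of A13 A23]
    by (simp add: br_simps gsimps satom_def sle_def smeet_def sdual_def smul_def)
  show "nf (br A24 \<cdot> x) = act A24 (nf x)"
    using nf_binv_sigma[of S3 "br A23 \<cdot> (br A34 \<cdot> x)"] s cancel[of S3 A24] comp[of A34 A23] comp[of A24 A34]
    by (simp add: br_simps gsimps satom_def sle_def smeet_def sdual_def smul_def)
  have "br A14 = binv (sigma S3) \<cdot> (br A13 \<cdot> br A34)"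
    by (simp add: br_simps gsimps)
  moreover have "nf (br A13 \<cdot> (br A34 \<cdot> x)) = act A13 (act A34 (nf x))"
  proof -
    let ?y = "br A34 \<cdot> x"
    have n': "nform (nf ?y)" by (rule nform_nf)
    have "gact (S2, False) (act A23 (act A13 (nf ?y))) = act A13 (nf ?y)"
      using gact_inverse[OF nform_act[OF n'], of S2 False A13] by (simp add: gact_def satom_def)
    then show ?thesis
      using nf_binv_sigma[of S2 "br A12 \<cdot> (br A23 \<cdot> ?y)"] s(1)[of "br A23 \<cdot> ?y"] s(2)[of ?y] s(3)[of x]
        act_comp[OF n', of A23 A12] act_comp[OF n', of A13 A23]
      by (simp add: br_simps gsimps satom_def sle_def smeet_def sdual_def smul_def)
  qed
  ultimately show "nf (br A14 \<cdot> x) = act A14 (nf x)"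
    using nf_binv_sigma[of S3 "br A13 \<cdot> (br A34 \<cdot> x)"] cancel[of S3 A14] comp[of A34 A13] comp[of A14 A34]
    by (simp add: gsimps satom_def sle_def smeet_def sdual_def smul_def)
qed

lemma nf_br_mult: "nf (br s \<cdot> x) = act s (nf x)"
proof -
  have two: "nf (br u \<cdot> x) = act u (nf x)"
    if "\<And>x. nf (br a \<cdot> x) = act a (nf x)" "\<And>x. nf (br b \<cdot> x) = act b (nf x)"
      "br a \<cdot> br b = br u" "sle b (sdual a)" "smul a b = u" for a b u x
    using that act_comp[OF nform_nf, of b a x] by (metis bmult_assoc)
  note len2 = two[OF nf_atom_mult(1,2) atom_products(1)] two[OF nf_atom_mult(1,5) atom_products(5)]
    two[OF nf_atom_mult(4,3) atom_products(9)] two[OF nf_atom_mult(2,3) atom_products(10)]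
    two[OF nf_atom_mult(1,3) atom_products(13)] two[OF nf_atom_mult(6,2) atom_products(15)]
  have t123: "nf (br T123 \<cdot> x) = act T123 (nf x)" for x
    by (rule len2(1)) (simp_all add: sle_def smeet_def sdual_def smul_def)
  have "br T123 \<cdot> br A34 = br DL" using br_sdual[of T123] by (simp add: sdual_def br_simps)
  note dl = two[OF t123 nf_atom_mult(3) this]
  have e: "act E0 (nf x) = nf x"
    using nform_nf[of x]
    by (auto simp: act_def taup_const ins_E0 pull_def nform_def hdE_def proper_def split: list.splits)
  have "nf (br T124 \<cdot> x) = act T124 (nf x)" "nf (br T134 \<cdot> x) = act T134 (nf x)"
    "nf (br T234 \<cdot> x) = act T234 (nf x)" "nf (br P12 \<cdot> x) = act P12 (nf x)" "nf (br P14 \<cdot> x) = act P14 (nf x)"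
    "nf (br DL \<cdot> x) = act DL (nf x)"
    by (rule len2 dl; simp add: sle_def smeet_def sdual_def smul_def)+
  then show ?thesis
    using t123 e by (cases s) (simp_all only: nf_atom_mult br_simps(1) bone_left)
qed

lemma nf_delta_mult: "nf (delta \<cdot> x) = (fst (nf x) + 1, snd (nf x))"
  using nf_br_mult[of DL x] act_DL[OF nform_nf] by (simp add: br_simps)

lemma nf_dpow_mult: "nf (dpow k \<cdot> x) = (fst (nf x) + k, snd (nf x))"
proof (induction k rule: int_induct[where k = 0])
  case base
  show ?case by (simp add: dpow_0 gsimps)
next
  case (step1 i)
  then show ?case using nf_delta_mult[of "dpow i \<cdot> x"] by (simp add: dpow_Suc gsimps)
next
  case (step2 i)
  then show ?case
    using nf_delta_mult[of "dpow (i - 1) \<cdot> x"] dpow_Suc[of "i - 1"]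
    by (auto simp: bmult_assoc[symmetric] prod_eq_iff)
qed

lemma nf_val: "nform \<omega> \<Longrightarrow> nf (val \<omega>) = \<omega>"
proof -
  have "nf (bprod (map br xs)) = (0, xs)" if "list_all proper xs" "successively lw xs" for xs
    using that
  proof (induction xs)
    case Nil
    then show ?case by (simp add: bprod_simps nf_bone)
  next
    case (Cons x xs)
    then have "nf (bprod (map br xs)) = (0, xs)" by (simp add: successively_lw_Cons)
    moreover have "ins x xs = x # xs" using Cons.prems by (intro ins_id) (auto simp: list_all_iff proper_def)
    ultimately show ?case
      using Cons.prems by (simp add: bprod_simps nf_br_mult act_def taup_0 pull_def hdE_simps proper_def)
  qed
  then show "nform \<omega> \<Longrightarrow> nf (val \<omega>) = \<omega>"
    by (simp add: val_def nf_dpow_mult nform_def)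
qed

lemma nf_inj: "nf x = nf y \<longleftrightarrow> x = y"
  by (metis val_nf)

lemma br_inj: "br s = br t \<longleftrightarrow> s = t"
proof -
  have "nf (br s) = (if s = E0 then (0, []) else if s = DL then (1, []) else (0, [s]))" for s
    using nf_br_mult[of s bone] nf_bone
    by (simp add: gsimps act_def taup_0 pull_def hdE_def)
  then show ?thesis by (metis Pair_inject list.inject list.distinct(1) zero_neq_one)
qed

section \<open>The prefix order\<close>

abbreviation finf :: "braid \<Rightarrow> int" where "finf x \<equiv> fst (nf x)"
abbreviation nfs :: "braid \<Rightarrow> sim list" where "nfs x \<equiv> snd (nf x)"

abbreviation pos :: "braid \<Rightarrow> bool" where "pos x \<equiv> 0 \<le> finf x"

lemma nfs_proper: "list_all proper (nfs x)" "successively lw (nfs x)"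
  using nform_nf[of x] by (simp_all add: nform_def)

lemma nf_decomp: "x = dpow (finf x) \<cdot> bprod (map br (nfs x))"
  using val_nf[of x] by (simp add: val_def)

lemma nf_eqI: "x = dpow p \<cdot> bprod (map br xs) \<Longrightarrow> list_all proper xs \<Longrightarrow> successively lw xs \<Longrightarrow> nf x = (p, xs)"
  using nf_val[of "(p, xs)"] by (simp add: val_def nform_def)

lemma finf_br_mult: "finf x \<le> finf (br s \<cdot> x)"
  by (simp add: nf_br_mult act_def pull_def)

lemma finf_bprod_mult: "finf x \<le> finf (bprod (map br ws) \<cdot> x)"
proof (induction ws)
  case Nil
  show ?case by (simp add: bprod_simps gsimps)
next
  case (Cons w ws)
  then show ?case using finf_br_mult[of "bprod (map br ws) \<cdot> x" w] by (simp add: bprod_simps gsimps)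
qed

lemma bprod_dpow: "bprod (map br xs) \<cdot> dpow k = dpow k \<cdot> bprod (map br (map (taup k) xs))"
proof (induction xs)
  case Nil
  show ?case by (simp add: bprod_simps gsimps)
next
  case (Cons x xs)
  then show ?case by (simp add: bprod_simps gsimps) (metis bmult_assoc br_dpow)
qed

lemma nf_mult_dpow: "nf (x \<cdot> dpow k) = (finf x + k, map (taup k) (nfs x))"
proof (rule nf_eqI)
  show "x \<cdot> dpow k = dpow (finf x + k) \<cdot> bprod (map br (map (taup k) (nfs x)))"
    by (subst nf_decomp[of x]) (simp only: bmult_assoc bprod_dpow dpow_add)
  show "list_all proper (map (taup k) (nfs x))"
    using nfs_proper(1)[of x] by (simp add: list_all_iff proper_taup)
  show "successively lw (map (taup k) (nfs x))"
    using nfs_proper(2)[of x] by (simp add: successively_map lw_taup)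
qed

lemma finf_mult: "finf x + finf y \<le> finf (x \<cdot> y)"
proof -
  have "finf (bprod (map br (nfs x)) \<cdot> y) \<ge> finf y" by (rule finf_bprod_mult)
  then show ?thesis
    using nf_dpow_mult[of "finf x" "bprod (map br (nfs x)) \<cdot> y"] nf_decomp[of x]
    by (metis add.commute add_left_mono bmult_assoc fst_conv)
qed

lemma nf_dpow: "nf (dpow k) = (k, [])"
  using nf_dpow_mult[of k bone] by (simp add: gsimps nf_bone)

lemma nf_br: "nf (br s) = (if s = E0 then (0, []) else if s = DL then (1, []) else (0, [s]))"
  using nf_br_mult[of s bone] nf_bone
  by (simp add: gsimps act_def taup_0 pull_def hdE_def)

lemma pos_br: "pos (br s)"
  by (simp add: nf_br)

lemma pos_mult: "pos x \<Longrightarrow> pos y \<Longrightarrow> pos (x \<cdot> y)"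
  using finf_mult[of x y] by linarith

section \<open>Positive braids and prefixes\<close>

lemma bkl_gens_eq: "bkl_gens = br ` {A12, A13, A14, A23, A24, A34}"
proof -
  have "(\<exists>p q. x = bkl_a p q \<and> 1 \<le> p \<and> p < q \<and> q \<le> 4) \<longleftrightarrow>
      x \<in> {bkl_a 1 2, bkl_a 1 3, bkl_a 1 4, bkl_a 2 3, bkl_a 2 4, bkl_a 3 4}" for x
  proof
    assume "\<exists>p q. x = bkl_a p q \<and> 1 \<le> p \<and> p < q \<and> q \<le> 4"
    then obtain p q where "x = bkl_a p q" "1 \<le> p" "p < q" "q \<le> 4" by blast
    moreover have "p = 1 \<or> p = 2 \<or> p = 3" "q = 2 \<or> q = 3 \<or> q = 4"
      using calculation by linarith+
    ultimately show "x \<in> {bkl_a 1 2, bkl_a 1 3, bkl_a 1 4, bkl_a 2 3, bkl_a 2 4, bkl_a 3 4}" by auto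
  next
    assume "x \<in> {bkl_a 1 2, bkl_a 1 3, bkl_a 1 4, bkl_a 2 3, bkl_a 2 4, bkl_a 3 4}"
    then show "\<exists>p q. x = bkl_a p q \<and> 1 \<le> p \<and> p < q \<and> q \<le> 4"
      by (elim insertE emptyE) (rule exI, rule exI, rule conjI, assumption, simp)+
  qed
  then show ?thesis
    unfolding bkl_gens_def by (auto simp: br_def)
qed

lemma bkl_monoid_mult: "x \<in> bkl_monoid \<Longrightarrow> y \<in> bkl_monoid \<Longrightarrow> x \<cdot> y \<in> bkl_monoid"
  unfolding bkl_monoid_def by (auto simp: bprod_append[symmetric]) (metis le_sup_iff set_append)

lemma br_in_bkl_monoid: "br s \<in> bkl_monoid"
proof -
  have at: "br s \<in> bkl_monoid" if "s \<in> {A12, A13, A14, A23, A24, A34}" for s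
    using that bkl_gens_eq unfolding bkl_monoid_def
    by (intro CollectI exI[of _ "[br s]"]) (auto simp: bprod_simps gsimps)
  have one: "bone \<in> bkl_monoid"
    unfolding bkl_monoid_def by (intro CollectI exI[of _ "[]"]) (simp add: bprod_simps)
  have "br T123 \<in> bkl_monoid" "br T124 \<in> bkl_monoid" "br T134 \<in> bkl_monoid" "br T234 \<in> bkl_monoid"
    "br P12 \<in> bkl_monoid" "br P14 \<in> bkl_monoid"
    unfolding br_len2 by (intro bkl_monoid_mult at; simp)+
  moreover have "br T123 \<cdot> br A34 = br DL" using br_sdual[of T123] by (simp add: sdual_def br_simps)
  then have "br DL \<in> bkl_monoid"
    using bkl_monoid_mult[of "br T123" "br A34"] at[of A34] calculation(1) by simp
  ultimately show ?thesis
    using at one by (cases s) (simp_all add: br_simps(1))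
qed

lemma bkl_monoid_pos: "x \<in> bkl_monoid \<longleftrightarrow> pos x"
proof
  assume "x \<in> bkl_monoid"
  then obtain l where l: "x = bprod l" "set l \<subseteq> bkl_gens" by (auto simp: bkl_monoid_def)
  have "set l \<subseteq> bkl_gens \<Longrightarrow> pos (bprod l)"
  proof (induction l)
    case Nil
    then show ?case by (simp add: bprod_simps nf_bone)
  next
    case (Cons a l)
    then obtain s where "a = br s" by (auto simp: bkl_gens_eq)
    then show ?case using Cons finf_br_mult[of "bprod l" s] by (simp add: bprod_simps)
  qed
  then show "pos x" using l by simp
next
  assume p: "pos x"
  have "bone \<in> bkl_monoid" using br_in_bkl_monoid[of E0] by (simp add: br_simps)
  then have "dpow (int n) \<in> bkl_monoid" for n
  proof (induction n)
    case 0
    then show ?case by (simp add: dpow_0)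
  next
    case (Suc n)
    then show ?case
      using bkl_monoid_mult[OF br_in_bkl_monoid[of DL], of "dpow (int n)"] dpow_Suc[of "int n"]
      by (simp add: br_simps add.commute)
  qed
  from this[of "nat (finf x)"] have d: "dpow (finf x) \<in> bkl_monoid" using p by simp
  have "bprod (map br xs) \<in> bkl_monoid" for xs
    using \<open>bone \<in> bkl_monoid\<close> by (induction xs) (auto simp: bprod_simps intro: bkl_monoid_mult br_in_bkl_monoid)
  then show "x \<in> bkl_monoid"
    using d nf_decomp[of x] bkl_monoid_mult by metis
qed

lemma prefix_pos: "x \<preccurlyeq> y \<longleftrightarrow> pos (binv x \<cdot> y)"
  by (simp add: prefix_def bkl_monoid_pos)

lemma prefix_one: "bone \<preccurlyeq> x \<longleftrightarrow> pos x"
  by (simp add: prefix_pos gsimps)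

lemma prefix_refl: "x \<preccurlyeq> x"
  by (simp add: prefix_pos gsimps nf_bone)

lemma prefix_trans: "x \<preccurlyeq> y \<Longrightarrow> y \<preccurlyeq> z \<Longrightarrow> x \<preccurlyeq> z"
  using pos_mult[of "binv x \<cdot> y" "binv y \<cdot> z"] by (simp add: prefix_pos gsimps)

lemma prefix_left: "z \<cdot> x \<preccurlyeq> z \<cdot> y \<longleftrightarrow> x \<preccurlyeq> y"
  by (simp add: prefix_pos gsimps)

lemma prefix_move: "z \<cdot> x \<preccurlyeq> y \<longleftrightarrow> x \<preccurlyeq> binv z \<cdot> y"
  by (simp add: prefix_pos gsimps)

lemma prefix_dpow: "x \<cdot> dpow k \<preccurlyeq> y \<cdot> dpow k \<longleftrightarrow> x \<preccurlyeq> y"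
proof -
  have "binv (x \<cdot> dpow k) \<cdot> (y \<cdot> dpow k) = dpow (- k) \<cdot> ((binv x \<cdot> y) \<cdot> dpow k)"
    by (simp add: gsimps binv_dpow)
  then show ?thesis
    by (simp add: prefix_pos nf_dpow_mult nf_mult_dpow)
qed

lemma prefix_dpow_left: "x \<cdot> dpow k \<preccurlyeq> y \<longleftrightarrow> x \<preccurlyeq> y \<cdot> dpow (- k)"
  using prefix_dpow[of x k "y \<cdot> dpow (- k)"] by (simp add: gsimps dpow_add[symmetric] dpow_0)

lemma prefix_mult_pos: "pos y \<Longrightarrow> x \<preccurlyeq> x \<cdot> y"
  by (simp add: prefix_pos gsimps)

lemma dpow_prefix: "dpow k \<preccurlyeq> x \<longleftrightarrow> k \<le> finf x"
  by (simp add: prefix_pos binv_dpow nf_dpow_mult)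

text \<open>The homomorphism to the integers that sends every atom to 1, computed from the normal
  form. It makes the prefix order antisymmetric and serves as measure for inductions on positive
  braids.\<close>

definition blen :: "braid \<Rightarrow> int" where
  "blen x = 3 * finf x + sum_list (map (int \<circ> slen) (nfs x))"

lemma sum_ins: "sum_list (map (int \<circ> slen) (ins s ys)) = int (slen s) + sum_list (map (int \<circ> slen) ys)"
proof (induction ys arbitrary: s)
  case Nil
  show ?case by (simp add: slen_def)
next
  case (Cons y ys)
  have "int (slen (fst (snorm s y))) + int (slen (snd (snorm s y))) = int (slen s) + int (slen y)"
    using binary_tables(17)[of s y] by linarith
  moreover have "slen E0 = 0" by (simp add: slen_def)
  ultimately show ?case using Cons by auto
qed

lemma blen_br_mult: "blen (br s \<cdot> x) = int (slen s) + blen x"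
proof -
  let ?zs = "ins (taup (finf x) s) (nfs x)"
  have "slen DL = 3" by (simp add: slen_def)
  then have "3 * fst (pull (finf x) ?zs) + sum_list (map (int \<circ> slen) (snd (pull (finf x) ?zs)))
     = 3 * finf x + sum_list (map (int \<circ> slen) ?zs)"
    by (cases ?zs) (auto simp: pull_def hdE_simps)
  then show ?thesis
    by (simp add: blen_def nf_br_mult act_def sum_ins slen_taup)
qed

lemma blen_mult: "blen (x \<cdot> y) = blen x + blen y"
proof -
  have "blen (bprod (map br xs) \<cdot> y) = sum_list (map (int \<circ> slen) xs) + blen y" for xs
    by (induction xs) (simp_all add: bprod_simps gsimps blen_br_mult)
  moreover have "blen (dpow k \<cdot> z) = 3 * k + blen z" for k z
    by (simp add: blen_def nf_dpow_mult)
  ultimately show ?thesis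
    using nf_decomp[of x] by (metis blen_def bmult_assoc add.assoc)
qed

lemma blen_bone: "blen bone = 0"
  by (simp add: blen_def nf_bone)

lemma blen_binv: "blen (binv x) = - blen x"
  using blen_mult[of x "binv x"] by (simp add: binv_right blen_bone)

lemma blen_dpow: "blen (dpow k) = 3 * k"
  by (simp add: blen_def nf_dpow)

lemma blen_br: "blen (br s) = int (slen s)"
  using blen_br_mult[of s bone] by (simp add: gsimps blen_bone)

lemma blen_nonneg: "pos x \<Longrightarrow> 0 \<le> blen x"
  unfolding blen_def by (intro add_nonneg_nonneg sum_list_nonneg) auto

lemma blen_0: "pos x \<Longrightarrow> blen x = 0 \<Longrightarrow> x = bone"
proof -
  assume p: "pos x" and l: "blen x = 0"
  have s: "0 \<le> sum_list (map (int \<circ> slen) (nfs x))" by (intro sum_list_nonneg) auto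
  have f: "finf x = 0" using p l s by (simp add: blen_def)
  have "nfs x = []"
  proof (cases "nfs x")
    case (Cons y ys)
    have "y \<noteq> E0" using nfs_proper(1)[of x] Cons by (simp add: proper_def)
    moreover have "0 \<le> sum_list (map (int \<circ> slen) ys)" by (intro sum_list_nonneg) auto
    then have "slen y = 0" using l f Cons by (simp add: blen_def)
    ultimately show ?thesis by (simp add: unary_tables)
  qed simp
  then show "x = bone"
    using nf_decomp[of x] f by (simp add: dpow_0 bprod_simps gsimps)
qed

lemma prefix_antisym: "x \<preccurlyeq> y \<Longrightarrow> y \<preccurlyeq> x \<Longrightarrow> x = y"
proof -
  assume a: "x \<preccurlyeq> y" "y \<preccurlyeq> x"
  have "blen (binv x \<cdot> y) = 0"
    using blen_nonneg[of "binv x \<cdot> y"] blen_nonneg[of "binv y \<cdot> x"] a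
    by (simp add: prefix_pos blen_mult blen_binv)
  then have "binv x \<cdot> y = bone" using a blen_0 by (simp add: prefix_pos)
  then show "x = y" by (metis binv_right_assoc bone_right)
qed

lemma prefix_blen: "x \<preccurlyeq> y \<Longrightarrow> blen x \<le> blen y"
  using blen_nonneg[of "binv x \<cdot> y"] by (simp add: prefix_pos blen_mult blen_binv)

lemma prefix_blen_eq: "x \<preccurlyeq> y \<Longrightarrow> blen y \<le> blen x \<Longrightarrow> x = y"
  using blen_0[of "binv x \<cdot> y"] blen_nonneg[of "binv x \<cdot> y"]
  by (simp add: prefix_pos blen_mult blen_binv) (metis binv_right_assoc bone_right)

text \<open>For a positive braid this is the greatest simple prefix, that is, the meet with
  \<delta>.\<close>

definition hsim :: "braid \<Rightarrow> sim" where
  "hsim x = (if 1 \<le> finf x then DL else hdE (nfs x))"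

lemma hsim_DL: "hsim x = DL \<longleftrightarrow> 1 \<le> finf x"
  using nfs_proper(1)[of x] by (auto simp: hsim_def hdE_def proper_def split: list.splits)

lemma hsim_br_mult: "pos x \<Longrightarrow> hsim (br s \<cdot> x) = fst (snorm s (hsim x))"
proof (cases "1 \<le> finf x")
  case True
  then show ?thesis by (auto simp: hsim_def nf_br_mult act_def pull_def binary_tables(18))
next
  case False
  assume "pos x"
  then have "finf x = 0" using False by simp
  then show ?thesis by (auto simp: hsim_def nf_br_mult act_def pull_def hdE_ins taup_0)
qed

lemma hsim_bprod_mult: "pos x \<Longrightarrow> hsim (bprod (map br ws) \<cdot> x) = foldr (\<lambda>u h. fst (snorm u h)) ws (hsim x)"
proof (induction ws)
  case Nil
  then show ?case by (simp add: bprod_simps gsimps)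
next
  case (Cons w ws)
  then show ?case
    using hsim_br_mult[of "bprod (map br ws) \<cdot> x" w] finf_bprod_mult[of x ws]
    by (simp add: bprod_simps gsimps)
qed

lemma hsim_br: "hsim (br s) = s"
  by (simp add: hsim_def nf_br hdE_def)

lemma br_prefix_br: "sle s t \<Longrightarrow> br s \<preccurlyeq> br t"
  using br_smul[of "sdiv s t" s] binary_tables(5,7)[of s t] pos_br[of "sdiv s t"]
  by (metis prefix_mult_pos)

lemma br_hsim_prefix: "pos x \<Longrightarrow> br (hsim x) \<preccurlyeq> x"
proof (cases "1 \<le> finf x")
  case True
  then show ?thesis using dpow_prefix[of 1 x] by (simp add: hsim_def br_simps dpow_1)
next
  case False
  assume "pos x"
  then have f: "finf x = 0" using False by simp
  show ?thesis
  proof (cases "nfs x")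
    case Nil
    then show ?thesis using f by (simp add: hsim_def hdE_def br_simps prefix_one)
  next
    case (Cons y ys)
    have "x = br y \<cdot> bprod (map br ys)" using nf_decomp[of x] f Cons by (simp add: dpow_0 bprod_simps gsimps)
    moreover have "pos (bprod (map br ys))"
      using finf_bprod_mult[of bone ys] by (simp add: gsimps nf_bone)
    ultimately show ?thesis
      using f Cons by (simp add: hsim_def hdE_def prefix_mult_pos)
  qed
qed

lemma br_prefix: "pos x \<Longrightarrow> br s \<preccurlyeq> x \<longleftrightarrow> sle s (hsim x)"
proof
  assume p: "pos x"
  {
    assume "br s \<preccurlyeq> x"
    then have "pos (binv (br s) \<cdot> x)" by (simp add: prefix_pos)
    from hsim_br_mult[OF this, of s] show "sle s (hsim x)"
      using binary_tables(14) by (simp add: gsimps)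
  next
    assume "sle s (hsim x)"
    then show "br s \<preccurlyeq> x" using br_hsim_prefix[OF p] br_prefix_br prefix_trans by blast
  }
qed

lemma foldr_snorm_meet:
  "foldr (\<lambda>u h. fst (snorm u h)) ws (smeet s t)
   = smeet (foldr (\<lambda>u h. fst (snorm u h)) ws s) (foldr (\<lambda>u h. fst (snorm u h)) ws t)"
  by (induction ws) (simp_all add: ternary_tables(2))

text \<open>The head of a product \<open>w u\<close> is determined by \<open>w\<close> and the head of \<open>u\<close>, and the resulting map on
  heads preserves meets; this is what makes the order a lattice order.\<close>

lemma pos_mult_iff:
  assumes "finf w = - 1" "pos u"
  shows "pos (w \<cdot> u) \<longleftrightarrow> foldr (\<lambda>u h. fst (snorm u h)) (nfs w) (hsim u) = DL"
proof -
  let ?W = "bprod (map br (nfs w))"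
  have "w \<cdot> u = dpow (- 1) \<cdot> (?W \<cdot> u)"
    using nf_decomp[of w] assms by (simp add: bmult_assoc[symmetric])
  then have "pos (w \<cdot> u) \<longleftrightarrow> 1 \<le> finf (?W \<cdot> u)"
    by (auto simp: nf_dpow_mult)
  also have "\<dots> \<longleftrightarrow> hsim (?W \<cdot> u) = DL" by (rule hsim_DL[symmetric])
  finally show ?thesis using hsim_bprod_mult[OF assms(2)] by simp
qed

text \<open>As \<open>z\<close> divides \<delta>, its inverse has infimum at least -1. If it equals
  -1, the head of \<open>u\<close> alone decides whether \<open>z\<close> divides \<open>u\<close>;
  if it is larger, the inverse is positive and \<open>z\<close> divides every positive
  braid.\<close>

lemma hsim_glb:
  assumes "pos u" "z \<preccurlyeq> u" "z \<preccurlyeq> delta"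
  shows "z \<preccurlyeq> br (hsim u)"
proof -
  let ?w = "binv z"
  have f: "finf ?w \<ge> - 1"
    using assms(3) nf_mult_dpow[of ?w 1] by (simp add: prefix_pos dpow_1)
  show ?thesis
  proof (cases "finf ?w = - 1")
    case True
    then show ?thesis
      using pos_mult_iff[OF True assms(1)] pos_mult_iff[OF True pos_br, of "hsim u"] assms(2)
      by (simp add: prefix_pos hsim_br)
  next
    case False
    then show ?thesis using f pos_mult[OF _ pos_br, of ?w] by (simp add: prefix_pos)
  qed
qed

lemma br_glb:
  assumes "z \<preccurlyeq> br s" "z \<preccurlyeq> br t"
  shows "z \<preccurlyeq> br (smeet s t)"
proof -
  let ?w = "binv z"
  have "br s \<preccurlyeq> delta" using br_sdual[of s] prefix_mult_pos[OF pos_br, of "br s" "sdual s"] by simp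
  then have "z \<preccurlyeq> delta" using assms prefix_trans by blast
  then have f: "finf ?w \<ge> - 1"
    using nf_mult_dpow[of ?w 1] by (simp add: prefix_pos dpow_1)
  show ?thesis
  proof (cases "finf ?w = - 1")
    case True
    then show ?thesis
      using pos_mult_iff[OF True pos_br, of s] pos_mult_iff[OF True pos_br, of t]
        pos_mult_iff[OF True pos_br, of "smeet s t"] assms
      by (simp add: prefix_pos hsim_br foldr_snorm_meet unary_tables)
  next
    case False
    then show ?thesis using f pos_mult[OF _ pos_br, of ?w] by (simp add: prefix_pos)
  qed
qed

definition is_glb :: "braid \<Rightarrow> braid \<Rightarrow> braid \<Rightarrow> bool" where
  "is_glb m x y \<longleftrightarrow> m \<preccurlyeq> x \<and> m \<preccurlyeq> y \<and> (\<forall>z. z \<preccurlyeq> x \<and> z \<preccurlyeq> y \<longrightarrow> z \<preccurlyeq> m)"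

lemma is_glb_br: "is_glb (br (smeet s t)) (br s) (br t)"
  using br_glb br_prefix_br binary_tables(11,12)[of s t] by (auto simp: is_glb_def)

lemma meet_br: "meet (br s) (br t) = br (smeet s t)"
  unfolding meet_def
  using is_glb_br[of s t] by (intro the_equality) (auto simp: is_glb_def intro: prefix_antisym)

text \<open>For positive braids the meet of the heads is divided out repeatedly, with the length as
  measure. A large power of \<delta> reduces the general case to this one.\<close>

lemma glb_exists: "\<exists>m. is_glb m x y"
proof -
  have pos: "\<exists>m. is_glb m u v" if "pos u" "pos v" for u v
    using that
  proof (induction "nat (blen u)" arbitrary: u v rule: less_induct)
    case less
    let ?h = "smeet (hsim u) (hsim v)"
    show ?case
    proof (cases "?h = E0")
      case True
      have "z \<preccurlyeq> bone" if z: "z \<preccurlyeq> u" "z \<preccurlyeq> v" for z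
      proof (rule ccontr)
        \<comment> \<open>Rescaling the inverse to infimum -1 makes \<open>pos_mult_iff\<close>
          applicable: the map on heads would send both heads to \<delta>, hence also their meet,
          which is trivial here.\<close>
        let ?w = "binv z" let ?W = "dpow (- 1 - finf ?w) \<cdot> ?w"
        assume "\<not> z \<preccurlyeq> bone"
        then have neg: "finf ?w < 0" by (simp add: prefix_pos gsimps)
        have W: "finf ?W = - 1" "nfs ?W = nfs ?w" by (simp_all add: nf_dpow_mult)
        have "pos (?W \<cdot> u)" "pos (?W \<cdot> v)"
          using z neg by (simp_all add: prefix_pos gsimps nf_dpow_mult)
        then have "pos (?W \<cdot> bone)"
          using pos_mult_iff[OF W(1) less.prems(1)] pos_mult_iff[OF W(1) less.prems(2)]
            pos_mult_iff[OF W(1), of bone] foldr_snorm_meet[of "nfs ?W" "hsim u" "hsim v"] True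
          by (simp add: nf_bone hsim_def hdE_def unary_tables)
        then show False using W by (simp add: gsimps)
      qed
      then show ?thesis using less.prems by (intro exI[of _ bone]) (auto simp: is_glb_def prefix_one)
    next
      case False
      let ?u = "binv (br ?h) \<cdot> u" and ?v = "binv (br ?h) \<cdot> v"
      have "br ?h \<preccurlyeq> u" "br ?h \<preccurlyeq> v"
        using less.prems binary_tables(11,12) by (simp_all add: br_prefix)
      then have p: "pos ?u" "pos ?v" by (simp_all add: prefix_pos)
      have "0 < slen ?h" using False unary_tables(21)[of ?h] by simp
      then have "nat (blen ?u) < nat (blen u)"
        using blen_nonneg[OF p(1)] by (simp add: blen_mult blen_binv blen_br)
      then obtain m where m: "is_glb m ?u ?v" using less.hyps p by blast
      have "is_glb (br ?h \<cdot> m) u v"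
        unfolding is_glb_def
      proof (intro conjI allI impI)
        show "br ?h \<cdot> m \<preccurlyeq> u" "br ?h \<cdot> m \<preccurlyeq> v"
          using m by (simp_all add: is_glb_def prefix_move)
        fix z assume "z \<preccurlyeq> u \<and> z \<preccurlyeq> v"
        then have "binv (br ?h) \<cdot> z \<preccurlyeq> m" using m by (simp add: is_glb_def prefix_left)
        then show "z \<preccurlyeq> br ?h \<cdot> m" by (simp add: prefix_move gsimps)
      qed
      then show ?thesis by blast
    qed
  qed
  define k where "k = \<bar>finf x\<bar> + \<bar>finf y\<bar>"
  have "pos (dpow k \<cdot> x)" "pos (dpow k \<cdot> y)" by (simp_all add: k_def nf_dpow_mult)
  then obtain m where m: "is_glb m (dpow k \<cdot> x) (dpow k \<cdot> y)" using pos by blast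
  have "is_glb (dpow (- k) \<cdot> m) x y"
    unfolding is_glb_def
  proof (intro conjI allI impI)
    show "dpow (- k) \<cdot> m \<preccurlyeq> x" "dpow (- k) \<cdot> m \<preccurlyeq> y"
      using m by (simp_all add: is_glb_def prefix_move binv_dpow)
    fix z assume "z \<preccurlyeq> x \<and> z \<preccurlyeq> y"
    then have "dpow k \<cdot> z \<preccurlyeq> m" using m by (simp add: is_glb_def prefix_left)
    then show "z \<preccurlyeq> dpow (- k) \<cdot> m" by (simp add: prefix_move binv_dpow)
  qed
  then show ?thesis by blast
qed

text \<open>The letters of the inverse after multiplication by \<delta> to the number of letters:
  complements in reverse order, each rotated once for every letter that followed it.\<close>

primrec rdual :: "sim list \<Rightarrow> sim list" where
  "rdual [] = []"
| "rdual (x # xs) = rdual xs @ [taup (int (length xs)) (sdual x)]"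

lemma length_rdual: "length (rdual xs) = length xs"
  by (induction xs) auto

lemma br_binv: "binv (br s) \<cdot> delta = br (sdual s)"
  using br_sdual[of s] by (metis binv_left_assoc)

lemma bprod_rdual: "binv (bprod (map br xs)) \<cdot> dpow (int (length xs)) = bprod (map br (rdual xs))"
proof (induction xs)
  case Nil
  show ?case by (simp add: bprod_simps dpow_0 gsimps)
next
  case (Cons x xs)
  let ?X = "bprod (map br xs)" and ?k = "int (length xs)"
  have "binv (br x \<cdot> ?X) \<cdot> dpow (?k + 1) = binv ?X \<cdot> ((binv (br x) \<cdot> delta) \<cdot> dpow ?k)"
    by (simp add: gsimps dpow_Suc)
  also have "\<dots> = (binv ?X \<cdot> dpow ?k) \<cdot> br (taup ?k (sdual x))"
    unfolding br_binv br_dpow by (simp add: gsimps)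
  finally show ?case using Cons by (simp add: bprod_simps bprod_append gsimps add.commute)
qed

lemma rdual_last: "xs \<noteq> [] \<Longrightarrow> last (rdual xs) = taup (int (length xs) - 1) (sdual (hd xs))"
  by (cases xs) simp_all

lemma rdual_hd: "xs \<noteq> [] \<Longrightarrow> hd (rdual xs) = sdual (last xs)"
proof (induction xs)
  case (Cons x xs)
  show ?case
  proof (cases "xs = []")
    case False
    then have "rdual xs \<noteq> []" using length_rdual[of xs] by auto
    then show ?thesis using Cons False by (simp add: hd_append)
  qed (simp add: taup_0)
qed simp

lemma rdual_nf: "list_all proper xs \<Longrightarrow> successively lw xs \<Longrightarrow> list_all proper (rdual xs) \<and> successively lw (rdual xs)"
proof (induction xs)
  case (Cons x xs)
  have px: "proper (sdual x)" using Cons.prems by (simp add: proper_def unary_tables)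
  show ?case
  proof (cases xs)
    case Nil
    then show ?thesis using px by (simp add: proper_taup)
  next
    case (Cons y ys)
    have "lw x y" using Cons.prems Cons by simp
    then have "lw (sdual y) (stau (sdual x))" by (rule binary_tables(16))
    then have "lw (taup (int (length ys)) (sdual y)) (taup (int (length ys)) (taup 1 (sdual x)))"
      by (simp add: lw_taup taup_1)
    then have "lw (last (rdual xs)) (taup (int (length xs)) (sdual x))"
      using Cons by (simp add: taup_add[symmetric] add.commute)
    moreover have "list_all proper (rdual xs) \<and> successively lw (rdual xs)"
      using Cons.IH Cons.prems Cons by simp
    ultimately show ?thesis
      using px by (auto simp: successively_append_iff proper_taup)
  qed
qed simp

lemma nf_binv_mult: "nf (binv x \<cdot> dpow (finf x + int (length (nfs x)))) = (0, rdual (nfs x))"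
proof (rule nf_eqI)
  let ?X = "bprod (map br (nfs x))"
  have "binv x = binv ?X \<cdot> dpow (- finf x)"
    by (subst nf_decomp[of x]) (simp add: gsimps binv_dpow)
  then show "binv x \<cdot> dpow (finf x + int (length (nfs x))) = dpow 0 \<cdot> bprod (map br (rdual (nfs x)))"
    by (simp add: bprod_rdual[symmetric] gsimps dpow_add dpow_0 dpow_cancel)
qed (use rdual_nf[OF nfs_proper] in auto)

lemma finf_binv: "finf (binv x) = - (finf x + int (length (nfs x)))"
  using nf_binv_mult[of x] nf_mult_dpow[of "binv x" "finf x + int (length (nfs x))"] by simp

section \<open>The notions of the statement in terms of \<open>nf\<close>\<close>

lemma pos_simple: "simple x \<longleftrightarrow> (\<exists>s. x = br s)"
proof
  assume "simple x"
  then have p: "pos x" and d: "x \<preccurlyeq> delta" by (simp_all add: simple_def prefix_one)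
  have "x \<preccurlyeq> br (hsim x)" using hsim_glb[OF p prefix_refl d] .
  then show "\<exists>s. x = br s" using prefix_antisym br_hsim_prefix[OF p] by blast
next
  assume "\<exists>s. x = br s"
  then obtain s where "x = br s" by blast
  then show "simple x"
    using pos_br br_prefix_br[of s DL] by (simp add: simple_def prefix_one sle_simps br_simps)
qed

lemma left_weighted_br: "left_weighted (br s) (br t) \<longleftrightarrow> lw s t"
  using br_inj[of _ E0] by (simp add: left_weighted_def bpartial_def br_binv meet_br lw_def br_simps)

lemma is_lnf_iff: "is_lnf x p xs \<longleftrightarrow> (\<exists>ts. xs = map br ts \<and> nf x = (p, ts))"
proof
  assume l: "is_lnf x p xs"
  then have "\<forall>s\<in>set xs. \<exists>t. s = br t" by (auto simp: is_lnf_def pos_simple)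
  then obtain ts where ts: "xs = map br ts" by (metis ex_map_conv)
  have "list_all proper ts"
    using l br_simps(1,2) by (auto simp: is_lnf_def ts list_all_iff proper_def)
  moreover have "successively lw ts"
    using l by (auto simp: is_lnf_def ts successively_conv_nth left_weighted_br)
  ultimately have "nf x = (p, ts)" using l by (intro nf_eqI) (auto simp: is_lnf_def ts)
  then show "\<exists>ts. xs = map br ts \<and> nf x = (p, ts)" using ts by blast
next
  assume "\<exists>ts. xs = map br ts \<and> nf x = (p, ts)"
  then obtain ts where ts: "xs = map br ts" "nf x = (p, ts)" by blast
  have pr: "list_all proper ts" "successively lw ts" using nfs_proper[of x] ts by simp_all
  show "is_lnf x p xs"
    unfolding is_lnf_def
  proof (intro conjI)
    show "x = dpow p \<cdot> bprod xs" using nf_decomp[of x] ts by simp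
    show "dpow p \<preccurlyeq> x" "\<not> dpow (p + 1) \<preccurlyeq> x" using ts by (simp_all add: dpow_prefix)
    show "\<forall>s\<in>set xs. simple s \<and> s \<noteq> bone \<and> s \<noteq> delta"
      using pr(1) br_inj[of _ E0] br_inj[of _ DL]
      by (auto simp: ts(1) pos_simple list_all_iff proper_def br_simps)
    show "\<forall>i. Suc i < length xs \<longrightarrow> left_weighted (xs ! i) (xs ! Suc i)"
      using pr(2) by (auto simp: ts(1) successively_conv_nth left_weighted_br)
  qed
qed

lemma lnf_nf: "lnf x = (finf x, map br (nfs x))"
  unfolding lnf_def by (rule the_equality) (auto simp: is_lnf_iff)

lemma binf_nf: "binf x = finf x" and clen_nf: "clen x = length (nfs x)"
  by (simp_all add: binf_def clen_def lnf_nf)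

lemma tau_pow_br: "tau_pow k (br s) = br (taup k s)"
  using br_dpow[of s k] by (simp add: tau_pow_def bconj_def binv_dpow gsimps dpow_cancel dpow_0)

lemma iota_nf: "nfs x \<noteq> [] \<Longrightarrow> iota x = br (taup (- finf x) (hd (nfs x)))"
  by (simp add: iota_def lnf_nf binf_nf hd_map tau_pow_br)

lemma varphi_nf: "nfs x \<noteq> [] \<Longrightarrow> varphi x = br (last (nfs x))"
  by (simp add: varphi_def lnf_nf last_map)

lemma rigid_nf: "rigid x \<longleftrightarrow> nfs x \<noteq> [] \<and> lw (last (nfs x)) (taup (- finf x) (hd (nfs x)))"
  by (cases "nfs x = []") (auto simp: rigid_def clen_nf iota_nf varphi_nf left_weighted_br Suc_le_eq)

lemma pfac_nf: "nfs x \<noteq> [] \<Longrightarrow> pfac x = br (smeet (taup (- finf x) (hd (nfs x))) (sdual (last (nfs x))))"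
  by (simp add: pfac_def iota_nf varphi_nf bpartial_def br_binv meet_br)

lemma hsim_iota: "nfs x \<noteq> [] \<Longrightarrow> hsim (x \<cdot> dpow (- finf x)) = taup (- finf x) (hd (nfs x))"
  by (cases "nfs x") (simp_all add: hsim_def nf_mult_dpow hdE_def)

lemma hsim_varphi: "nfs x \<noteq> [] \<Longrightarrow> hsim (binv x \<cdot> dpow (finf x + int (length (nfs x)))) = sdual (last (nfs x))"
  using nf_binv_mult[of x] rdual_hd[of "nfs x"] length_rdual[of "nfs x"]
  by (cases "rdual (nfs x)") (auto simp: hsim_def hdE_def)

text \<open>A description of the preferred prefix by inequalities only: this is what makes it compatible with
  conjugation.\<close>

lemma prefix_pfac:
  assumes "nfs x \<noteq> []"
  shows "z \<preccurlyeq> pfac x \<longleftrightarrow>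
    z \<preccurlyeq> x \<cdot> dpow (- finf x) \<and> z \<preccurlyeq> binv x \<cdot> dpow (finf x + int (length (nfs x))) \<and> z \<preccurlyeq> delta"
proof -
  let ?u = "x \<cdot> dpow (- finf x)" and ?v = "binv x \<cdot> dpow (finf x + int (length (nfs x)))"
  have p: "pos ?u" "pos ?v" using nf_binv_mult[of x] by (simp_all add: nf_mult_dpow)
  have d: "br s \<preccurlyeq> delta" for s using br_prefix_br[of s DL] by (simp add: sle_simps br_simps)
  have "z \<preccurlyeq> pfac x \<longleftrightarrow> z \<preccurlyeq> br (hsim ?u) \<and> z \<preccurlyeq> br (hsim ?v)"
    using is_glb_br[of "hsim ?u" "hsim ?v"] prefix_trans
    unfolding pfac_nf[OF assms] hsim_iota[OF assms] hsim_varphi[OF assms] is_glb_def by blast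
  then show ?thesis
    using hsim_glb[OF p(1), of z] hsim_glb[OF p(2), of z] br_hsim_prefix[OF p(1)] br_hsim_prefix[OF p(2)] d prefix_trans
    by blast
qed

section \<open>Rigid conjugates\<close>

text \<open>Collecting the factors \<delta>^p of a power of \<delta>^p w in front rotates the copies
  of w by different multiples of p; the last copy stays as it is.\<close>

primrec pw :: "int \<Rightarrow> sim list \<Rightarrow> nat \<Rightarrow> sim list" where
  "pw p xs 0 = []"
| "pw p xs (Suc n) = map (taup (int n * p)) xs @ pw p xs n"

lemma length_pw: "length (pw p xs n) = n * length xs"
  by (induction n) auto

lemma hd_pw: "xs \<noteq> [] \<Longrightarrow> hd (pw p xs (Suc n)) = taup (int n * p) (hd xs)"
  by (simp add: hd_map)

lemma last_pw: "xs \<noteq> [] \<Longrightarrow> last (pw p xs (Suc n)) = last xs"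
proof (induction n)
  case 0
  then show ?case by (simp add: taup_0 last_map cong: map_cong)
next
  case (Suc n)
  then have "pw p xs (Suc n) \<noteq> []" using length_pw[of p xs "Suc n"] by auto
  then show ?case
    unfolding pw.simps(2)[of p xs "Suc n"] using Suc by (simp del: pw.simps)
qed

text \<open>Rigidity is exactly left-weightedness at the seams between consecutive copies.\<close>

lemma nf_bpow:
  assumes "rigid x"
  shows "nf (bpow x n) = (int n * finf x, pw (finf x) (nfs x) n)"
proof (induction n)
  case 0
  show ?case by (simp add: bpow_simps nf_bone)
next
  case (Suc n)
  let ?p = "finf x" and ?xs = "nfs x"
  have ne: "?xs \<noteq> []" and lwr: "lw (last ?xs) (taup (- ?p) (hd ?xs))"
    using assms by (simp_all add: rigid_nf)
  show ?case
  proof (rule nf_eqI)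
    have "bpow x n = dpow (int n * ?p) \<cdot> bprod (map br (pw ?p ?xs n))"
      using nf_decomp[of "bpow x n"] Suc by simp
    then have "bpow x (Suc n) = dpow ?p \<cdot> (bprod (map br ?xs) \<cdot> dpow (int n * ?p)) \<cdot> bprod (map br (pw ?p ?xs n))"
      by (subst nf_decomp[of x], simp add: bpow_simps) (metis bmult_assoc nf_decomp)
    also have "\<dots> = dpow (int (Suc n) * ?p) \<cdot> bprod (map br (pw ?p ?xs (Suc n)))"
      unfolding bprod_dpow by (simp add: bprod_append gsimps dpow_cancel algebra_simps)
    finally show "bpow x (Suc n) = dpow (int (Suc n) * ?p) \<cdot> bprod (map br (pw ?p ?xs (Suc n)))" .
    have IH: "list_all proper (pw ?p ?xs n)" "successively lw (pw ?p ?xs n)"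
      using nfs_proper[of "bpow x n"] Suc by simp_all
    have m: "list_all proper (map (taup (int n * ?p)) ?xs)" "successively lw (map (taup (int n * ?p)) ?xs)"
      using nfs_proper[of x] by (simp_all add: list_all_iff proper_taup successively_map lw_taup)
    show "list_all proper (pw ?p ?xs (Suc n))" using IH m by simp
    show "successively lw (pw ?p ?xs (Suc n))"
    proof (cases n)
      case 0
      then show ?thesis using m by simp
    next
      case (Suc k)
      have "lw (taup (int n * ?p) (last ?xs)) (taup (int n * ?p) (taup (- ?p) (hd ?xs)))"
        using lwr by (simp add: lw_taup)
      then have "lw (taup (int n * ?p) (last ?xs)) (taup (int k * ?p) (hd ?xs))"
        by (simp add: taup_add[symmetric] Suc algebra_simps)
      then have "lw (last (map (taup (int n * ?p)) ?xs)) (hd (pw ?p ?xs n))"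
        using ne hd_pw[OF ne, of ?p k] unfolding Suc by (simp add: last_map del: pw.simps)
      then show ?thesis using IH m by (simp add: successively_append_iff)
    qed
  qed
qed

section \<open>Infima of conjugates of rigid braids\<close>

lemma bconj_bpow: "bpow (bconj x z) n = bconj (bpow x n) z"
  by (induction n) (simp_all add: bpow_simps bconj_def gsimps)

lemma bconj_bconj: "bconj (bconj x z) w = bconj x (z \<cdot> w)"
  by (simp add: bconj_def gsimps)

lemma bconj_binv: "binv (bconj x z) = bconj (binv x) z"
  by (simp add: bconj_def gsimps)

lemma bconj_bone: "bconj x bone = x"
  by (simp add: bconj_def gsimps)

lemma binv_bpow: "binv (bpow x n) = bpow (binv x) n"
proof (induction n)
  case (Suc n)
  then show ?case using bpow_commute[of "binv x" n] by (simp add: bpow_simps gsimps)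
qed (simp add: bpow_simps gsimps)

lemma finf_bconj: "\<exists>c\<ge>0. \<forall>w. \<bar>finf (bconj w z) - finf w\<bar> \<le> c"
proof (intro exI conjI allI)
  let ?c = "\<bar>finf z\<bar> + \<bar>finf (binv z)\<bar>"
  show "0 \<le> ?c" by simp
  fix w
  have "finf (binv z) + (finf w + finf z) \<le> finf (bconj w z)"
    using finf_mult[of "binv z" "w \<cdot> z"] finf_mult[of w z] by (simp add: bconj_def gsimps)
  moreover have "finf z + (finf (bconj w z) + finf (binv z)) \<le> finf w"
    using finf_mult[of z "bconj w z \<cdot> binv z"] finf_mult[of "bconj w z" "binv z"]
    by (simp add: bconj_def gsimps)
  ultimately show "\<bar>finf (bconj w z) - finf w\<bar> \<le> ?c" by linarith
qed

lemma finf_bpow: "int n * finf x \<le> finf (bpow x n)"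
proof (induction n)
  case (Suc n)
  then show ?case using finf_mult[of x "bpow x n"] by (simp add: bpow_simps algebra_simps)
qed (simp add: bpow_simps nf_bone)

lemma finf_binv_bpow:
  assumes "rigid x"
  shows "finf (bpow (binv x) n) = - (int n * (finf x + int (length (nfs x))))"
  using finf_binv[of "bpow x n"] nf_bpow[OF assms, of n] length_pw[of "finf x" "nfs x" n]
  by (simp add: binv_bpow algebra_simps)

lemma int_bound: "(\<And>n. int n * a \<le> int n * b + c) \<Longrightarrow> (a::int) \<le> b"
proof (rule ccontr)
  assume H: "\<And>n. int n * a \<le> int n * b + c" and "\<not> a \<le> b"
  then have "1 \<le> a - b" by simp
  then have "int n \<le> int n * (a - b)" for n by (simp add: mult_le_cancel_left1)
  moreover have "int (nat (\<bar>c\<bar> + 1)) * (a - b) \<le> c" using H[of "nat (\<bar>c\<bar> + 1)"] by (simp add: algebra_simps)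
  ultimately have "\<bar>c\<bar> + 1 \<le> c" by (metis abs_ge_zero add_nonneg_nonneg int_nat_eq order_trans zero_le_one)
  then show False by simp
qed

text \<open>For a rigid braid the infimum of the n-th power is exactly n times the infimum, and
  conjugation by a fixed \<open>z\<close> changes infima by a bounded amount. For an arbitrary braid
  the infimum of the power is at least this multiple, so no conjugate can have a larger infimum; the
  same holds for inverses.\<close>

lemma rigid_summit:
  assumes "rigid x"
  obtains c where "\<And>n. int n * finf x - c \<le> finf (bpow (bconj x z) n)"
    and "\<And>n. - (int n * (finf x + int (length (nfs x)))) - c \<le> finf (bpow (binv (bconj x z)) n)"
    and "finf (bconj x z) \<le> finf x" and "finf (binv (bconj x z)) \<le> - (finf x + int (length (nfs x)))"
proof -
  obtain c where c: "\<And>w. \<bar>finf (bconj w z) - finf w\<bar> \<le> c" using finf_bconj[of z] by blast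
  have 1: "\<bar>finf (bpow (bconj x z) n) - int n * finf x\<bar> \<le> c" for n
    using c[of "bpow x n"] nf_bpow[OF assms, of n] by (simp add: bconj_bpow)
  have 2: "\<bar>finf (bpow (binv (bconj x z)) n) + int n * (finf x + int (length (nfs x)))\<bar> \<le> c" for n
    using c[of "bpow (binv x) n"] finf_binv_bpow[OF assms, of n] by (simp add: bconj_binv bconj_bpow)
  show thesis
  proof (rule that)
    show "int n * finf x - c \<le> finf (bpow (bconj x z) n)" for n using 1[of n] by linarith
    show "- (int n * (finf x + int (length (nfs x)))) - c \<le> finf (bpow (binv (bconj x z)) n)" for n
      using 2[of n] by linarith
    show "finf (bconj x z) \<le> finf x"
    proof (rule int_bound)
      show "int n * finf (bconj x z) \<le> int n * finf x + c" for n
        using 1[of n] finf_bpow[of n "bconj x z"] by linarith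
    qed
    show "finf (binv (bconj x z)) \<le> - (finf x + int (length (nfs x)))"
    proof (rule int_bound)
      show "int n * finf (binv (bconj x z)) \<le> int n * - (finf x + int (length (nfs x))) + c" for n
        using 2[of n] finf_bpow[of n "binv (bconj x z)"] by (simp add: algebra_simps)
    qed
  qed
qed

lemma prefix_twist: "g \<cdot> z \<cdot> dpow k \<preccurlyeq> w \<longleftrightarrow> z \<preccurlyeq> binv g \<cdot> (w \<cdot> dpow (- k))"
  by (simp add: prefix_dpow_left) (simp add: prefix_move)

lemma glb_chain: "\<exists>m. \<forall>z. z \<preccurlyeq> m \<longleftrightarrow> (\<forall>d\<le>n. z \<preccurlyeq> f d)" for f :: "nat \<Rightarrow> braid"
proof (induction n)
  case 0
  show ?case by auto
next
  case (Suc n)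
  then obtain m where m: "\<And>z. z \<preccurlyeq> m \<longleftrightarrow> (\<forall>d\<le>n. z \<preccurlyeq> f d)" by blast
  obtain k where k: "is_glb k m (f (Suc n))" using glb_exists by blast
  have "z \<preccurlyeq> k \<longleftrightarrow> (\<forall>d\<le>Suc n. z \<preccurlyeq> f d)" for z
  proof
    assume "z \<preccurlyeq> k"
    then have "z \<preccurlyeq> m" "z \<preccurlyeq> f (Suc n)" using k prefix_trans unfolding is_glb_def by blast+
    then show "\<forall>d\<le>Suc n. z \<preccurlyeq> f d" using m by (auto simp: le_Suc_eq)
  next
    assume "\<forall>d\<le>Suc n. z \<preccurlyeq> f d"
    then show "z \<preccurlyeq> k" using m k by (simp add: is_glb_def)
  qed
  then show ?case by blast
qed

text \<open>Iterating a sliding-type recursion yields the meets of the elements \<open>y\<^sup>d \<delta>\<^sup>-\<^sup>d\<^sup>(\<^sup>q\<^sup>+\<^sup>1\<^sup>)\<close> and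
  \<open>y\<^sup>-\<^sup>d \<delta>\<^sup>d\<^sup>(\<^sup>q\<^sup>'\<^sup>-\<^sup>1\<^sup>)\<close>. If the former are bounded below, their decreasing sequence of meets becomes
  stationary, and then the infimum of the conjugate has increased.\<close>

lemma sliding_increases_inf:
  assumes B0: "B 0 = bone"
    and rec: "\<And>n z. z \<preccurlyeq> B (Suc n) \<longleftrightarrow>
      z \<preccurlyeq> y \<cdot> (B n \<cdot> dpow (- q)) \<and> z \<preccurlyeq> binv y \<cdot> (B n \<cdot> dpow q') \<and> z \<preccurlyeq> B n \<cdot> delta"
    and gap: "2 \<le> q' - q"
    and low: "\<And>d. - c \<le> finf (bpow y d) - int d * (q + 1)"
  shows "\<exists>n. B n \<cdot> dpow (q + 1) \<preccurlyeq> y \<cdot> B n"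
proof -
  define T where "T d = bpow y d \<cdot> dpow (- (int d * (q + 1)))" for d
  define U where "U d = bpow (binv y) d \<cdot> dpow (int d * (q' - 1))" for d
  define D where "D n = B n \<cdot> dpow (- int n)" for n
  have TU0: "T 0 = bone" "U 0 = bone" by (simp_all add: T_def U_def bpow_simps dpow_0 gsimps)
  have TS: "y \<cdot> (T d \<cdot> dpow (- (q + 1))) = T (Suc d)" for d
    by (simp add: T_def bpow_simps gsimps dpow_add[symmetric] algebra_simps)
  have US: "binv y \<cdot> (U d \<cdot> dpow (q' - 1)) = U (Suc d)" for d
    by (simp add: U_def bpow_simps gsimps dpow_add[symmetric] algebra_simps)
  have TU: "y \<cdot> (U (Suc d) \<cdot> dpow (- (q + 1))) = U d \<cdot> dpow (q' - q - 2)" for d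
    by (simp add: US[symmetric] gsimps dpow_add[symmetric] algebra_simps)
  have UT: "binv y \<cdot> (T (Suc d) \<cdot> dpow (q' - 1)) = T d \<cdot> dpow (q' - q - 2)" for d
    by (simp add: TS[symmetric] gsimps dpow_add[symmetric] algebra_simps)
  \<comment> \<open>The gap hypothesis makes this exponent nonnegative, so the mixed terms of the
    recursion follow from earlier ones.\<close>
  have up: "z \<preccurlyeq> w \<Longrightarrow> z \<preccurlyeq> w \<cdot> dpow (q' - q - 2)" for z w
    using prefix_mult_pos[of "dpow (q' - q - 2)" w] gap prefix_trans by (simp add: nf_dpow)
  have Drec: "z \<preccurlyeq> D (Suc n) \<longleftrightarrow>
      z \<preccurlyeq> y \<cdot> (D n \<cdot> dpow (- (q + 1))) \<and> z \<preccurlyeq> binv y \<cdot> (D n \<cdot> dpow (q' - 1)) \<and> z \<preccurlyeq> D n" for z n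
  proof -
    have "z \<preccurlyeq> D (Suc n) \<longleftrightarrow> z \<cdot> dpow (int (Suc n)) \<preccurlyeq> B (Suc n)"
      by (simp add: D_def prefix_dpow_left)
    also have "\<dots> \<longleftrightarrow> z \<preccurlyeq> (y \<cdot> (B n \<cdot> dpow (- q))) \<cdot> dpow (- int (Suc n))
        \<and> z \<preccurlyeq> (binv y \<cdot> (B n \<cdot> dpow q')) \<cdot> dpow (- int (Suc n)) \<and> z \<preccurlyeq> (B n \<cdot> dpow 1) \<cdot> dpow (- int (Suc n))"
      unfolding rec prefix_dpow_left dpow_1 ..
    finally show ?thesis
      by (simp add: D_def gsimps dpow_add[symmetric] algebra_simps)
  qed
  have Dn: "z \<preccurlyeq> D n \<longleftrightarrow> (\<forall>d\<le>n. z \<preccurlyeq> T d \<and> z \<preccurlyeq> U d)" for z n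
  proof (induction n arbitrary: z)
    case 0
    show ?case by (simp add: D_def B0 dpow_0 gsimps TU0)
  next
    case (Suc n)
    have 1: "z \<preccurlyeq> y \<cdot> (D n \<cdot> dpow (- (q + 1))) \<longleftrightarrow>
        (\<forall>d\<le>n. z \<preccurlyeq> y \<cdot> (T d \<cdot> dpow (- (q + 1))) \<and> z \<preccurlyeq> y \<cdot> (U d \<cdot> dpow (- (q + 1))))"
      using Suc[of "binv y \<cdot> z \<cdot> dpow (q + 1)"] unfolding prefix_twist binv_binv .
    have 2: "z \<preccurlyeq> binv y \<cdot> (D n \<cdot> dpow (q' - 1)) \<longleftrightarrow>
        (\<forall>d\<le>n. z \<preccurlyeq> binv y \<cdot> (T d \<cdot> dpow (q' - 1)) \<and> z \<preccurlyeq> binv y \<cdot> (U d \<cdot> dpow (q' - 1)))"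
      using Suc[of "y \<cdot> z \<cdot> dpow (- (q' - 1))"] unfolding prefix_twist minus_minus .
    show ?case
    proof
      assume "z \<preccurlyeq> D (Suc n)"
      then show "\<forall>d\<le>Suc n. z \<preccurlyeq> T d \<and> z \<preccurlyeq> U d"
        unfolding Drec 1 2 TS US Suc[of z] le_Suc_eq by blast
    next
      assume H: "\<forall>d\<le>Suc n. z \<preccurlyeq> T d \<and> z \<preccurlyeq> U d"
      have "z \<preccurlyeq> y \<cdot> (U d \<cdot> dpow (- (q + 1)))" if "d \<le> n" for d
      proof (cases d)
        case 0
        then show ?thesis using H TS[of 0] by (simp add: TU0)
      next
        case (Suc e)
        then show ?thesis using H TU[of e] up that by simp
      qed
      moreover have "z \<preccurlyeq> binv y \<cdot> (T d \<cdot> dpow (q' - 1))" if "d \<le> n" for d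
      proof (cases d)
        case 0
        then show ?thesis using H US[of 0] by (simp add: TU0)
      next
        case (Suc e)
        then show ?thesis using H UT[of e] up that by simp
      qed
      ultimately show "z \<preccurlyeq> D (Suc n)"
        unfolding Drec 1 2 TS US Suc[of z] using H by auto
    qed
  qed
  have "\<exists>N. \<forall>n z. z \<preccurlyeq> N n \<longleftrightarrow> (\<forall>d\<le>n. z \<preccurlyeq> T d)"
    using glb_chain[of _ T] by (intro choice allI) blast
  then obtain N where N: "\<And>n z. z \<preccurlyeq> N n \<longleftrightarrow> (\<forall>d\<le>n. z \<preccurlyeq> T d)" by blast
  have dec: "N (Suc n) \<preccurlyeq> N n" for n using N[of "N (Suc n)" "Suc n"] N prefix_refl by (metis le_SucI)
  have "dpow (- c) \<preccurlyeq> T d" for d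
    using low[of d] by (simp add: dpow_prefix T_def nf_mult_dpow)
  then have "dpow (- c) \<preccurlyeq> N n" for n using N by blast
  then have bound: "- (3 * c) \<le> blen (N n)" for n using prefix_blen by (metis blen_dpow mult_minus_right)
  have "\<exists>n. N n \<preccurlyeq> T (Suc n)"
  proof (rule ccontr)
    assume H: "\<nexists>n. N n \<preccurlyeq> T (Suc n)"
    have strict: "blen (N (Suc n)) < blen (N n)" for n
    proof (rule ccontr)
      assume "\<not> ?thesis"
      then have "N (Suc n) = N n" using prefix_blen_eq[OF dec[of n]] by simp
      then show False using N[of "N n" "Suc n"] prefix_refl H by (metis order_refl)
    qed
    have "blen (N n) \<le> blen (N 0) - int n" for n
    proof (induction n)
      case (Suc n)
      then show ?case using strict[of n] by simp
    qed simp
    from this[of "nat (blen (N 0) + 3 * c + 1)"] bound[of "nat (blen (N 0) + 3 * c + 1)"] bound[of 0]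
    show False by simp
  qed
  then obtain n where n: "N n \<preccurlyeq> T (Suc n)" by blast
  have DT: "D n \<preccurlyeq> T d" if "d \<le> Suc n" for d
  proof (cases "d = Suc n")
    case True
    have "D n \<preccurlyeq> N n" using Dn[of "D n" n] prefix_refl by (simp add: N)
    then show ?thesis using n prefix_trans True by blast
  next
    case False
    then show ?thesis using Dn[of "D n" n] prefix_refl that by simp
  qed
  have DU: "D n \<preccurlyeq> U d" if "d \<le> n" for d
    using Dn[of "D n" n] prefix_refl that by simp
  \<comment> \<open>This is the goal in disguise: it says that conjugating \<open>y\<close> by
    \<open>D n\<close> gives a braid of infimum at least q + 1. It holds because the description of
    \<open>D n\<close> by \<open>T\<close> and \<open>U\<close> is stable under the shift once the
    meets of the \<open>T d\<close> are stationary.\<close>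
  have "binv y \<cdot> D n \<cdot> dpow (q + 1) \<preccurlyeq> D n"
    unfolding Dn
  proof (intro allI impI conjI)
    fix d assume d: "d \<le> n"
    show "binv y \<cdot> D n \<cdot> dpow (q + 1) \<preccurlyeq> T d"
      unfolding prefix_twist binv_binv TS using DT[of "Suc d"] d by simp
    have "D n \<preccurlyeq> y \<cdot> (U d \<cdot> dpow (- (q + 1)))"
    proof (cases d)
      case 0
      then show ?thesis using DT[of 1] TS[of 0] by (simp add: TU0)
    next
      case (Suc e)
      then show ?thesis using DU[of e] TU[of e] up d by simp
    qed
    then show "binv y \<cdot> D n \<cdot> dpow (q + 1) \<preccurlyeq> U d"
      unfolding prefix_twist binv_binv .
  qed
  then have "D n \<cdot> dpow (q + 1) \<preccurlyeq> y \<cdot> D n"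
    by (simp add: prefix_move bmult_assoc binv_binv)
  then have "(D n \<cdot> dpow (q + 1)) \<cdot> dpow (int n) \<preccurlyeq> (y \<cdot> D n) \<cdot> dpow (int n)"
    by (simp add: prefix_dpow)
  then have "B n \<cdot> dpow (q + 1) \<preccurlyeq> y \<cdot> B n"
    by (simp add: D_def gsimps dpow_add[symmetric] dpow_0)
  then show ?thesis by blast
qed

lemma pfac_pos: "nfs x \<noteq> [] \<Longrightarrow> pos (pfac x)"
  by (simp add: pfac_nf pos_br)

lemma rigid_pfac: "rigid x \<longleftrightarrow> nfs x \<noteq> [] \<and> pfac x = bone"
proof -
  have "br u = bone \<longleftrightarrow> u = E0" for u by (metis br_inj br_simps(1))
  then show ?thesis
    by (cases "nfs x = []") (simp_all add: rigid_nf pfac_nf lw_def binary_tables(1)[of "sdual _"])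
qed

lemma cslide_nf: "cslide x = (if nfs x = [] then x else bconj x (pfac x))"
  by (simp add: cslide_def clen_nf)

lemma finf_cslide: "finf x \<le> finf (cslide x)" "finf (binv x) \<le> finf (binv (cslide x))"
proof -
  let ?s = "pfac x"
  have "finf x \<le> finf (bconj x ?s) \<and> finf (binv x) \<le> finf (binv (bconj x ?s))" if ne: "nfs x \<noteq> []"
  proof
    have s: "?s \<preccurlyeq> x \<cdot> dpow (- finf x)" "?s \<preccurlyeq> binv x \<cdot> dpow (- finf (binv x))"
      using prefix_pfac[OF ne, of ?s] prefix_refl by (simp_all add: finf_binv add.commute)
    have "x \<preccurlyeq> x \<cdot> ?s" "binv x \<preccurlyeq> binv x \<cdot> ?s" using pfac_pos[OF ne] prefix_mult_pos by blast+
    then have "?s \<cdot> dpow (finf x) \<preccurlyeq> x \<cdot> ?s" "?s \<cdot> dpow (finf (binv x)) \<preccurlyeq> binv x \<cdot> ?s"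
      using s prefix_trans by (metis prefix_dpow_left minus_minus)+
    then show "finf x \<le> finf (bconj x ?s)" "finf (binv x) \<le> finf (binv (bconj x ?s))"
      by (simp_all add: prefix_move bconj_binv, simp_all add: bconj_def dpow_prefix gsimps)
  qed
  then show "finf x \<le> finf (cslide x)" "finf (binv x) \<le> finf (binv (cslide x))"
    by (auto simp: cslide_nf)
qed

text \<open>This larger set is counted in place of \<open>SC x\<close>: it is stable under meets of
  conjugators and under fourth powers, which is not apparent for sliding circuits.\<close>

definition rset :: "braid \<Rightarrow> braid set" where
  "rset x = {y. conjugate y x \<and> rigid y \<and> finf y = finf x \<and> length (nfs y) = length (nfs x)}"

text \<open>Along a circuit the infima of the braid and of its inverse cannot decrease, hence they
  are constant. The accumulated conjugators \<open>B n\<close> then obey the recursion of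
  \<open>sliding_increases_inf\<close>, which excludes values below those of \<open>x\<close>. With
  equal values the conjugators stay bounded, and this forces the preferred prefix of
  \<open>y\<close> to be trivial.\<close>

theorem SC_subset_rset:
  assumes "rigid x"
  shows "SC x \<subseteq> rset x"
proof
  fix y assume "y \<in> SC x"
  then obtain k z0 where k: "k \<ge> 1" "(cslide ^^ k) y = y" and z0: "y = bconj x z0"
    by (auto simp: SC_def conjugate_def)
  let ?p = "finf x" and ?r = "int (length (nfs x))"
  have r: "?r \<ge> 1" using assms by (cases "nfs x") (auto simp: rigid_nf)
  have ne: "nfs (bconj x w) \<noteq> []" for w
  proof
    assume "nfs (bconj x w) = []"
    then have "finf (binv (bconj x w)) = - finf (bconj x w)" by (simp add: finf_binv)
    moreover obtain c where "finf (bconj x w) \<le> ?p" "finf (binv (bconj x w)) \<le> - (?p + ?r)"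
      using rigid_summit[OF assms, of w] by metis
    ultimately show False using r by linarith
  qed
  define Y where "Y n = (cslide ^^ n) y" for n
  define B where "B = rec_nat bone (\<lambda>n b. b \<cdot> pfac (Y n))"
  have B: "B 0 = bone" "B (Suc n) = B n \<cdot> pfac (Y n)" for n by (simp_all add: B_def)
  have YB: "Y n = bconj y (B n)" for n
  proof (induction n)
    case 0
    show ?case by (simp add: Y_def B bconj_bone)
  next
    case (Suc n)
    have "nfs (Y n) \<noteq> []" using ne[of "z0 \<cdot> B n"] Suc by (simp add: z0 bconj_bconj)
    then have "Y (Suc n) = bconj (Y n) (pfac (Y n))" by (simp add: Y_def cslide_nf)
    then show ?case using Suc by (simp add: B bconj_bconj)
  qed
  have neY: "nfs (Y n) \<noteq> []" for n using ne[of "z0 \<cdot> B n"] YB[of n] by (simp add: z0 bconj_bconj)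
  have per: "Y (m * k) = y" for m
  proof (induction m)
    case (Suc m)
    have "Y (k + m * k) = (cslide ^^ k) (Y (m * k))" by (simp add: Y_def funpow_add)
    then show ?case using Suc k by simp
  qed (simp add: Y_def)
  have mono: "i \<le> j \<Longrightarrow> finf (Y i) \<le> finf (Y j) \<and> finf (binv (Y i)) \<le> finf (binv (Y j))" for i j
  proof (induction j rule: dec_induct)
    case (step j)
    then show ?case using finf_cslide[of "Y j"] by (simp add: Y_def)
  qed simp
  have const: "finf (Y n) = finf y" "finf (binv (Y n)) = finf (binv y)" for n
  proof -
    have "n \<le> n * k" using k by simp
    then show "finf (Y n) = finf y" "finf (binv (Y n)) = finf (binv y)"
      using mono[of 0 n] mono[of n "n * k"] per[of n] per[of 0] by auto
  qed
  let ?q = "finf y" let ?q' = "- finf (binv y)"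
  have rec: "z \<preccurlyeq> B (Suc n) \<longleftrightarrow>
      z \<preccurlyeq> y \<cdot> (B n \<cdot> dpow (- ?q)) \<and> z \<preccurlyeq> binv y \<cdot> (B n \<cdot> dpow ?q') \<and> z \<preccurlyeq> B n \<cdot> delta" for n z
  proof -
    have "z \<preccurlyeq> B (Suc n) \<longleftrightarrow> binv (B n) \<cdot> z \<preccurlyeq> pfac (Y n)"
      by (simp add: B prefix_move gsimps)
    also have "\<dots> \<longleftrightarrow> binv (B n) \<cdot> z \<preccurlyeq> Y n \<cdot> dpow (- ?q) \<and> binv (B n) \<cdot> z \<preccurlyeq> binv (Y n) \<cdot> dpow ?q'
        \<and> binv (B n) \<cdot> z \<preccurlyeq> delta"
    proof -
      have "finf (Y n) + int (length (nfs (Y n))) = ?q'"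
        using const[of n] finf_binv[of "Y n"] by linarith
      then show ?thesis
        using prefix_pfac[OF neY[of n], of "binv (B n) \<cdot> z"] const[of n] by simp
    qed
    finally show ?thesis by (simp add: prefix_move YB bconj_def gsimps)
  qed
  obtain c where c1: "\<And>n. int n * ?p - c \<le> finf (bpow y n)"
    and c2: "\<And>n. - (int n * (?p + ?r)) - c \<le> finf (bpow (binv y) n)"
    and q: "?q \<le> ?p" "finf (binv y) \<le> - (?p + ?r)"
    using rigid_summit[OF assms, of z0] unfolding z0 by metis
  have "?q = ?p"
  proof (rule ccontr)
    assume "?q \<noteq> ?p"
    then have lt: "?q + 1 \<le> ?p" using q by simp
    have "- c \<le> finf (bpow y d) - int d * (?q + 1)" for d
      using c1[of d] mult_left_mono[OF lt, of "int d"] by simp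
    then have "\<exists>n. B n \<cdot> dpow (?q + 1) \<preccurlyeq> y \<cdot> B n"
      using q r lt by (intro sliding_increases_inf[OF B(1) rec]) auto
    then obtain n where "B n \<cdot> dpow (?q + 1) \<preccurlyeq> y \<cdot> B n" by blast
    then have "?q + 1 \<le> finf (Y n)" by (simp add: prefix_move YB bconj_def dpow_prefix gsimps)
    then show False using const[of n] by simp
  qed
  \<comment> \<open>The recursion is symmetric under exchanging \<open>y\<close> with its inverse
    and the pair q, q' with -q', -q.\<close>
  moreover have "?q' = ?p + ?r"
  proof (rule ccontr)
    assume "?q' \<noteq> ?p + ?r"
    then have lt: "?p + ?r \<le> ?q' - 1" using q by simp
    have low: "- c \<le> finf (bpow (binv y) d) - int d * (- ?q' + 1)" for d
      using c2[of d] mult_left_mono[OF lt, of "int d"] by (simp add: algebra_simps)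
    have rec': "z \<preccurlyeq> B (Suc n) \<longleftrightarrow>
      z \<preccurlyeq> binv y \<cdot> (B n \<cdot> dpow (- (- ?q'))) \<and> z \<preccurlyeq> binv (binv y) \<cdot> (B n \<cdot> dpow (- ?q)) \<and> z \<preccurlyeq> B n \<cdot> delta" for n z
      using rec by (auto simp: binv_binv)
    have "\<exists>n. B n \<cdot> dpow (- ?q' + 1) \<preccurlyeq> binv y \<cdot> B n"
      using q r lt by (intro sliding_increases_inf[OF B(1) rec' _ low]) auto
    then obtain n where "B n \<cdot> dpow (- ?q' + 1) \<preccurlyeq> binv y \<cdot> B n" by blast
    then have "- ?q' + 1 \<le> finf (binv (Y n))"
      by (simp add: prefix_move YB bconj_def dpow_prefix gsimps)
    then show False using const[of n] by simp
  qed
  ultimately have eq: "?q = ?p" "?q' = ?p + ?r" by simp_all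
  \<comment> \<open>Chosen so that \<open>z0\<close> lies below \<delta>^m. Triviality of
    \<open>pfac x\<close> carries this bound over to all \<open>z0 \<cdot> B n\<close>.\<close>
  define m where "m = - finf (binv z0)"
  have gm: "z0 \<cdot> B n \<preccurlyeq> dpow m" for n
  proof (induction n)
    case 0
    show ?case by (simp add: B gsimps prefix_pos nf_mult_dpow m_def)
  next
    case (Suc n)
    let ?g = "z0 \<cdot> B n"
    have pre: "z \<preccurlyeq> B (Suc n) \<Longrightarrow> ?g \<preccurlyeq> dpow m \<Longrightarrow> z0 \<cdot> z \<cdot> dpow (- m) \<preccurlyeq> pfac x" for z
    proof -
      assume z: "z \<preccurlyeq> B (Suc n)" and g: "?g \<preccurlyeq> dpow m"
      have gd: "?g \<cdot> dpow j \<preccurlyeq> dpow (m + j)" for j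
        using g prefix_dpow[of ?g j "dpow m"] by (simp add: dpow_add)
      have "z0 \<cdot> z \<preccurlyeq> x \<cdot> (?g \<cdot> dpow (- ?p))"
        using z rec[of z n] eq by (simp add: prefix_move z0 bconj_def gsimps)
      then have 1: "z0 \<cdot> z \<preccurlyeq> x \<cdot> dpow (m + - ?p)" using gd prefix_trans by (meson prefix_left)
      have "z0 \<cdot> z \<preccurlyeq> binv x \<cdot> (?g \<cdot> dpow (?p + ?r))"
        using z rec[of z n] eq by (simp add: prefix_move z0 bconj_def gsimps)
      then have 2: "z0 \<cdot> z \<preccurlyeq> binv x \<cdot> dpow (m + (?p + ?r))" using gd prefix_trans by (meson prefix_left)
      have "z0 \<cdot> z \<preccurlyeq> ?g \<cdot> dpow 1"
        using z rec[of z n] by (simp add: prefix_move gsimps dpow_1)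
      then have 3: "z0 \<cdot> z \<preccurlyeq> dpow (m + 1)" using gd prefix_trans by blast
      have "nfs x \<noteq> []" using assms by (simp add: rigid_nf)
      then show ?thesis
      proof (rule iffD2[OF prefix_pfac], intro conjI)
        show "z0 \<cdot> z \<cdot> dpow (- m) \<preccurlyeq> x \<cdot> dpow (- ?p)"
          "z0 \<cdot> z \<cdot> dpow (- m) \<preccurlyeq> binv x \<cdot> dpow (?p + ?r)" "z0 \<cdot> z \<cdot> dpow (- m) \<preccurlyeq> delta"
          unfolding prefix_dpow_left dpow_1[symmetric] minus_minus
          using 1 2 3 by (simp_all add: bmult_assoc dpow_add[symmetric] add.commute add.left_commute)
      qed
    qed
    have "pfac x = bone" using assms by (simp add: rigid_pfac)
    then have "z0 \<cdot> B (Suc n) \<cdot> dpow (- m) \<preccurlyeq> bone" using pre[OF prefix_refl Suc] by simp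
    then show ?case unfolding prefix_dpow_left by (simp add: gsimps)
  qed
  have bound: "blen (B n) \<le> 3 * m - blen z0" for n
    using prefix_blen[OF gm[of n]] by (simp add: blen_mult blen_dpow)
  have pf: "pfac y = bone"
  proof (rule ccontr)
    assume H: "pfac y \<noteq> bone"
    have pp: "pos (pfac (Y n))" for n using pfac_pos neY by blast
    have one: "1 \<le> blen (pfac y)" using blen_0[of "pfac y"] blen_nonneg[of "pfac y"] pp[of 0] H
      by (fastforce simp: Y_def)
    have step: "blen (B n) \<le> blen (B (Suc n))" for n using blen_nonneg[OF pp[of n]] by (simp add: B blen_mult)
    \<comment> \<open>Every period of the circuit begins with the same factor \<open>pfac y\<close>;
      a nontrivial one would make the lengths unbounded.\<close>
    have "int j \<le> blen (B (j * k))" for j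
    proof (induction j)
      case (Suc j)
      have "blen (B (Suc (j * k))) = blen (B (j * k)) + blen (pfac y)" by (simp add: B blen_mult per)
      moreover have "blen (B (Suc (j * k))) \<le> blen (B (Suc j * k))"
        using k by (intro lift_Suc_mono_le[of "\<lambda>n. blen (B n)", OF step]) simp
      ultimately show ?case using Suc one by simp
    qed (simp add: B blen_bone)
    from this[of "nat (\<bar>3 * m - blen z0\<bar> + 1)"] bound[of "nat (\<bar>3 * m - blen z0\<bar> + 1) * k"]
    show False by simp
  qed
  have "rigid y" using pf neY[of 0] by (simp add: rigid_pfac Y_def)
  moreover have "length (nfs y) = length (nfs x)" using eq finf_binv[of y] by simp
  ultimately show "y \<in> rset x"
    using eq z0 by (auto simp: rset_def conjugate_def)
qed

section \<open>Fourth powers and convexity\<close>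

lemma dpow_central: "4 dvd k \<Longrightarrow> x \<cdot> dpow k = dpow k \<cdot> x"
proof -
  assume k: "4 dvd k"
  have "nf (x \<cdot> dpow k) = nf (dpow k \<cdot> x)"
    using k by (simp add: nf_mult_dpow nf_dpow_mult taup_4 map_idI)
  then show ?thesis by (simp add: nf_inj)
qed

text \<open>Passing to fourth powers removes the twist by \<open>\<tau>\<close>: the normal form becomes a cyclic word.\<close>

definition fourth :: "braid \<Rightarrow> braid" where
  "fourth x = dpow (- (4 * finf x)) \<cdot> bpow x 4"

lemma nf_fourth:
  assumes "rigid x"
  shows "nf (fourth x) = (0, pw (finf x) (nfs x) 4)" "rigid (fourth x)"
proof -
  show n: "nf (fourth x) = (0, pw (finf x) (nfs x) 4)"
    using nf_bpow[OF assms, of 4] by (simp add: fourth_def nf_dpow_mult)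
  have ne: "nfs x \<noteq> []" and l: "lw (last (nfs x)) (taup (- finf x) (hd (nfs x)))"
    using assms by (simp_all add: rigid_nf)
  have "taup (3 * finf x) (hd (nfs x)) = taup (4 * finf x + - finf x) (hd (nfs x))" by (simp add: algebra_simps)
  also have "\<dots> = taup (4 * finf x) (taup (- finf x) (hd (nfs x)))" by (rule taup_add)
  also have "\<dots> = taup (- finf x) (hd (nfs x))" by (simp add: taup_4)
  finally show "rigid (fourth x)"
    using hd_pw[OF ne, of "finf x" 3] last_pw[OF ne, of "finf x" 3] ne l length_pw[of "finf x" "nfs x" 4]
    unfolding rigid_nf n by (auto simp: taup_0 numeral_eq_Suc simp del: pw.simps)
qed

lemma rset_fourth:
  assumes "rigid x"
  shows "fourth ` rset x \<subseteq> rset (fourth x)" "inj_on fourth (rset x)"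
proof -
  show "fourth ` rset x \<subseteq> rset (fourth x)"
  proof
    fix w assume "w \<in> fourth ` rset x"
    then obtain y z where y: "y \<in> rset x" "w = fourth y" "y = bconj x z" by (auto simp: rset_def conjugate_def)
    have ry: "rigid y" "finf y = finf x" "length (nfs y) = length (nfs x)" using y by (simp_all add: rset_def)
    have "bpow y 4 = bconj (bpow x 4) z" by (simp add: y(3) bconj_bpow)
    then have "fourth y = (dpow (- (4 * finf x)) \<cdot> binv z) \<cdot> (bpow x 4 \<cdot> z)"
      by (simp add: fourth_def ry(2)) (simp add: bconj_def gsimps)
    also have "dpow (- (4 * finf x)) \<cdot> binv z = binv z \<cdot> dpow (- (4 * finf x))"
      by (rule dpow_central[symmetric]) simp
    finally have "fourth y = bconj (fourth x) z"
      by (simp add: fourth_def bconj_def gsimps)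
    then show "w \<in> rset (fourth x)"
      using nf_fourth[OF assms] nf_fourth[OF ry(1)] ry y(2)
      by (auto simp: rset_def conjugate_def length_pw)
  qed
  show "inj_on fourth (rset x)"
  proof (rule inj_onI)
    fix y w assume yw: "y \<in> rset x" "w \<in> rset x" "fourth y = fourth w"
    have r: "rigid y" "rigid w" "finf y = finf x" "finf w = finf x" "length (nfs y) = length (nfs w)"
      using yw by (simp_all add: rset_def)
    have "pw (finf x) (nfs y) 4 = pw (finf x) (nfs w) 4"
      using nf_fourth(1)[OF r(1)] nf_fourth(1)[OF r(2)] yw(3) r by simp
    \<comment> \<open>The last of the four blocks is not rotated, so it is the word of the braid
      itself.\<close>
    then have "drop (3 * length (nfs y)) (pw (finf x) (nfs y) 4) = drop (3 * length (nfs w)) (pw (finf x) (nfs w) 4)"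
      using r by simp
    then have "nfs y = nfs w"
      using r(5) by (simp add: numeral_eq_Suc taup_0 cong: map_cong)
    then have "nf y = nf w" using r by (simp add: prod_eq_iff)
    then show "y = w" by (simp add: nf_inj)
  qed
qed

text \<open>The bounds on the infima of the conjugate by c and of its inverse both have the form w c
  \<delta>^j \<preccurlyeq> c, and such conditions pass to meets. As for rigidity, \<open>m\<close>
  times the preferred prefix of its conjugate still lies below \<open>a\<close> and
  \<open>b\<close>, because theirs are trivial; so it lies below \<open>m\<close>.\<close>

lemma rset_convex:
  assumes "finf x = 0" "rigid x" "bconj x a \<in> rset x" "bconj x b \<in> rset x" "is_glb m a b"
  shows "bconj x m \<in> rset x"
proof -
  let ?R = "int (length (nfs x))" and ?u = "bconj x m"
  have R: "?R \<ge> 1" using assms(2) by (cases "nfs x") (auto simp: rigid_nf)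
  have mono: "w \<cdot> m \<cdot> dpow j \<preccurlyeq> m" if "w \<cdot> a \<cdot> dpow j \<preccurlyeq> a" "w \<cdot> b \<cdot> dpow j \<preccurlyeq> b" for w j
  proof -
    have "w \<cdot> m \<cdot> dpow j \<preccurlyeq> w \<cdot> a \<cdot> dpow j" "w \<cdot> m \<cdot> dpow j \<preccurlyeq> w \<cdot> b \<cdot> dpow j"
      using assms(5) by (simp_all add: is_glb_def prefix_dpow prefix_left)
    then show ?thesis using that assms(5) prefix_trans unfolding is_glb_def by blast
  qed
  have fi: "finf (bconj x c) \<ge> 0 \<longleftrightarrow> binv x \<cdot> c \<cdot> dpow 0 \<preccurlyeq> c"
    "finf (binv (bconj x c)) \<ge> - ?R \<longleftrightarrow> x \<cdot> c \<cdot> dpow (- ?R) \<preccurlyeq> c" for c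
  proof -
    show "finf (bconj x c) \<ge> 0 \<longleftrightarrow> binv x \<cdot> c \<cdot> dpow 0 \<preccurlyeq> c"
      by (simp add: prefix_pos bconj_def gsimps dpow_0)
    have "binv (x \<cdot> c \<cdot> dpow (- ?R)) \<cdot> c = dpow ?R \<cdot> binv (bconj x c)"
      by (simp add: bconj_def gsimps binv_dpow)
    then show "finf (binv (bconj x c)) \<ge> - ?R \<longleftrightarrow> x \<cdot> c \<cdot> dpow (- ?R) \<preccurlyeq> c"
      by (auto simp: prefix_pos nf_dpow_mult)
  qed
  have ab: "finf (bconj x a) = 0" "finf (bconj x b) = 0"
      "finf (binv (bconj x a)) = - ?R" "finf (binv (bconj x b)) = - ?R"
    using assms(1,3,4) by (simp_all add: rset_def finf_binv)
  have "finf ?u \<ge> 0" "finf (binv ?u) \<ge> - ?R"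
    using mono fi[of a] fi[of b] fi[of m] ab by auto
  moreover obtain c where "finf ?u \<le> finf x" "finf (binv ?u) \<le> - (finf x + ?R)"
    using rigid_summit[OF assms(2), of m] by metis
  ultimately have f: "finf ?u = 0" "length (nfs ?u) = length (nfs x)"
    using assms(1) finf_binv[of ?u] by auto
  then have ne: "nfs ?u \<noteq> []" using R by auto
  let ?s = "pfac ?u"
  have s: "?s \<preccurlyeq> ?u" "?s \<preccurlyeq> binv ?u \<cdot> dpow ?R" "?s \<preccurlyeq> delta"
    using prefix_pfac[OF ne, of ?s] prefix_refl f by (simp_all add: dpow_0 gsimps)
  have below: "m \<cdot> ?s \<preccurlyeq> c" if c: "bconj x c \<in> rset x" "m \<preccurlyeq> c" for c
  proof -
    let ?g = "bconj x c"
    have g: "nfs ?g \<noteq> []" "pfac ?g = bone" "finf ?g = 0" "length (nfs ?g) = length (nfs x)"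
      using c assms(1) by (auto simp: rset_def rigid_pfac)
    have "m \<cdot> ?s \<preccurlyeq> m \<cdot> ?u" using s(1) by (simp add: prefix_left)
    then have "m \<cdot> ?s \<preccurlyeq> x \<cdot> m" by (simp add: bconj_def gsimps)
    then have 1: "m \<cdot> ?s \<preccurlyeq> x \<cdot> c" using c(2) prefix_trans prefix_left by blast
    have "m \<cdot> ?s \<preccurlyeq> m \<cdot> (binv ?u \<cdot> dpow ?R)" using s(2) by (simp add: prefix_left)
    then have "m \<cdot> ?s \<preccurlyeq> binv x \<cdot> (m \<cdot> dpow ?R)" by (simp add: bconj_def gsimps)
    then have 2: "m \<cdot> ?s \<preccurlyeq> binv x \<cdot> (c \<cdot> dpow ?R)"
      using c(2) prefix_trans prefix_left prefix_dpow by blast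
    have "m \<cdot> ?s \<preccurlyeq> m \<cdot> dpow 1" using s(3) by (simp add: prefix_left dpow_1)
    then have 3: "m \<cdot> ?s \<preccurlyeq> c \<cdot> dpow 1" using c(2) prefix_trans prefix_dpow by blast
    have "binv c \<cdot> (m \<cdot> ?s) \<preccurlyeq> pfac ?g"
      unfolding prefix_pfac[OF g(1)] prefix_move[of "binv c"] g(3,4) using 1 2 3
      by (simp add: bconj_def gsimps dpow_0 dpow_1)
    then show ?thesis using g(2) by (simp add: prefix_move gsimps)
  qed
  have "m \<cdot> ?s \<preccurlyeq> m"
    using below[of a] below[of b] assms(3,4,5) by (simp add: is_glb_def)
  then have "?s \<preccurlyeq> bone" using prefix_left[of m ?s bone] by (simp add: gsimps)
  then have "?s = bone" using prefix_antisym pfac_pos[OF ne] by (simp add: prefix_one)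
  then show ?thesis
    using ne f assms(1) by (auto simp: rset_def rigid_pfac conjugate_def)
qed

lemma rset_trans: "finf x = finf y \<Longrightarrow> length (nfs x) = length (nfs y) \<Longrightarrow> conjugate y x \<Longrightarrow> rset y = rset x"
proof -
  assume H: "finf x = finf y" "length (nfs x) = length (nfs y)" "conjugate y x"
  then obtain z where z: "y = bconj x z" by (auto simp: conjugate_def)
  have "conjugate w y \<longleftrightarrow> conjugate w x" for w
  proof
    assume "conjugate w y"
    then show "conjugate w x" by (auto simp: conjugate_def z bconj_bconj)
  next
    assume "conjugate w x"
    then obtain u where "w = bconj x u" by (auto simp: conjugate_def)
    then have "w = bconj y (binv z \<cdot> u)" by (simp add: z bconj_bconj gsimps)
    then show "conjugate w y" by (auto simp: conjugate_def)
  qed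
  then show "rset y = rset x" using H by (simp add: rset_def)
qed

lemma bconj_dpow_rset:
  assumes "finf x = 0" "y \<in> rset x"
  shows "bconj y (dpow k) \<in> rset x"
proof -
  have y: "rigid y" "finf y = 0" "length (nfs y) = length (nfs x)" "conjugate y x"
    using assms by (auto simp: rset_def)
  have nf: "nf (bconj y (dpow k)) = (0, map (taup k) (nfs y))"
    using y by (simp add: bconj_def binv_dpow gsimps nf_dpow_mult nf_mult_dpow)
  have "rigid (bconj y (dpow k))"
    using y unfolding rigid_nf nf by (auto simp: last_map hd_map taup_0 lw_taup)
  moreover have "conjugate (bconj y (dpow k)) x" using y(4) by (auto simp: conjugate_def bconj_bconj)
  ultimately show ?thesis using nf y assms(1) by (simp add: rset_def)
qed

text \<open>By convexity, any two rigid conjugates are joined by a chain of conjugations by simple elements.\<close>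

lemma rset_induct:
  assumes x: "finf x = 0" "rigid x" and y: "y \<in> rset x"
    and base: "P x"
    and step: "\<And>u s. u \<in> rset x \<Longrightarrow> P u \<Longrightarrow> bconj u (br s) \<in> rset x \<Longrightarrow> P (bconj u (br s))"
  shows "P y"
proof -
  have main: "P (bconj u z)" if "pos z" "u \<in> rset x" "P u" "bconj u z \<in> rset x" for u z
    using that
  proof (induction "nat (blen z)" arbitrary: u z rule: less_induct)
    case less
    show ?case
    proof (cases "z = bone")
      case True
      then show ?thesis using less.prems by (simp add: bconj_bone)
    next
      case False
      let ?s = "br (hsim z)" let ?z = "binv ?s \<cdot> z"
      have sz: "?s \<preccurlyeq> z" using less.prems(1) by (rule br_hsim_prefix)
      have d: "br t \<preccurlyeq> delta" for t using br_prefix_br[of t DL] by (simp add: sle_simps br_simps)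
      have u: "finf u = 0" "rigid u" "conjugate u x" "length (nfs u) = length (nfs x)"
        using less.prems x by (auto simp: rset_def)
      have ru: "rset u = rset x" using rset_trans[of x u] u x by simp
      \<comment> \<open>The head is the meet of \<open>z\<close> and \<delta>, and conjugation by
        \<delta> stays in the set; so convexity applies to the first factor of
        \<open>z\<close>.\<close>
      have glb: "is_glb ?s z delta"
        using sz d hsim_glb[OF less.prems(1)] by (auto simp: is_glb_def)
      have "bconj u delta \<in> rset u" using bconj_dpow_rset[of u u 1] u ru less.prems by (simp add: dpow_1)
      then have r1: "bconj u ?s \<in> rset x"
        using rset_convex[of u z delta ?s] u glb less.prems ru by simp
      have z': "bconj (bconj u ?s) ?z = bconj u z" by (simp add: bconj_bconj gsimps)
      have "hsim z \<noteq> E0"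
      proof
        assume "hsim z = E0"
        then have h: "\<not> 1 \<le> finf z" "hdE (nfs z) = E0" by (auto simp: hsim_def split: if_splits)
        then have "nfs z = []" using nfs_proper(1)[of z] by (cases "nfs z") (auto simp: hdE_def proper_def)
        moreover have "finf z = 0" using h less.prems(1) by simp
        ultimately show False using False nf_decomp[of z] by (simp add: dpow_0 bprod_simps gsimps)
      qed
      then have "0 < slen (hsim z)" using unary_tables(21)[of "hsim z"] by simp
      moreover have pz: "pos ?z" using sz by (simp add: prefix_pos)
      ultimately have "nat (blen ?z) < nat (blen z)"
        using blen_nonneg[OF pz] by (simp add: blen_mult blen_binv blen_br)
      then show ?thesis
        using less.hyps[OF _ pz r1 step[OF less.prems(2,3) r1]] z' less.prems(4) by simp
    qed
  qed
  obtain z where z: "y = bconj x z" using y by (auto simp: rset_def conjugate_def)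
  \<comment> \<open>A multiple of 4 makes this power of \<delta> central: the conjugator becomes
    positive and the conjugate does not change.\<close>
  let ?k = "4 * \<bar>finf z\<bar>"
  have p: "pos (z \<cdot> dpow ?k)" by (simp add: nf_mult_dpow)
  have "bconj x (z \<cdot> dpow ?k) = y"
  proof -
    have "bconj y (dpow ?k) = y"
      using dpow_central[of ?k y] by (simp add: bconj_def gsimps binv_dpow dpow_cancel dpow_0)
    then show ?thesis by (simp add: z bconj_bconj)
  qed
  moreover have "x \<in> rset x" using x by (auto simp: rset_def conjugate_def intro: bconj_bone[symmetric])
  ultimately show ?thesis using main[OF p _ base] y by simp
qed

section \<open>Cyclic words and ladders\<close>

text \<open>A periodic function on all natural numbers needs no separate treatment of the seam, and
  rotations become index shifts.\<close>

definition cword :: "nat \<Rightarrow> (nat \<Rightarrow> sim) \<Rightarrow> bool" where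
  "cword R a \<longleftrightarrow> 0 < R \<and> (\<forall>i. a (i + R) = a i) \<and> (\<forall>i. proper (a i)) \<and> (\<forall>i. lw (a i) (a (Suc i)))"

definition bw :: "nat \<Rightarrow> (nat \<Rightarrow> sim) \<Rightarrow> braid" where
  "bw n a = bprod (map (\<lambda>i. br (a i)) [0..<n])"

lemma periodic_mult: "(\<forall>i. a (i + R) = a i) \<Longrightarrow> a (i + n * R) = a i" for a :: "nat \<Rightarrow> 'a"
proof (induction n)
  case (Suc n)
  then have "a (i + Suc n * R) = a (i + n * R)" by (metis add.assoc add.commute mult_Suc)
  then show ?case using Suc by simp
qed simp

lemma periodic_mod: "(\<forall>i. a (i + R) = a i) \<Longrightarrow> a (i mod R) = a i" for a :: "nat \<Rightarrow> 'a"
  by (metis mod_div_mult_eq periodic_mult)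

lemma bw_0: "bw 0 a = bone"
  by (simp add: bw_def bprod_simps)

lemma bw_snoc: "bw (Suc n) a = bw n a \<cdot> br (a n)"
  by (simp add: bw_def bprod_append bprod_simps gsimps)

lemma bw_add: "bw (m + n) a = bw m a \<cdot> bw n (\<lambda>i. a (m + i))"
proof (induction n)
  case (Suc n)
  then show ?case using bw_snoc[of "m + n" a] bw_snoc[of n "\<lambda>i. a (m + i)"] by (simp add: gsimps)
qed (simp add: bw_0 gsimps)

lemma nf_bw:
  assumes "cword R a"
  shows "nf (bw R a) = (0, map a [0..<R])" "rigid (bw R a)"
proof -
  have R: "0 < R" and per: "\<And>i. a (i + R) = a i" and pr: "\<And>i. proper (a i)" and l: "\<And>i. lw (a i) (a (Suc i))"
    using assms by (auto simp: cword_def)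
  show n: "nf (bw R a) = (0, map a [0..<R])"
  proof (rule nf_eqI)
    show "bw R a = dpow 0 \<cdot> bprod (map br (map a [0..<R]))" by (simp add: bw_def dpow_0 gsimps comp_def)
    show "list_all proper (map a [0..<R])" using pr by (simp add: list_all_iff)
    show "successively lw (map a [0..<R])" using l by (simp add: successively_conv_nth)
  qed
  obtain k where k: "R = Suc k" using R by (cases R) auto
  have "lw (a k) (a 0)" using l[of k] per[of 0] k by simp
  moreover have "last (map a [0..<R]) = a k" by (simp add: k)
  moreover have "hd (map a [0..<R]) = a 0" "map a [0..<R] \<noteq> []" using R by (simp_all add: hd_map)
  ultimately show "rigid (bw R a)"
    unfolding rigid_nf n by (simp only: fst_conv snd_conv minus_zero taup_0 simp_thms)
qed

lemma bw_inj: "cword R a \<Longrightarrow> cword R b \<Longrightarrow> bw R a = bw R b \<Longrightarrow> a = b"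
proof
  fix i assume H: "cword R a" "cword R b" "bw R a = bw R b"
  then have "map a [0..<R] = map b [0..<R]" using nf_bw(1) by (metis snd_conv)
  then have "a (i mod R) = b (i mod R)" using H(1) by (auto simp: cword_def)
  then show "a i = b i" using H periodic_mod[of a R i] periodic_mod[of b R i] by (simp add: cword_def)
qed

lemma rset_cword:
  assumes "finf x = 0" "y \<in> rset x"
  obtains a where "cword (length (nfs x)) a" "y = bw (length (nfs x)) a"
proof -
  let ?R = "length (nfs x)"
  have y: "finf y = 0" "length (nfs y) = ?R" "rigid y" using assms by (auto simp: rset_def)
  then have ne: "nfs y \<noteq> []" and R: "0 < ?R" and l: "lw (last (nfs y)) (hd (nfs y))"
    by (auto simp: rigid_nf taup_0)
  define a where "a i = nfs y ! (i mod ?R)" for i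
  have "lw (a i) (a (Suc i))" for i
  proof (cases "Suc (i mod ?R) = ?R")
    case True
    then have "Suc i mod ?R = 0" by (metis mod_Suc)
    moreover have "i mod ?R = ?R - 1" using True by simp
    ultimately show ?thesis using l ne y(2) by (simp add: a_def last_conv_nth hd_conv_nth)
  next
    case False
    then have "Suc i mod ?R = Suc (i mod ?R)" by (simp add: mod_Suc)
    moreover have "Suc (i mod ?R) < ?R" using False R by (metis Suc_lessI mod_less_divisor)
    ultimately show ?thesis using nfs_proper(2)[of y] y(2) by (simp add: a_def successively_conv_nth)
  qed
  moreover have "proper (a i)" for i
    using nfs_proper(1)[of y] y(2) R by (auto simp: a_def list_all_length)
  ultimately have "cword ?R a" using R by (auto simp: cword_def a_def)
  moreover have "map br (nfs y) = map (\<lambda>i. br (a i)) [0..<?R]"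
    using y(2) by (intro nth_equalityI) (auto simp: a_def)
  then have "y = bw ?R a"
    using nf_decomp[of y] y(1) by (simp add: bw_def dpow_0 gsimps)
  ultimately show thesis using that by blast
qed

lemma cword_shift: "cword R a \<Longrightarrow> cword R (\<lambda>i. a (i + n))"
  by (simp add: cword_def) (metis add.assoc add.commute add_Suc)

lemma bw_shift:
  assumes "cword R a"
  shows "bconj (bw R a) (bw n a) = bw R (\<lambda>i. a (i + n))"
proof -
  have "bw n (\<lambda>i. a (R + i)) = bw n a" using assms by (simp add: cword_def add.commute)
  then have "bw R a \<cdot> bw n a = bw n a \<cdot> bw R (\<lambda>i. a (n + i))"
    using bw_add[of R n a] bw_add[of n R a] by (simp add: add.commute)
  then show ?thesis by (simp add: bconj_def gsimps add.commute)
qed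

text \<open>The first component of \<open>snorm\<close> is the head of the product and the second
  one the rest, so equality of such products is decided by the tables.\<close>

lemma snorm_tile: "br a \<cdot> br t = br s \<cdot> br b \<longleftrightarrow> snorm a t = snorm s b"
proof -
  have split: "br a \<cdot> br t = br (fst (snorm a t)) \<cdot> br (snd (snorm a t))" for a t
    using bprod_ins[of a "[t]"] by (cases "a = E0") (auto simp: bprod_simps gsimps br_simps snorm_E0 split: if_splits)
  have h: "hsim (br a \<cdot> br t) = fst (snorm a t)" for a t
    using hsim_br_mult[OF pos_br] by (simp add: hsim_br)
  show ?thesis
  proof
    assume e: "br a \<cdot> br t = br s \<cdot> br b"
    then have "fst (snorm a t) = fst (snorm s b)" using h by metis
    moreover from this e have "br (snd (snorm a t)) = br (snd (snorm s b))"
      using split[of a t] split[of s b] by (simp add: bmult_left_cancel)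
    ultimately show "snorm a t = snorm s b" by (simp add: br_inj prod_eq_iff)
  next
    assume "snorm a t = snorm s b"
    then show "br a \<cdot> br t = br s \<cdot> br b" using split[of a t] split[of s b] by simp
  qed
qed

text \<open>The picture of a conjugation: \<open>a\<close> and \<open>b\<close> are the rails and
  \<open>\<sigma>\<close> the rungs. Each square commutes, and the ladder closes up after
  \<open>R\<close> squares.\<close>

definition ladder :: "nat \<Rightarrow> (nat \<Rightarrow> sim) \<Rightarrow> (nat \<Rightarrow> sim) \<Rightarrow> (nat \<Rightarrow> sim) \<Rightarrow> bool" where
  "ladder R a \<sigma> b \<longleftrightarrow> (\<forall>i. \<sigma> (i + R) = \<sigma> i) \<and> (\<forall>i. proper (\<sigma> i)) \<and> (\<forall>i. snorm (a i) (\<sigma> (Suc i)) = snorm (\<sigma> i) (b i))"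

lemma bconj_eq: "bconj y z = w \<longleftrightarrow> y \<cdot> z = z \<cdot> w"
  by (metis bconj_def binv_left_assoc binv_right_assoc bmult_assoc)

text \<open>\<open>a 0\<close> divides the product of \<open>s\<close> with the conjugated word,
  which depends only on heads, so it divides s b_0 and the quotient is positive. Conversely s b_0
  \<delta>^-1 divides both the word and \<delta>, hence the head \<open>a 0\<close>; so the quotient
  divides \<delta>.\<close>

lemma ladder_step:
  assumes "cword R a" "cword R b" "bconj (bw R a) (br s) = bw R b"
  shows "\<exists>t. br (a 0) \<cdot> br t = br s \<cdot> br (b 0)"
proof -
  let ?y = "bw R a" and ?y' = "bw R b"
  have h: "hsim ?y = a 0" "hsim ?y' = b 0" "pos ?y" "pos ?y'"
    using nf_bw(1)[OF assms(1)] nf_bw(1)[OF assms(2)] assms(1)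
    by (auto simp: hsim_def hdE_def cword_def upt_conv_Cons split: list.splits)
  have ys: "?y \<cdot> br s = br s \<cdot> ?y'" using assms(3) by (simp add: bconj_eq)
  let ?t = "binv (br (a 0)) \<cdot> (br s \<cdot> br (b 0))"
  have d: "br u \<preccurlyeq> delta" for u using br_prefix_br[of u DL] by (simp add: sle_simps br_simps)
  have "br (a 0) \<preccurlyeq> ?y" using br_hsim_prefix[OF h(3)] h by simp
  then have "br (a 0) \<preccurlyeq> br s \<cdot> ?y'" using ys prefix_mult_pos[OF pos_br, of ?y s] prefix_trans by metis
  then have "sle (a 0) (hsim (br s \<cdot> ?y'))" using br_prefix[OF pos_mult[OF pos_br h(4)]] by blast
  then have "sle (a 0) (fst (snorm s (b 0)))" using hsim_br_mult[OF h(4)] h by simp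
  then have "sle (a 0) (hsim (br s \<cdot> br (b 0)))" using hsim_br_mult[OF pos_br] by (simp add: hsim_br)
  then have "br (a 0) \<preccurlyeq> br s \<cdot> br (b 0)" using br_prefix[OF pos_mult[OF pos_br pos_br]] by blast
  then have p: "bone \<preccurlyeq> ?t" by (simp add: prefix_pos gsimps)
  have "br s \<cdot> br (b 0) \<preccurlyeq> br s \<cdot> ?y'" using br_hsim_prefix[OF h(4)] h by (simp add: prefix_left)
  also have "br s \<cdot> ?y' = ?y \<cdot> br s" using ys by simp
  finally have 1: "br s \<cdot> br (b 0) \<preccurlyeq> ?y \<cdot> dpow 1"
    using d[of s] prefix_trans prefix_left dpow_1 by metis
  have "br s \<cdot> br (b 0) \<preccurlyeq> br s \<cdot> dpow 1" using d by (simp add: prefix_left dpow_1)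
  moreover have "br s \<cdot> dpow 1 \<preccurlyeq> dpow 1 \<cdot> dpow 1" unfolding prefix_dpow using d by (simp add: dpow_1)
  ultimately have 2: "br s \<cdot> br (b 0) \<preccurlyeq> delta \<cdot> dpow 1" using prefix_trans dpow_1 by metis
  have "br s \<cdot> br (b 0) \<cdot> dpow (- 1) \<preccurlyeq> br (hsim ?y)"
    using 1 2 by (intro hsim_glb[OF h(3)]) (simp_all add: prefix_dpow_left)
  then have "br s \<cdot> br (b 0) \<preccurlyeq> br (a 0) \<cdot> delta" using h by (simp add: prefix_dpow_left dpow_1)
  then have "?t \<preccurlyeq> delta" by (simp add: prefix_pos gsimps)
  with p have "simple ?t" by (simp add: simple_def)
  then obtain t where "?t = br t" using pos_simple by blast
  then have "br (a 0) \<cdot> br t = br s \<cdot> br (b 0)" by (metis binv_right_assoc)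
  then show ?thesis by blast
qed

text \<open>The rungs are the conjugators between the rotated words, so each is simple by
  \<open>ladder_step\<close>.\<close>

lemma ladder_exists:
  assumes a: "cword R a" and b: "cword R b" and s: "proper s" and ab: "bconj (bw R a) (br s) = bw R b"
  obtains \<sigma> where "\<sigma> 0 = s" "ladder R a \<sigma> b"
proof -
  define g where "g n = binv (bw n a) \<cdot> (br s \<cdot> bw n b)" for n
  have gconj: "bconj (bw R (\<lambda>i. a (i + n))) (g n) = bw R (\<lambda>i. b (i + n))" for n
  proof -
    have "bw n a \<cdot> g n = br s \<cdot> bw n b" by (simp add: g_def gsimps)
    then show ?thesis
      using bw_shift[OF a, of n] bw_shift[OF b, of n] ab by (metis bconj_bconj)
  qed
  have gS: "br (a n) \<cdot> g (Suc n) = g n \<cdot> br (b n)" for n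
    by (simp add: g_def bw_snoc gsimps)
  have "\<exists>t. g n = br t" for n
  proof (induction n)
    case 0
    show ?case by (auto simp: g_def bw_0 gsimps)
  next
    case (Suc n)
    then obtain t where t: "g n = br t" by blast
    then obtain u where "br (a n) \<cdot> br u = br t \<cdot> br (b n)"
      using ladder_step[OF cword_shift[OF a, of n] cword_shift[OF b, of n], of t] gconj[of n] by auto
    then have "g (Suc n) = br u" using gS[of n] t by (metis bmult_left_cancel)
    then show ?case by blast
  qed
  then obtain \<sigma> where \<sigma>: "\<And>n. g n = br (\<sigma> n)" by metis
  have s0: "\<sigma> 0 = s" using \<sigma>[of 0] by (simp add: g_def bw_0 gsimps br_inj)
  have tile: "br (a n) \<cdot> br (\<sigma> (Suc n)) = br (\<sigma> n) \<cdot> br (b n)" for n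
    using gS[of n] by (simp add: \<sigma>)
  have gR: "g (n + R) = g n" for n
  proof -
    have "bw (R + n) a = bw R a \<cdot> bw n a" "bw (R + n) b = bw R b \<cdot> bw n b"
      using a b by (simp_all add: bw_add cword_def add.commute)
    moreover have "bw R a \<cdot> br s = br s \<cdot> bw R b" using ab by (simp add: bconj_eq)
    then have "binv (bw R a) \<cdot> (br s \<cdot> bw R b) = br s" by (metis binv_left_assoc)
    ultimately show ?thesis by (simp add: g_def add.commute gsimps) (metis bmult_assoc)
  qed
  have per: "\<sigma> (n + R) = \<sigma> n" for n using gR[of n] by (simp add: \<sigma> br_inj)
  have R: "0 < R" using a by (simp add: cword_def)
  have wrap: "\<sigma> (n * R) = s" for n using periodic_mult[of \<sigma> R 0 n] per s0 by simp
  \<comment> \<open>After a rung 1 or \<delta> the second word is the first one or its image under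
    \<tau> from there on, so the rung repeats forever. By periodicity this contradicts that
    \<open>s\<close> is proper.\<close>
  have stay: "\<sigma> j = u" if u: "u = E0 \<and> v = id \<or> u = DL \<and> v = stau" and n: "\<sigma> n = u" and j: "n \<le> j" for u v n j
  proof -
    have "cword R (\<lambda>i. v (a (i + n)))"
      using cword_shift[OF a, of n] u by (auto simp: cword_def proper_def unary_tables lw_stau)
    moreover have "bconj (bw R (\<lambda>i. a (i + n))) (br u) = bw R (\<lambda>i. v (a (i + n)))"
    proof (cases "u = E0")
      case True
      then show ?thesis using u by (simp add: br_simps bconj_bone)
    next
      case False
      have "bw m c \<cdot> delta = delta \<cdot> bw m (\<lambda>i. stau (c i))" for m c
      proof (induction m)
        case (Suc m)
        have "bw (Suc m) c \<cdot> delta = bw m c \<cdot> (br (c m) \<cdot> delta)" by (simp add: bw_snoc gsimps)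
        also have "\<dots> = (bw m c \<cdot> delta) \<cdot> br (stau (c m))" by (simp add: br_delta gsimps)
        finally show ?case using Suc by (simp add: bw_snoc gsimps)
      qed (simp add: bw_0 gsimps)
      then show ?thesis using False u by (simp add: br_simps bconj_def gsimps)
    qed
    ultimately have "(\<lambda>i. v (a (i + n))) = (\<lambda>i. b (i + n))"
      using gconj[of n] n cword_shift[OF b, of n] by (intro bw_inj[of R]) (simp_all add: \<sigma>)
    then have bv: "b (i + n) = v (a (i + n))" for i by metis
    show ?thesis using j
    proof (induction j rule: dec_induct)
      case base
      show ?case by (rule n)
    next
      case (step j)
      have "br (a j) \<cdot> br (\<sigma> (Suc j)) = br u \<cdot> br (v (a j))"
        using tile[of j] step bv[of "j - n"] by simp
      then have "br (a j) \<cdot> br (\<sigma> (Suc j)) = br (a j) \<cdot> br u"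
        using u by (auto simp: br_simps gsimps br_delta)
      then show ?case by (simp add: bmult_left_cancel br_inj)
    qed
  qed
  have "proper (\<sigma> n)" for n
  proof (rule ccontr)
    assume "\<not> proper (\<sigma> n)"
    then have "\<sigma> n = E0 \<or> \<sigma> n = DL" by (auto simp: proper_def)
    moreover have "n \<le> n * R" using R by simp
    ultimately have "\<sigma> (n * R) = E0 \<or> \<sigma> (n * R) = DL" using stay[of E0 id n "n * R"] stay[of DL stau n "n * R"] by auto
    then show False using wrap s by (auto simp: proper_def)
  qed
  then have "ladder R a \<sigma> b" using per tile by (simp add: ladder_def snorm_tile)
  then show thesis using that s0 by blast
qed

text \<open>Left-weightedness of both words makes this rank nondecreasing from square to square.
  Rank 1 collects cycling (\<open>y = s\<close>), decycling (\<open>y\<close> and the next rung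
  multiply to \<delta>) and changes of length; in ranks 2 and 0 lengths are kept and
  \<open>y\<close> has length one, respectively two when it is proper.\<close>

definition tile_rank :: "sim \<Rightarrow> sim \<Rightarrow> sim \<Rightarrow> sim \<Rightarrow> nat" where
  "tile_rank y s s' y' =
     (if y = s \<or> snorm y s' = (DL, E0) \<or> slen y \<noteq> slen y' \<or> slen s \<noteq> slen s' then 1
      else if slen y = 1 then 2 else 0)"

definition props :: "sim list" where
  "props = [A12, A13, A14, A23, A24, A34, T123, T124, T134, T234, P12, P14]"

lemma proper_props: "proper s \<longleftrightarrow> s \<in> set props"
  by (cases s) (simp_all add: proper_def props_def)

definition sim_pairs :: "((sim \<times> sim) \<times> (sim \<times> sim)) list" where
  "sim_pairs = concat (map (\<lambda>s. map (\<lambda>t. ((s, t), snorm s t)) props) props)"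

text \<open>Squares are found by matching products with equal normal form, and later compared only
  if they share a rung; this keeps the evaluation small.\<close>

definition match_pairs :: "((sim \<times> sim) \<times> (sim \<times> sim)) list \<Rightarrow> (sim \<times> sim \<times> sim \<times> sim) list" where
  "match_pairs ps = concat (map (\<lambda>((y, s'), n). map (\<lambda>((s, y'), m). (y, s, s', y')) (filter (\<lambda>(q, m). m = n) ps)) ps)"

lemma in_match_pairs:
  assumes "proper y" "proper s" "proper s'" "proper y'" "snorm y s' = snorm s y'"
  shows "(y, s, s', y') \<in> set (match_pairs sim_pairs)"
proof -
  have "((y, s'), snorm y s') \<in> set sim_pairs" "((s, y'), snorm s y') \<in> set sim_pairs"
    using assms(1-4) by (auto simp: proper_props sim_pairs_def)
  moreover from this(2) have "(y, s, s', y') \<in> set (map (\<lambda>((s, y'), m). (y, s, s', y'))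
      (filter (\<lambda>(q, m). m = snorm y s') sim_pairs))"
    unfolding set_map set_filter using assms(5) by (intro image_eqI[of _ _ "((s, y'), snorm s y')"]) auto
  ultimately show ?thesis
    unfolding match_pairs_def set_concat set_map image_image
    by (intro UN_I[of "((y, s'), snorm y s')"]) simp_all
qed

definition tile_pairs_ok :: "(sim \<times> sim \<times> sim \<times> sim) list \<Rightarrow> (sim \<times> sim \<times> sim \<times> sim) list \<Rightarrow> bool" where
  "tile_pairs_ok ts us \<longleftrightarrow> list_all (\<lambda>(y, s, s', y'). list_all (\<lambda>(z, t, t', z').
     if lw y z then if lw y' z' then
       tile_rank y s s' y' \<le> tile_rank z t t' z' \<and>
       (tile_rank y s s' y' = 1 \<longrightarrow> tile_rank z t t' z' = 1 \<longrightarrow>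
          (if y = s then z = t else z \<noteq> t \<and> snorm y s' = (DL, E0) \<and> snorm z t' = (DL, E0)))
     else True else True) us) ts"

definition tiles_ok :: "(sim \<times> sim \<times> sim \<times> sim) list \<Rightarrow> bool" where
  "tiles_ok ts \<longleftrightarrow> list_all (\<lambda>r. tile_pairs_ok (filter (\<lambda>(y, s, s', y'). s' = r) ts)
     (filter (\<lambda>(y, s, s', y'). s = r) ts)) props"

lemma tiles_ok: "tiles_ok (match_pairs sim_pairs)"
  by code_simp

lemma tile_rank_step:
  assumes "proper y" "proper s" "proper r" "proper y'" "snorm y r = snorm s y'"
    and "proper z" "proper t'" "proper z'" "snorm z t' = snorm r z'" "lw y z" "lw y' z'"
  shows "tile_rank y s r y' \<le> tile_rank z r t' z'"
    and "tile_rank y s r y' = 1 \<Longrightarrow> tile_rank z r t' z' = 1 \<Longrightarrow>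
          if y = s then z = r else z \<noteq> r \<and> snorm y r = (DL, E0) \<and> snorm z t' = (DL, E0)"
proof -
  have 1: "(y, s, r, y') \<in> set (match_pairs sim_pairs)" "(z, r, t', z') \<in> set (match_pairs sim_pairs)"
    using assms in_match_pairs by blast+
  have "r \<in> set props" using assms(3) proper_props by blast
  then have "tile_pairs_ok (filter (\<lambda>(y, s, s', y'). s' = r) (match_pairs sim_pairs))
     (filter (\<lambda>(y, s, s', y'). s = r) (match_pairs sim_pairs))"
    using tiles_ok by (simp add: tiles_ok_def list_all_iff)
  then have "tile_rank y s r y' \<le> tile_rank z r t' z' \<and>
       (tile_rank y s r y' = 1 \<longrightarrow> tile_rank z r t' z' = 1 \<longrightarrow>
          (if y = s then z = r else z \<noteq> r \<and> snorm y r = (DL, E0) \<and> snorm z t' = (DL, E0)))"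
    unfolding tile_pairs_ok_def list_all_iff using 1 assms(10,11) by fastforce
  then show "tile_rank y s r y' \<le> tile_rank z r t' z'"
    "tile_rank y s r y' = 1 \<Longrightarrow> tile_rank z r t' z' = 1 \<Longrightarrow>
          if y = s then z = r else z \<noteq> r \<and> snorm y r = (DL, E0) \<and> snorm z t' = (DL, E0)" by blast+
qed

text \<open>One turn leads back to the initial value, so no step can be strict. This is the passage
  from local rules to whole rows.\<close>

lemma periodic_mono_const:
  fixes f :: "nat \<Rightarrow> 'a :: order"
  assumes "\<And>i. f i \<le> f (Suc i)" "\<And>i. f (i + R) = f i" "0 < R"
  shows "f i = f j"
proof -
  have "f i = f (Suc i)" for i
  proof (rule antisym)
    have "f (Suc i) \<le> f (i + R)"
      using assms(3) by (intro lift_Suc_mono_le[of f, OF assms(1)]) simp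
    then show "f (Suc i) \<le> f i" by (simp add: assms(2))
  qed (rule assms(1))
  then have "f i = f 0" for i by (induction i) auto
  then show ?thesis by metis
qed

text \<open>The rank is constant around the ladder. In rank 1 neighbouring squares are either both
  of cycling type or both of decycling type, which leaves no room for other changes of
  length.\<close>

lemma ladder_cases:
  assumes a: "cword R a" and b: "cword R b" and l: "ladder R a \<sigma> b"
  obtains (cycling) "\<And>i. b i = a (Suc i)" | (decycling) "\<And>i. b (Suc i) = stau (a i)"
    | (atoms) "\<And>i. slen (a i) = 1 \<and> slen (b i) = 1 \<and> a i \<noteq> \<sigma> i \<and> slen (\<sigma> (Suc i)) = slen (\<sigma> i)"
    | (coatoms) "\<And>i. slen (a i) = 2"
proof -
  have R: "0 < R" using a by (simp add: cword_def)
  have pa: "proper (a i)" "proper (b i)" "lw (a i) (a (Suc i))" "lw (b i) (b (Suc i))"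
    and per: "a (i + R) = a i" "b (i + R) = b i" for i
    using a b by (auto simp: cword_def)
  have ps: "proper (\<sigma> i)" "\<sigma> (i + R) = \<sigma> i" and t: "snorm (a i) (\<sigma> (Suc i)) = snorm (\<sigma> i) (b i)" for i
    using l by (auto simp: ladder_def)
  define rk where "rk i = tile_rank (a i) (\<sigma> i) (\<sigma> (Suc i)) (b i)" for i
  note step = tile_rank_step[OF pa(1) ps(1) ps(1) pa(2) t pa(1) ps(1) pa(2) t pa(3) pa(4)]
  have rk: "rk i = rk 0" for i
  proof (rule periodic_mono_const[where f = rk, OF _ _ R])
    show "rk i \<le> rk (Suc i)" for i unfolding rk_def by (rule step(1))
    show "rk (i + R) = rk i" for i
      using per ps(2)[of i] ps(2)[of "Suc i"] by (simp add: rk_def)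
  qed
  have slen_a: "slen (a i) = 1 \<or> slen (a i) = 2" for i
    using pa(1)[of i] by (cases "a i") (simp_all add: proper_def slen_def)
  have "rk 0 = 0 \<or> rk 0 = 1 \<or> rk 0 = 2" unfolding rk_def tile_rank_def by simp
  then show thesis
  proof (elim disjE)
    assume 1: "rk 0 = 0"
    have "slen (a i) = 2" for i
      using rk[of i] 1 slen_a[of i] unfolding rk_def tile_rank_def by (auto split: if_splits)
    then show thesis by (rule coatoms)
  next
    assume 3: "rk 0 = 2"
    have "slen (a i) = 1 \<and> slen (b i) = 1 \<and> a i \<noteq> \<sigma> i \<and> slen (\<sigma> (Suc i)) = slen (\<sigma> i)" for i
      using rk[of i] 3 slen_a[of i] unfolding rk_def tile_rank_def by (auto split: if_splits)
    then show thesis by (rule atoms)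
  next
    assume 2: "rk 0 = 1"
    define dec where "dec i \<longleftrightarrow> snorm (a i) (\<sigma> (Suc i)) = (DL, E0)" for i
    have st: "if a i = \<sigma> i then a (Suc i) = \<sigma> (Suc i) else a (Suc i) \<noteq> \<sigma> (Suc i) \<and> dec i \<and> dec (Suc i)" for i
      using step(2)[of i] rk[of i] rk[of "Suc i"] 2 unfolding rk_def dec_def by auto
    show thesis
    proof (cases "\<forall>i. a i = \<sigma> i")
      case True
      have "b i = a (Suc i)" for i
      proof -
        have "br (a i) \<cdot> br (a (Suc i)) = br (a i) \<cdot> br (b i)"
          using t[of i] True by (simp add: snorm_tile)
        then show ?thesis by (simp add: bmult_left_cancel br_inj)
      qed
      then show thesis by (rule cycling)
    next
      case False
      then obtain k where "a k \<noteq> \<sigma> k" by blast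
      then have nk: "a (k + j) \<noteq> \<sigma> (k + j)" for j
      proof (induction j)
        case (Suc j)
        then show ?case using st[of "k + j"] by simp
      qed simp
      have dec: "dec (k + j)" for j
        using nk[of j] st[of "k + j"] by simp
      have "dec i" for i
      proof -
        have "dec (k + (i + (k * R - k)))" by (rule dec)
        moreover have "k + (i + (k * R - k)) = i + k * R" using R by (cases R) auto
        ultimately have "dec (i + k * R)" by simp
        then show ?thesis
          using periodic_mult[of a R i k] periodic_mult[of \<sigma> R "Suc i" k] per ps by (simp add: dec_def)
      qed
      then have e: "br (a i) \<cdot> br (\<sigma> (Suc i)) = delta" "br (\<sigma> i) \<cdot> br (b i) = delta" for i
        using snorm_tile[of "a i" "\<sigma> (Suc i)" DL E0] snorm_tile[of "\<sigma> i" "b i" DL E0] t[of i]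
        by (simp_all add: dec_def br_simps gsimps snorm_def Let_def sdual_def smeet_def smul_def sdiv_def)
      have "b (Suc i) = stau (a i)" for i
      proof -
        have "\<sigma> (Suc i) = sdual (a i)" using e(1)[of i] br_sdual[of "a i"] by (metis bmult_left_cancel br_inj)
        moreover have "b (Suc i) = sdual (\<sigma> (Suc i))"
          using e(2)[of "Suc i"] br_sdual[of "\<sigma> (Suc i)"] by (metis bmult_left_cancel br_inj)
        ultimately show ?thesis by (simp add: unary_tables)
      qed
      then show thesis by (rule decycling)
    qed
  qed
qed

section \<open>Annuli\<close>

text \<open>\<open>tl2 y s = Some (s', y')\<close> means that \<open>y s' = s y'\<close> is the least common multiple of the atoms \<open>y\<close> and \<open>s\<close>,
  provided it has length two.\<close>

definition tl2 :: "sim \<Rightarrow> sim \<Rightarrow> (sim \<times> sim) option" where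
  "tl2 y s = (case y of A12 \<Rightarrow> (case s of A13 \<Rightarrow> Some (A23, A12) | A14 \<Rightarrow> Some (A24, A12) | A23 \<Rightarrow> Some (A23, A13) | A24 \<Rightarrow> Some (A24, A14) | A34 \<Rightarrow> Some (A34, A12) | _ \<Rightarrow> None)
     | A13 \<Rightarrow> (case s of A12 \<Rightarrow> Some (A12, A23) | A14 \<Rightarrow> Some (A34, A13) | A23 \<Rightarrow> Some (A12, A13) | A34 \<Rightarrow> Some (A34, A14) | _ \<Rightarrow> None)
     | A14 \<Rightarrow> (case s of A12 \<Rightarrow> Some (A12, A24) | A13 \<Rightarrow> Some (A13, A34) | A23 \<Rightarrow> Some (A23, A14) | A24 \<Rightarrow> Some (A12, A14) | A34 \<Rightarrow> Some (A13, A14) | _ \<Rightarrow> None)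
     | A23 \<Rightarrow> (case s of A12 \<Rightarrow> Some (A13, A23) | A13 \<Rightarrow> Some (A13, A12) | A14 \<Rightarrow> Some (A14, A23) | A24 \<Rightarrow> Some (A34, A23) | A34 \<Rightarrow> Some (A34, A24) | _ \<Rightarrow> None)
     | A24 \<Rightarrow> (case s of A12 \<Rightarrow> Some (A14, A24) | A14 \<Rightarrow> Some (A14, A12) | A23 \<Rightarrow> Some (A23, A34) | A34 \<Rightarrow> Some (A23, A24) | _ \<Rightarrow> None)
     | A34 \<Rightarrow> (case s of A12 \<Rightarrow> Some (A12, A34) | A13 \<Rightarrow> Some (A14, A34) | A14 \<Rightarrow> Some (A14, A13) | A23 \<Rightarrow> Some (A24, A34) | A24 \<Rightarrow> Some (A24, A23) | _ \<Rightarrow> None)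
     | _ \<Rightarrow> None)"

definition ats :: "sim list" where
  "ats = [A12, A13, A14, A23, A24, A34]"

lemma slen_1: "slen s = 1 \<longleftrightarrow> s \<in> set ats"
  by (cases s) (simp_all add: slen_def ats_def)

text \<open>The atoms joining neighbouring points of the circle form one orbit of \<tau>; the
  diagonals \<open>A13\<close> and \<open>A24\<close> form the other.\<close>

definition side :: "sim \<Rightarrow> bool" where
  "side s \<longleftrightarrow> s = A12 \<or> s = A14 \<or> s = A23 \<or> s = A34"

definition nx :: "sim \<Rightarrow> sim list" where
  "nx y = filter (lw y) ats"

lemma in_nx: "slen s = 1 \<Longrightarrow> lw y s \<Longrightarrow> s \<in> set (nx y)"
  by (simp add: nx_def slen_1[symmetric])

text \<open>Squares along the word \<open>Y\<close> that close up to a conjugation of \<open>Y\<close> into \<open>Y'\<close> by the atom \<open>b 0\<close>.\<close>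

definition strip :: "nat \<Rightarrow> (nat \<Rightarrow> sim) \<Rightarrow> (nat \<Rightarrow> sim) \<Rightarrow> (nat \<Rightarrow> sim) \<Rightarrow> bool" where
  "strip R Y b Y' \<longleftrightarrow> (\<forall>i. tl2 (Y i) (b i) = Some (b (Suc i), Y' i)) \<and> (\<forall>i. b (i + R) = b i)"

definition aword :: "nat \<Rightarrow> (nat \<Rightarrow> sim) \<Rightarrow> bool" where
  "aword R Y \<longleftrightarrow> 0 < R \<and> (\<forall>i. Y (i + R) = Y i) \<and> (\<forall>i. slen (Y i) = 1) \<and> (\<forall>i. lw (Y i) (Y (Suc i)))"

text \<open>Left-weightedness of consecutive vertical edges in each column excludes backtracking: a
  strip followed by its reverse violates it.\<close>

definition annulus :: "nat \<Rightarrow> nat \<Rightarrow> (nat \<Rightarrow> nat \<Rightarrow> sim) \<Rightarrow> (nat \<Rightarrow> nat \<Rightarrow> sim) \<Rightarrow> bool" where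
  "annulus R k a b \<longleftrightarrow> (\<forall>j\<le>k. aword R (a j)) \<and> (\<forall>j<k. strip R (a j) (b j) (a (Suc j)))
     \<and> (\<forall>j i. Suc j < k \<longrightarrow> lw (b j i) (b (Suc j) i))"

text \<open>In both cases the braid spelled by the word preserves an essential curve.\<close>

definition red :: "nat \<Rightarrow> (nat \<Rightarrow> sim) \<Rightarrow> bool" where
  "red R Y \<longleftrightarrow> (\<exists>s. strip R Y s Y) \<or> (\<exists>s. \<forall>i. \<exists>y'. tl2 (Y i) s = Some (s, y'))"

text \<open>An orientation of pairs of atoms: the product is simple in this order only. Commuting
  atoms, equal atoms and the two crossing diagonals are unrelated.\<close>

definition sgh :: "sim \<Rightarrow> sim \<Rightarrow> bool" where
  "sgh b c \<longleftrightarrow> sle c (sdual b) \<and> \<not> sle b (sdual c)"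

text \<open>For two sides of a square with simple product of length two, this is the atom that
  completes the product to \<delta>.\<close>

definition cc1 :: "sim \<Rightarrow> sim \<Rightarrow> sim" where
  "cc1 y b = sdual (smul y b)"

text \<open>Around an interior vertex of an annulus, the vertical edges \<open>p\<close>, \<open>q\<close> and the diagonals \<open>c\<close>, \<open>n\<close> are compared:
  \<open>x2c\<close> and \<open>x2r\<close> say that the vertical edge is unchanged resp. rotated, \<open>x3c\<close> and \<open>x3r\<close> say this of the diagonal up
  to \<open>\<tau>\<close>, and \<open>sh\<close>, \<open>sv\<close> record which of the two products of vertical edge and diagonal is simple.\<close>

type_synonym feat = "bool \<times> bool \<times> bool \<times> bool \<times> bool \<times> bool"

definition feat' :: "sim \<Rightarrow> sim \<Rightarrow> sim \<Rightarrow> sim \<Rightarrow> feat" where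
  "feat' c n p q = (q = p, side p \<and> q = stau p, n = stau c, side c \<and> n = c, sgh q c, sgh c q)"

definition feat :: "sim \<Rightarrow> sim \<Rightarrow> sim \<Rightarrow> sim \<Rightarrow> sim \<Rightarrow> feat" where
  "feat y p q z n = feat' (cc1 y p) (cc1 z n) p q"

definition x2c :: "feat \<Rightarrow> bool" where "x2c f = fst f"
definition x2r :: "feat \<Rightarrow> bool" where "x2r f = fst (snd f)"
definition x3c :: "feat \<Rightarrow> bool" where "x3c f = fst (snd (snd f))"
definition x3r :: "feat \<Rightarrow> bool" where "x3r f = fst (snd (snd (snd f)))"
definition sh :: "feat \<Rightarrow> bool" where "sh f = fst (snd (snd (snd (snd f))))"
definition sv :: "feat \<Rightarrow> bool" where "sv f = snd (snd (snd (snd (snd f))))"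
definition hv :: "feat \<Rightarrow> feat \<Rightarrow> bool" where "hv f g = (sh f \<and> sv g)"
definition vh :: "feat \<Rightarrow> feat \<Rightarrow> bool" where "vh f g = (sv f \<and> sh g)"
definition nb :: "feat \<Rightarrow> feat \<Rightarrow> bool" where "nb f g = (\<not> hv f g \<and> \<not> vh f g)"

text \<open>Equations on atoms that speed up the evaluation of the finite checks below.\<close>

lemma tl2_code [code]:
  "tl2 A12 A12 = None" "tl2 A12 A13 = Some (A23, A12)" "tl2 A12 A14 = Some (A24, A12)"
  "tl2 A12 A23 = Some (A23, A13)" "tl2 A12 A24 = Some (A24, A14)" "tl2 A12 A34 = Some (A34, A12)"
  "tl2 A13 A12 = Some (A12, A23)" "tl2 A13 A13 = None" "tl2 A13 A14 = Some (A34, A13)"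
  "tl2 A13 A23 = Some (A12, A13)" "tl2 A13 A24 = None" "tl2 A13 A34 = Some (A34, A14)"
  "tl2 A14 A12 = Some (A12, A24)" "tl2 A14 A13 = Some (A13, A34)" "tl2 A14 A14 = None"
  "tl2 A14 A23 = Some (A23, A14)" "tl2 A14 A24 = Some (A12, A14)" "tl2 A14 A34 = Some (A13, A14)"
  "tl2 A23 A12 = Some (A13, A23)" "tl2 A23 A13 = Some (A13, A12)" "tl2 A23 A14 = Some (A14, A23)"
  "tl2 A23 A23 = None" "tl2 A23 A24 = Some (A34, A23)" "tl2 A23 A34 = Some (A34, A24)"
  "tl2 A24 A12 = Some (A14, A24)" "tl2 A24 A13 = None" "tl2 A24 A14 = Some (A14, A12)"
  "tl2 A24 A23 = Some (A23, A34)" "tl2 A24 A24 = None" "tl2 A24 A34 = Some (A23, A24)"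
  "tl2 A34 A12 = Some (A12, A34)" "tl2 A34 A13 = Some (A14, A34)" "tl2 A34 A14 = Some (A14, A13)"
  "tl2 A34 A23 = Some (A24, A34)" "tl2 A34 A24 = Some (A24, A23)" "tl2 A34 A34 = None"
  by (simp_all add: tl2_def)

lemma nx_code [code]:
  "nx A12 = [A12, A13, A14]" "nx A13 = [A13, A14, A23, A24]"
  "nx A14 = [A14, A24, A34]" "nx A23 = [A12, A23, A24]"
  "nx A24 = [A12, A13, A24, A34]" "nx A34 = [A13, A23, A34]"
  by code_simp+

lemma cc1_code [code]:
  "cc1 A12 A23 = A34" "cc1 A12 A24 = A23" "cc1 A12 A34 = A24" "cc1 A13 A12 = A34"
  "cc1 A13 A34 = A12" "cc1 A14 A12 = A23" "cc1 A14 A13 = A12" "cc1 A14 A23 = A13"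
  "cc1 A23 A13 = A34" "cc1 A23 A14 = A13" "cc1 A23 A34 = A14" "cc1 A24 A14 = A23"
  "cc1 A24 A23 = A14" "cc1 A34 A12 = A24" "cc1 A34 A14 = A12" "cc1 A34 A24 = A14"
  by (simp_all add: cc1_def smul_def sdual_def)

lemma stau_code [code]:
  "stau A12 = A14" "stau A13 = A24" "stau A14 = A34" "stau A23 = A12" "stau A24 = A13" "stau A34 = A23"
  by (simp_all add: stau_def)

lemma side_code [code]:
  "side A12 = True" "side A13 = False" "side A14 = True" "side A23 = True" "side A24 = False" "side A34 = True"
  by (simp_all add: side_def)

lemma sgh_code [code]:
  "sgh A12 A12 = False" "sgh A12 A13 = False" "sgh A12 A14 = False" "sgh A12 A23 = True"
  "sgh A12 A24 = True" "sgh A12 A34 = False" "sgh A13 A12 = True" "sgh A13 A13 = False"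
  "sgh A13 A14 = False" "sgh A13 A23 = False" "sgh A13 A24 = False" "sgh A13 A34 = True"
  "sgh A14 A12 = True" "sgh A14 A13 = True" "sgh A14 A14 = False" "sgh A14 A23 = False"
  "sgh A14 A24 = False" "sgh A14 A34 = False" "sgh A23 A12 = False" "sgh A23 A13 = True"
  "sgh A23 A14 = False" "sgh A23 A23 = False" "sgh A23 A24 = False" "sgh A23 A34 = True"
  "sgh A24 A12 = False" "sgh A24 A13 = False" "sgh A24 A14 = True" "sgh A24 A23 = True"
  "sgh A24 A24 = False" "sgh A24 A34 = False" "sgh A34 A12 = False" "sgh A34 A13 = False"
  "sgh A34 A14 = True" "sgh A34 A23 = False" "sgh A34 A24 = True" "sgh A34 A34 = False"
  by (simp_all add: sgh_def sle_def smeet_def sdual_def)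

text \<open>The rules to be verified at nine vertices; the first index counts columns, the second
  rows. \<open>hv\<close> passes to the next column and \<open>vh\<close> to the previous one. Where
  neither occurs, \<open>x2c\<close> is constant along diagonals and \<open>x3c\<close> along
  columns. Other clauses let features spread, and the last one forbids the collision of the two
  patterns.\<close>

definition ok4 :: "feat \<Rightarrow> feat \<Rightarrow> feat \<Rightarrow> feat \<Rightarrow> feat \<Rightarrow> feat \<Rightarrow> feat \<Rightarrow> feat \<Rightarrow> feat \<Rightarrow> bool" where
  "ok4 f00 f01 f02 f10 f11 f12 f20 f21 f22 \<longleftrightarrow>
     (hv f00 f01 \<longrightarrow> hv f10 f11) \<and> (vh f10 f11 \<longrightarrow> vh f00 f01)
   \<and> (nb f00 f01 \<longrightarrow> nb f10 f11 \<longrightarrow> x2c f00 = x2c f11 \<and> x3c f00 = x3c f01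
       \<and> (\<not> x3c f00 \<longrightarrow> x3c f10 \<longrightarrow> x2c f00 \<or> x2r f00)
       \<and> (x2c f01 \<longrightarrow> x2c f00 \<or> x3c f01 \<or> x3r f01))
   \<and> (x2c f00 \<longrightarrow> x2c f01 \<longrightarrow> x2c f11) \<and> (x2r f00 \<longrightarrow> x2r f01 \<longrightarrow> x2r f11)
   \<and> (x3c f00 \<longrightarrow> x3c f11 \<longrightarrow> x3c f10) \<and> (x3r f00 \<longrightarrow> x3r f11 \<longrightarrow> x3r f10)
   \<and> (hv f01 f02 \<longrightarrow> hv f11 f12 \<longrightarrow> (sv f00 \<longrightarrow> sv f10) \<longrightarrow> x2c f01 \<longrightarrow> x2c f11)
   \<and> (vh f00 f01 \<longrightarrow> vh f10 f11 \<longrightarrow> vh f20 f21 \<longrightarrow> \<not> sv f02 \<longrightarrow> \<not> sv f12 \<longrightarrow> \<not> sv f22 \<longrightarrow> x2c f11 \<longrightarrow> x2c f01)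
   \<and> (nb f00 f01 \<longrightarrow> nb f01 f02 \<longrightarrow> nb f10 f11 \<longrightarrow> nb f11 f12 \<longrightarrow> nb f20 f21 \<longrightarrow> nb f21 f22 \<longrightarrow>
       \<not> x3c f01 \<longrightarrow> x3c f11 \<longrightarrow> x2c f01 \<longrightarrow> x2c f00)"

definition col4 :: "sim \<times> sim \<times> sim \<times> sim \<Rightarrow> sim \<Rightarrow> ((sim \<times> sim \<times> sim \<times> sim) \<times> (sim \<times> sim \<times> sim)) option" where
  "col4 S y = (case S of (s1, s2, s3, s4) \<Rightarrow>
     (case tl2 y s1 of None \<Rightarrow> None | Some (u1, p1) \<Rightarrow>
     (case tl2 p1 s2 of None \<Rightarrow> None | Some (u2, p2) \<Rightarrow>
     (case tl2 p2 s3 of None \<Rightarrow> None | Some (u3, p3) \<Rightarrow>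
     (case tl2 p3 s4 of None \<Rightarrow> None | Some (u4, p4) \<Rightarrow> Some ((u1, u2, u3, u4), (p1, p2, p3)))))))"

definition vfeat :: "sim \<Rightarrow> sim \<times> sim \<times> sim \<Rightarrow> sim \<times> sim \<times> sim \<times> sim \<Rightarrow> sim \<times> sim \<times> sim \<Rightarrow>
    sim \<times> sim \<times> sim \<times> sim \<Rightarrow> feat \<times> feat \<times> feat" where
  "vfeat y P S P' S' = (case P of (p1, p2, p3) \<Rightarrow> case S of (s1, s2, s3, s4) \<Rightarrow>
     case P' of (q1, q2, q3) \<Rightarrow> case S' of (t1, t2, t3, t4) \<Rightarrow>
       (feat y s1 s2 q1 t2, feat p1 s2 s3 q2 t3, feat p2 s3 s4 q3 t4))"

definition okf :: "feat \<times> feat \<times> feat \<Rightarrow> feat \<times> feat \<times> feat \<Rightarrow> feat \<times> feat \<times> feat \<Rightarrow> bool" where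
  "okf F G H = (case F of (f0, f1, f2) \<Rightarrow> case G of (g0, g1, g2) \<Rightarrow> case H of (h0, h1, h2) \<Rightarrow>
     ok4 f0 f1 f2 g0 g1 g2 h0 h1 h2)"

definition walk4_3 :: "sim \<Rightarrow> sim \<times> sim \<times> sim \<Rightarrow> sim \<times> sim \<times> sim \<times> sim \<Rightarrow> feat \<times> feat \<times> feat \<Rightarrow> feat \<times> feat \<times> feat \<Rightarrow> bool" where
  "walk4_3 y P S F G = list_all (\<lambda>z. case col4 S z of None \<Rightarrow> True | Some (T, Q) \<Rightarrow>
     okf F G (vfeat y P S Q T)) (nx y)"

definition walk4_2 :: "sim \<Rightarrow> sim \<times> sim \<times> sim \<Rightarrow> sim \<times> sim \<times> sim \<times> sim \<Rightarrow> feat \<times> feat \<times> feat \<Rightarrow> bool" where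
  "walk4_2 y P S F = list_all (\<lambda>z. case col4 S z of None \<Rightarrow> True | Some (T, Q) \<Rightarrow>
     walk4_3 z Q T F (vfeat y P S Q T)) (nx y)"

definition walk4_1 :: "sim \<Rightarrow> sim \<times> sim \<times> sim \<Rightarrow> sim \<times> sim \<times> sim \<times> sim \<Rightarrow> bool" where
  "walk4_1 y P S = list_all (\<lambda>z. case col4 S z of None \<Rightarrow> True | Some (T, Q) \<Rightarrow>
     walk4_2 z Q T (vfeat y P S Q T)) (nx y)"

definition walk4_0 :: "sim \<Rightarrow> sim \<Rightarrow> sim \<Rightarrow> sim \<Rightarrow> bool" where
  "walk4_0 s1 s2 s3 s4 = list_all (\<lambda>y. case col4 (s1, s2, s3, s4) y of None \<Rightarrow> True | Some (T, Q) \<Rightarrow>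
     walk4_1 y Q T) ats"

text \<open>Nine interior vertices need four rows and four columns of squares. The block grows
  column by column, so choices that do not fit are dropped at once and the enumeration stays
  feasible.\<close>

lemma walk4_check: "list_all (\<lambda>s1. list_all (\<lambda>s2. list_all (\<lambda>s3. list_all (walk4_0 s1 s2 s3) (nx s3)) (nx s2)) (nx s1)) ats"
  by code_simp

section \<open>Squares, diagonals and features in annuli\<close>

lemma tl2_tile:
  assumes "tl2 y s = Some (s', y')"
  shows "slen y = 1" "slen s = 1" "slen s' = 1" "slen y' = 1" "y \<noteq> s" "br y \<cdot> br s' = br s \<cdot> br y'"
proof -
  have "slen y = 1 \<and> slen s = 1 \<and> slen s' = 1 \<and> slen y' = 1 \<and> y \<noteq> s \<and> br y \<cdot> br s' = br s \<cdot> br y'"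
    using assms by (cases y; cases s) (auto simp: tl2_def slen_def atom_products)
  then show "slen y = 1" "slen s = 1" "slen s' = 1" "slen y' = 1" "y \<noteq> s" "br y \<cdot> br s' = br s \<cdot> br y'"
    by blast+
qed

lemma tl2_stau: "tl2 (stau y) (stau s) = map_option (map_prod stau stau) (tl2 y s)"
  by (cases y; cases s) (simp_all add: tl2_def stau_def)

lemma flip_check:
  "list_all (\<lambda>y. list_all (\<lambda>s. case tl2 y s of None \<Rightarrow> True | Some (s1, p0) \<Rightarrow>
     list_all (\<lambda>z. case tl2 z s1 of None \<Rightarrow> True | Some (s2, p1) \<Rightarrow>
       tl2 p1 (cc1 y s1) = Some (cc1 z s2, stau y) \<and> lw p0 p1) (nx y)) ats) ats"
  by code_simp

text \<open>The diagonals of a strip are vertical edges of another strip, leading from the new word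
  back to the old one up to \<tau> and a rotation. So strips can be reversed, and the new word is
  again left-weighted.\<close>

lemma tl2_flip:
  assumes "tl2 y s = Some (s1, p0)" "tl2 z s1 = Some (s2, p1)" "lw y z"
  shows "tl2 p1 (cc1 y s1) = Some (cc1 z s2, stau y)" "lw p0 p1"
proof -
  have "y \<in> set ats" "s \<in> set ats" "z \<in> set (nx y)"
    using tl2_tile[OF assms(1)] tl2_tile[OF assms(2)] assms(3) in_nx by (simp_all add: slen_1[symmetric])
  then have "tl2 p1 (cc1 y s1) = Some (cc1 z s2, stau y) \<and> lw p0 p1"
    using flip_check assms(1,2) by (fastforce simp: list_all_iff)
  then show "tl2 p1 (cc1 y s1) = Some (cc1 z s2, stau y)" "lw p0 p1" by blast+
qed

text \<open>The link from features to letters: a feature present at two neighbouring vertices of a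
  row, or suitable features absent at one, make two letters agree. Reducibility of a row is read off
  from such coincidences.\<close>

definition ok2 :: "feat \<Rightarrow> feat \<Rightarrow> sim \<Rightarrow> sim \<Rightarrow> sim \<Rightarrow> sim \<Rightarrow> sim \<Rightarrow> sim \<Rightarrow> sim \<Rightarrow> sim \<Rightarrow> sim \<Rightarrow> bool" where
  "ok2 f0 f1 p0 p1 p2 y1 u1 v1 q2 v2 w2 \<longleftrightarrow>
     (\<not> x2c f0 \<longrightarrow> \<not> x3c f0 \<longrightarrow> p1 = p0) \<and> (sh f0 \<longrightarrow> \<not> x2c f0 \<longrightarrow> p1 = p0)
   \<and> (x2c f0 \<longrightarrow> x2c f1 \<longrightarrow> p1 = y1) \<and> (x2r f0 \<longrightarrow> x2r f1 \<longrightarrow> v1 = u1)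
   \<and> (x3c f0 \<longrightarrow> x3c f1 \<longrightarrow> q2 = stau p1) \<and> (x3r f0 \<longrightarrow> x3r f1 \<longrightarrow> cc1 p2 w2 = cc1 p1 v2)"

lemma walk2_check:
  "list_all (\<lambda>s1. list_all (\<lambda>s2. list_all (\<lambda>y0.
     case tl2 y0 s1 of None \<Rightarrow> True | Some (u1, p0) \<Rightarrow> case tl2 p0 s2 of None \<Rightarrow> True | Some (u2, q0) \<Rightarrow>
     list_all (\<lambda>y1. case tl2 y1 u1 of None \<Rightarrow> True | Some (v1, p1) \<Rightarrow> case tl2 p1 u2 of None \<Rightarrow> True | Some (v2, q1) \<Rightarrow>
     list_all (\<lambda>y2. case tl2 y2 v1 of None \<Rightarrow> True | Some (w1, p2) \<Rightarrow> case tl2 p2 v2 of None \<Rightarrow> True | Some (w2, q2) \<Rightarrow>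
       ok2 (feat y0 u1 u2 p1 v2) (feat y1 v1 v2 p2 w2) p0 p1 p2 y1 u1 v1 q2 v2 w2)
     (nx y1)) (nx y0)) ats) (nx s1)) ats"
  by code_simp

lemma strip_tl2: "strip R Y b Y' \<Longrightarrow> tl2 (Y i) (b i) = Some (b (Suc i), Y' i)"
  by (simp add: strip_def)

lemma annulusD:
  assumes "annulus R k a b"
  shows "j < k \<Longrightarrow> tl2 (a j i) (b j i) = Some (b j (Suc i), a (Suc j) i)"
    "Suc j < k \<Longrightarrow> lw (b j i) (b (Suc j) i)" "j \<le> k \<Longrightarrow> lw (a j i) (a j (Suc i))"
    "j < k \<Longrightarrow> slen (b j i) = 1" "j \<le> k \<Longrightarrow> slen (a j i) = 1"
    "j < k \<Longrightarrow> b j (i + R) = b j i" "j \<le> k \<Longrightarrow> a j (i + R) = a j i" "0 < R"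
proof -
  show t: "j < k \<Longrightarrow> tl2 (a j i) (b j i) = Some (b j (Suc i), a (Suc j) i)" for j i
    using assms by (auto simp: annulus_def strip_def)
  show "Suc j < k \<Longrightarrow> lw (b j i) (b (Suc j) i)" "j \<le> k \<Longrightarrow> lw (a j i) (a j (Suc i))"
    "j \<le> k \<Longrightarrow> slen (a j i) = 1" "j < k \<Longrightarrow> b j (i + R) = b j i" "j \<le> k \<Longrightarrow> a j (i + R) = a j i"
    using assms by (auto simp: annulus_def strip_def aword_def)
  show "0 < R" using assms by (auto simp: annulus_def aword_def)
  show "j < k \<Longrightarrow> slen (b j i) = 1" using t tl2_tile(2) by blast
qed

definition FF :: "(nat \<Rightarrow> nat \<Rightarrow> sim) \<Rightarrow> (nat \<Rightarrow> nat \<Rightarrow> sim) \<Rightarrow> nat \<Rightarrow> nat \<Rightarrow> feat" where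
  "FF a b i j = feat (a j i) (b j (Suc i)) (b (Suc j) (Suc i)) (a (Suc j) (Suc i)) (b (Suc j) (Suc (Suc i)))"

lemma annulus_ok4:
  assumes A: "annulus R k a b" and j: "j + 4 \<le> k"
  shows "ok4 (FF a b i j) (FF a b i (Suc j)) (FF a b i (Suc (Suc j)))
    (FF a b (Suc i) j) (FF a b (Suc i) (Suc j)) (FF a b (Suc i) (Suc (Suc j)))
    (FF a b (Suc (Suc i)) j) (FF a b (Suc (Suc i)) (Suc j)) (FF a b (Suc (Suc i)) (Suc (Suc j)))"
proof -
  define S where "S i = (b j i, b (Suc j) i, b (Suc (Suc j)) i, b (Suc (Suc (Suc j))) i)" for i
  define P where "P i = (a (Suc j) i, a (Suc (Suc j)) i, a (Suc (Suc (Suc j))) i)" for i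
  have col: "col4 (S i) (a j i) = Some (S (Suc i), P i)" for i
    using annulusD(1)[OF A, of j i] annulusD(1)[OF A, of "Suc j" i] annulusD(1)[OF A, of "Suc (Suc j)" i]
      annulusD(1)[OF A, of "Suc (Suc (Suc j))" i] j
    by (simp add: col4_def S_def P_def)
  have nxa: "a j (Suc i) \<in> set (nx (a j i))" for i
    using annulusD(3,5)[OF A, of j] j by (intro in_nx) auto
  have nxb: "b (Suc m) i \<in> set (nx (b m i))" if "Suc m < k" for m
    using annulusD(2,4)[OF A] that by (intro in_nx) auto
  have in_ats: "b j i \<in> set ats" "a j i \<in> set ats" for i
    using annulusD(4,5)[OF A, of j] j by (simp_all add: slen_1[symmetric])
  have vf: "vfeat (a j i) (P i) (S (Suc i)) (P (Suc i)) (S (Suc (Suc i)))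
      = (FF a b i j, FF a b i (Suc j), FF a b i (Suc (Suc j)))" for i
    by (simp add: vfeat_def P_def S_def FF_def)
  have "walk4_0 (b j i) (b (Suc j) i) (b (Suc (Suc j)) i) (b (Suc (Suc (Suc j))) i)"
    using walk4_check in_ats(1)[of i] nxb[of j] nxb[of "Suc j"] nxb[of "Suc (Suc j)"] j
    by (simp add: list_all_iff)
  then have "walk4_0 (fst (S i)) (fst (snd (S i))) (fst (snd (snd (S i)))) (snd (snd (snd (S i))))"
    by (simp add: S_def)
  then have "walk4_1 (a j i) (P i) (S (Suc i))"
    using in_ats(2)[of i] col[of i] unfolding walk4_0_def list_all_iff by (auto dest!: bspec)
  then have "walk4_2 (a j (Suc i)) (P (Suc i)) (S (Suc (Suc i)))
      (FF a b i j, FF a b i (Suc j), FF a b i (Suc (Suc j)))"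
    using nxa[of i] col[of "Suc i"] unfolding walk4_1_def list_all_iff vf[symmetric] by (auto dest!: bspec)
  then have "walk4_3 (a j (Suc (Suc i))) (P (Suc (Suc i))) (S (Suc (Suc (Suc i))))
      (FF a b i j, FF a b i (Suc j), FF a b i (Suc (Suc j)))
      (FF a b (Suc i) j, FF a b (Suc i) (Suc j), FF a b (Suc i) (Suc (Suc j)))"
    using nxa[of "Suc i"] col[of "Suc (Suc i)"] unfolding walk4_2_def list_all_iff vf[of "Suc i", symmetric]
    by (auto dest!: bspec)
  then have "okf (FF a b i j, FF a b i (Suc j), FF a b i (Suc (Suc j)))
      (FF a b (Suc i) j, FF a b (Suc i) (Suc j), FF a b (Suc i) (Suc (Suc j)))
      (FF a b (Suc (Suc i)) j, FF a b (Suc (Suc i)) (Suc j), FF a b (Suc (Suc i)) (Suc (Suc j)))"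
    using nxa[of "Suc (Suc i)"] col[of "Suc (Suc (Suc i))"]
    unfolding walk4_3_def list_all_iff vf[of "Suc (Suc i)", symmetric] by (auto dest!: bspec)
  then show ?thesis by (simp add: okf_def)
qed

lemma annulus_ok2:
  assumes A: "annulus R k a b" and j: "j + 2 \<le> k"
  shows "ok2 (FF a b i j) (FF a b (Suc i) j) (a (Suc j) i) (a (Suc j) (Suc i)) (a (Suc j) (Suc (Suc i)))
    (a j (Suc i)) (b j (Suc i)) (b j (Suc (Suc i))) (a (Suc (Suc j)) (Suc (Suc i)))
    (b (Suc j) (Suc (Suc i))) (b (Suc j) (Suc (Suc (Suc i))))"
proof -
  have t: "tl2 (a j i) (b j i) = Some (b j (Suc i), a (Suc j) i)"
    "tl2 (a (Suc j) i) (b (Suc j) i) = Some (b (Suc j) (Suc i), a (Suc (Suc j)) i)" for i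
    using annulusD(1)[OF A, of j i] annulusD(1)[OF A, of "Suc j" i] j by simp_all
  have nxa: "a j (Suc i) \<in> set (nx (a j i))" for i
    using annulusD(3,5)[OF A, of j] j by (intro in_nx) auto
  have nxb: "b (Suc j) i \<in> set (nx (b j i))"
    using annulusD(2,4)[OF A] j by (intro in_nx) auto
  have at: "b j i \<in> set ats" "a j i \<in> set ats"
    using annulusD(4,5)[OF A, of j] j by (simp_all add: slen_1[symmetric])
  note c1 = bspec[OF bspec[OF bspec[OF walk2_check[unfolded list_all_iff] at(1)] nxb] at(2)]
  note c2 = bspec[OF c1[unfolded t(1)[of i] t(2)[of i] option.case prod.case] nxa[of i]]
  note c3 = bspec[OF c2[unfolded t(1)[of "Suc i"] t(2)[of "Suc i"] option.case prod.case] nxa[of "Suc i"]]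
  show ?thesis
    using c3[unfolded t(1)[of "Suc (Suc i)"] t(2)[of "Suc (Suc i)"] option.case prod.case] unfolding FF_def .
qed

section \<open>Reducible rows and the height of annuli\<close>

lemma red_shift:
  assumes "aword R Y" "red R (\<lambda>i. Y (i + n))"
  shows "red R Y"
proof -
  have R: "0 < R" and per: "Y (i + m * R) = Y i" for i m
    using assms(1) periodic_mult[of Y R] by (auto simp: aword_def)
  let ?d = "n * R - n"
  have d: "Y (i + ?d + n) = Y i" for i
  proof -
    have "i + ?d + n = i + n * R" using R by (cases R) auto
    then show ?thesis by (simp only: per)
  qed
  from assms(2) show ?thesis
    unfolding red_def
  proof (elim disjE exE)
    fix s assume s: "strip R (\<lambda>i. Y (i + n)) s (\<lambda>i. Y (i + n))"
    have "strip R Y (\<lambda>i. s (i + ?d)) Y"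
      unfolding strip_def
    proof (intro conjI allI)
      fix i
      show "tl2 (Y i) (s (i + ?d)) = Some (s (Suc i + ?d), Y i)"
        using strip_tl2[OF s, of "i + ?d"] d[of i] by simp
      show "s (i + R + ?d) = s (i + ?d)"
        using s unfolding strip_def by (metis add.assoc add.commute)
    qed
    then show "(\<exists>s. strip R Y s Y) \<or> (\<exists>s. \<forall>i. \<exists>y'. tl2 (Y i) s = Some (s, y'))" by blast
  next
    fix s assume s: "\<forall>i. \<exists>y'. tl2 (Y (i + n)) s = Some (s, y')"
    have "\<exists>y'. tl2 (Y i) s = Some (s, y')" for i
      using s[rule_format, of "i + ?d"] d[of i] by simp
    then show "(\<exists>s. strip R Y s Y) \<or> (\<exists>s. \<forall>i. \<exists>y'. tl2 (Y i) s = Some (s, y'))" by blast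
  qed
qed

text \<open>For every atom \<open>y\<close> there is an atom \<open>s\<close> that a square on
  \<open>y\<close> and \<open>s\<close> repeats, so a power of \<open>y\<close> satisfies the second
  alternative of \<open>red\<close>.\<close>

lemma red_const: "aword R Y \<Longrightarrow> (\<And>i. Y (Suc i) = Y i) \<Longrightarrow> red R Y"
proof -
  assume Y: "aword R Y" and c: "\<And>i. Y (Suc i) = Y i"
  have "Y i = Y 0" for i by (induction i) (auto simp: c)
  moreover have "\<exists>s y'. tl2 y s = Some (s, y')" if "slen y = 1" for y
  proof -
    have "tl2 A12 A23 = Some (A23, A13)" "tl2 A13 A12 = Some (A12, A23)" "tl2 A14 A12 = Some (A12, A24)"
      "tl2 A23 A13 = Some (A13, A12)" "tl2 A24 A14 = Some (A14, A12)" "tl2 A34 A14 = Some (A14, A13)"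
      by (simp_all add: tl2_def)
    then show ?thesis using that by (cases y) (auto simp: slen_def)
  qed
  ultimately show "red R Y" unfolding red_def using Y unfolding aword_def by metis
qed

lemma periodic_bool_const:
  assumes "\<And>i. P i \<Longrightarrow> P (Suc i)" "\<And>i. P (i + R) = P i" "0 < R"
  shows "P i = P j"
  using periodic_mono_const[where f = P and R = R] assms by auto

lemma periodic_change:
  assumes per: "\<And>i. P (i + R) = P i" and "0 < R" "P i" "\<not> P j"
  obtains m where "P m" "\<not> P (Suc m)"
proof (rule ccontr)
  assume "\<not> thesis"
  then have "P m \<Longrightarrow> P (Suc m)" for m using that by blast
  then have "P i = P j" using periodic_bool_const[of P R i j] per assms(2) by blast
  then show False using assms by blast
qed

text \<open>Without a reducible row, none of \<open>x2c\<close>, \<open>x2r\<close>,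
  \<open>x3c\<close>, \<open>x3r\<close> holds along a whole row. Where \<open>hv\<close> or
  \<open>vh\<close> occurs, it fills a row and makes \<open>x2c\<close> constant along a row, which
  is impossible; so \<open>nb\<close> holds away from the ends, and two patterns describe the rows.
  They need \<open>R\<close> rows to meet in every relative position; the summand 8 leaves room for
  the blocks of the local rules.\<close>

theorem annulus_red:
  assumes A: "annulus R k a b" and k: "R + 8 \<le> k"
  shows "\<exists>j\<le>k. red R (a j)"
proof (rule ccontr)
  assume "\<not> ?thesis"
  then have nored: "\<not> red R (a j)" if "j \<le> k" for j using that by blast
  let ?F = "FF a b"
  have R: "0 < R" using annulusD(8)[OF A] .
  have aw: "aword R (a j)" if "j \<le> k" for j using A that by (simp add: annulus_def)
  have perF: "?F (i + R) j = ?F i j" if "j + 2 \<le> k" for i j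
    using annulusD(6)[OF A, of j "Suc i"] annulusD(6)[OF A, of "Suc j" "Suc i"] annulusD(6)[OF A, of "Suc j" "Suc (Suc i)"]
      annulusD(7)[OF A, of j i] annulusD(7)[OF A, of "Suc j" "Suc i"] that
    by (simp add: FF_def)
  note w2 = annulus_ok2[OF A, unfolded ok2_def]
  note w4' = annulus_ok4[OF A, unfolded ok4_def]
  have w4_hv: "hv (?F i j) (?F i (Suc j)) \<Longrightarrow> hv (?F (Suc i) j) (?F (Suc i) (Suc j))"
    and w4_vh: "vh (?F (Suc i) j) (?F (Suc i) (Suc j)) \<Longrightarrow> vh (?F i j) (?F i (Suc j))"
    if "j + 4 \<le> k" for i j using w4'[OF that, of i] by blast+
  have r1: "\<exists>i. \<not> x2c (?F i j)" if j: "j + 2 \<le> k" for j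
  proof (rule ccontr)
    assume "\<not> ?thesis"
    then have "a (Suc j) (Suc i) = a j (Suc i)" for i using w2[OF j, of i] by blast
    then have "strip R (\<lambda>i. a j (i + 1)) (\<lambda>i. b j (i + 1)) (\<lambda>i. a j (i + 1))"
      using annulusD(1)[OF A, of j] annulusD(6)[OF A, of j] j by (auto simp: strip_def) (metis add_Suc)
    then have "red R (\<lambda>i. a j (i + 1))" unfolding red_def by blast
    from red_shift[OF aw this] nored[of j] j show False by linarith
  qed
  have r2: "\<exists>i. \<not> x2r (?F i j)" if j: "j + 2 \<le> k" for j
  proof (rule ccontr)
    assume "\<not> ?thesis"
    then have c: "b j (Suc (Suc i)) = b j (Suc i)" for i using w2[OF j, of i] by blast
    have e: "b j (Suc i) = b j 1" for i by (induction i) (auto simp: c)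
    have "\<exists>y'. tl2 (a j (i + 1)) (b j 1) = Some (b j 1, y')" for i
      using annulusD(1)[OF A, of j "Suc i"] e[of i] e[of "Suc i"] j by auto
    then have "red R (\<lambda>i. a j (i + 1))" unfolding red_def by blast
    from red_shift[OF aw this] nored[of j] j show False by linarith
  qed
  have fl: "tl2 (a (Suc (Suc j)) (Suc i)) (cc1 (a (Suc j) i) (b (Suc j) (Suc i)))
      = Some (cc1 (a (Suc j) (Suc i)) (b (Suc j) (Suc (Suc i))), stau (a (Suc j) i))" if "j + 2 \<le> k" for i j
    using tl2_flip(1)[OF annulusD(1)[OF A, of "Suc j" i] annulusD(1)[OF A, of "Suc j" "Suc i"] annulusD(3)[OF A, of "Suc j" i]]
      that by simp
  have r3: "\<exists>i. \<not> x3c (?F i j)" if j: "j + 2 \<le> k" for j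
  proof (rule ccontr)
    assume "\<not> ?thesis"
    then have e: "a (Suc (Suc j)) (Suc (Suc i)) = stau (a (Suc j) (Suc i))" for i using w2[OF j, of i] by blast
    let ?s = "\<lambda>i. cc1 (a (Suc j) (Suc i)) (b (Suc j) (Suc (Suc i)))"
    have "?s (i + R) = ?s i" for i
      using annulusD(6)[OF A, of "Suc j" "Suc (Suc i)"] annulusD(7)[OF A, of "Suc j" "Suc i"] j by simp
    then have "strip R (\<lambda>i. a (Suc (Suc j)) (i + 2)) ?s (\<lambda>i. a (Suc (Suc j)) (i + 2))"
      using fl[OF j, of "Suc _"] e by (simp add: strip_def)
    then have "red R (\<lambda>i. a (Suc (Suc j)) (i + 2))" unfolding red_def by blast
    from red_shift[OF aw this] nored[of "Suc (Suc j)"] j show False by linarith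
  qed
  have r4: "\<exists>i. \<not> x3r (?F i j)" if j: "j + 2 \<le> k" for j
  proof (rule ccontr)
    assume "\<not> ?thesis"
    let ?s = "\<lambda>i. cc1 (a (Suc j) (Suc i)) (b (Suc j) (Suc (Suc i)))"
    have c: "?s (Suc i) = ?s i" for i using w2[OF j, of i] \<open>\<not> (\<exists>i. \<not> x3r (?F i j))\<close> by blast
    have e: "?s i = ?s 0" for i by (induction i) (use c in auto)
    have "tl2 (a (Suc (Suc j)) (i + 2)) (?s 0) = Some (?s 0, stau (a (Suc j) (Suc i)))" for i
      using fl[OF j, of "Suc i"] e[of i] e[of "Suc i"] by simp
    then have "red R (\<lambda>i. a (Suc (Suc j)) (i + 2))" unfolding red_def by blast
    from red_shift[OF aw this] nored[of "Suc (Suc j)"] j show False by linarith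
  qed
  have r5: "\<exists>i. a (Suc j) (Suc i) \<noteq> a (Suc j) i" if "j + 2 \<le> k" for j
    using red_const[OF aw, of "Suc j"] nored[of "Suc j"] that by auto
  have mixed: False if j: "j + 2 \<le> k" and s: "\<And>i. sh (?F i j)" and c: "\<And>i i'. x2c (?F i j) = x2c (?F i' j)" for j
  proof (cases "x2c (?F 0 j)")
    case True
    then show False using r1[OF j] c by blast
  next
    case False
    then have "a (Suc j) (Suc i) = a (Suc j) i" for i using w2[OF j, of i] s[of i] c[of i 0] by blast
    then show False using r5[OF j] by blast
  qed
  have hvc: "hv (?F i j) (?F i (Suc j)) = hv (?F i' j) (?F i' (Suc j))"
    and vhc: "vh (?F i j) (?F i (Suc j)) = vh (?F i' j) (?F i' (Suc j))" if "j + 4 \<le> k" for i i' j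
  proof -
    have p: "?F (i + R) j = ?F i j" "?F (i + R) (Suc j) = ?F i (Suc j)" for i using perF that by auto
    show "hv (?F i j) (?F i (Suc j)) = hv (?F i' j) (?F i' (Suc j))"
    proof (rule periodic_bool_const[where P = "\<lambda>i. hv (?F i j) (?F i (Suc j))" and R = R])
      show "hv (?F i j) (?F i (Suc j)) \<Longrightarrow> hv (?F (Suc i) j) (?F (Suc i) (Suc j))" for i by (rule w4_hv[OF that])
      show "hv (?F (i + R) j) (?F (i + R) (Suc j)) = hv (?F i j) (?F i (Suc j))" for i by (simp only: p)
    qed (rule R)
    have "\<not> vh (?F i j) (?F i (Suc j)) \<longleftrightarrow> \<not> vh (?F i' j) (?F i' (Suc j))"
    proof (rule periodic_bool_const[where P = "\<lambda>i. \<not> vh (?F i j) (?F i (Suc j))" and R = R])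
      show "\<not> vh (?F i j) (?F i (Suc j)) \<Longrightarrow> \<not> vh (?F (Suc i) j) (?F (Suc i) (Suc j))" for i
        using w4_vh[OF that, of i] by blast
      show "(\<not> vh (?F (i + R) j) (?F (i + R) (Suc j))) = (\<not> vh (?F i j) (?F i (Suc j)))" for i by (simp only: p)
    qed (rule R)
    then show "vh (?F i j) (?F i (Suc j)) = vh (?F i' j) (?F i' (Suc j))" by blast
  qed
  \<comment> \<open>Here \<open>sh\<close> holds along the whole row, and constancy of
    \<open>vh\<close> makes \<open>sv\<close> constant in the preceding row. Then \<open>x2c\<close>
    propagates around the row and \<open>mixed\<close> applies.\<close>
  have nohv: "\<not> hv (?F i (Suc j)) (?F i (Suc (Suc j)))" if j: "j + 5 \<le> k" for i j
  proof
    assume "hv (?F i (Suc j)) (?F i (Suc (Suc j)))"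
    then have h: "hv (?F i (Suc j)) (?F i (Suc (Suc j)))" for i using hvc[of "Suc j"] j by auto
    have sv: "sv (?F i j) = sv (?F i' j)" for i i'
      using vhc[of j i i'] h[of i] h[of i'] j by (auto simp: vh_def hv_def)
    have "x2c (?F i (Suc j)) \<Longrightarrow> x2c (?F (Suc i) (Suc j))" for i
    proof -
      have "j + 4 \<le> k" using j by simp
      then have "hv (?F i (Suc j)) (?F i (Suc (Suc j))) \<longrightarrow> hv (?F (Suc i) (Suc j)) (?F (Suc i) (Suc (Suc j))) \<longrightarrow>
          (sv (?F i j) \<longrightarrow> sv (?F (Suc i) j)) \<longrightarrow> x2c (?F i (Suc j)) \<longrightarrow> x2c (?F (Suc i) (Suc j))"
        using w4'[of j i] by blast
      then show "x2c (?F i (Suc j)) \<Longrightarrow> x2c (?F (Suc i) (Suc j))"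
        using h[of i] h[of "Suc i"] sv[of i "Suc i"] by simp
    qed
    note st = this
    have "x2c (?F i (Suc j)) = x2c (?F i' (Suc j))" for i i'
    proof (rule periodic_bool_const[where P = "\<lambda>i. x2c (?F i (Suc j))" and R = R])
      show "x2c (?F (i + R) (Suc j)) = x2c (?F i (Suc j))" for i using perF[of "Suc j" i] j by simp
    qed (use st R in blast)+
    then show False using mixed[of "Suc j"] h j by (auto simp: hv_def)
  qed
  have novh: "\<not> vh (?F i j) (?F i (Suc j))" if j: "j + 5 \<le> k" for i j
  proof
    assume "vh (?F i j) (?F i (Suc j))"
    then have h: "vh (?F i j) (?F i (Suc j))" for i using vhc[of j] j by auto
    have sv: "\<not> sv (?F i (Suc (Suc j)))" for i
      using nohv[OF j, of i] h[of i] by (auto simp: vh_def hv_def)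
    have "x2c (?F (Suc i) (Suc j)) \<Longrightarrow> x2c (?F i (Suc j))" for i
    proof -
      have "j + 4 \<le> k" using j by simp
      then have "vh (?F i j) (?F i (Suc j)) \<longrightarrow> vh (?F (Suc i) j) (?F (Suc i) (Suc j)) \<longrightarrow>
          vh (?F (Suc (Suc i)) j) (?F (Suc (Suc i)) (Suc j)) \<longrightarrow> \<not> sv (?F i (Suc (Suc j))) \<longrightarrow>
          \<not> sv (?F (Suc i) (Suc (Suc j))) \<longrightarrow> \<not> sv (?F (Suc (Suc i)) (Suc (Suc j))) \<longrightarrow>
          x2c (?F (Suc i) (Suc j)) \<longrightarrow> x2c (?F i (Suc j))"
        using w4'[of j i] by blast
      then show "x2c (?F (Suc i) (Suc j)) \<Longrightarrow> x2c (?F i (Suc j))"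
        using h[of i] h[of "Suc i"] h[of "Suc (Suc i)"] sv[of i] sv[of "Suc i"] sv[of "Suc (Suc i)"] by simp
    qed
    note st = this
    have "\<not> x2c (?F i (Suc j)) \<longleftrightarrow> \<not> x2c (?F i' (Suc j))" for i i'
    proof (rule periodic_bool_const[where P = "\<lambda>i. \<not> x2c (?F i (Suc j))" and R = R])
      show "(\<not> x2c (?F (i + R) (Suc j))) = (\<not> x2c (?F i (Suc j)))" for i using perF[of "Suc j" i] j by simp
    qed (use st R in blast)+
    then show False using mixed[of "Suc j"] h j by (auto simp: vh_def)
  qed
  have nb: "nb (?F i (Suc j)) (?F i (Suc (Suc j)))" if "j + 6 \<le> k" for i j
    using nohv[of j i] novh[of "Suc j" i] that by (simp add: nb_def)
  have inv2: "x2c (?F i (Suc j)) = x2c (?F (Suc i) (Suc (Suc j)))"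
    and inv3: "x3c (?F i (Suc j)) = x3c (?F i (Suc (Suc j)))"
    and g1: "\<not> x3c (?F i (Suc j)) \<Longrightarrow> x3c (?F (Suc i) (Suc j)) \<Longrightarrow> \<not> x2c (?F i (Suc j)) \<Longrightarrow> x2r (?F i (Suc j))"
    and g2: "x2c (?F i (Suc (Suc j))) \<Longrightarrow> \<not> x2c (?F i (Suc j)) \<Longrightarrow>
        x3c (?F i (Suc (Suc j))) \<or> x3r (?F i (Suc (Suc j)))" if "j + 6 \<le> k" for i j
  proof -
    have "Suc j + 4 \<le> k" using that by simp
    note w = w4'[OF this, of i]
    show "x2c (?F i (Suc j)) = x2c (?F (Suc i) (Suc (Suc j)))" "x3c (?F i (Suc j)) = x3c (?F i (Suc (Suc j)))"
      "\<not> x3c (?F i (Suc j)) \<Longrightarrow> x3c (?F (Suc i) (Suc j)) \<Longrightarrow> \<not> x2c (?F i (Suc j)) \<Longrightarrow> x2r (?F i (Suc j))"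
      "x2c (?F i (Suc (Suc j))) \<Longrightarrow> \<not> x2c (?F i (Suc j)) \<Longrightarrow>
        x3c (?F i (Suc (Suc j))) \<or> x3r (?F i (Suc (Suc j)))"
      using w nb[OF that, of i] nb[OF that, of "Suc i"] by blast+
  qed
  \<comment> \<open>\<open>I\<close> is the pattern of \<open>x3c\<close>, the same in every row;
    \<open>J\<close> is the pattern of \<open>x2c\<close>, which moves on by one column per
    row.\<close>
  define I where "I i = x3c (?F i 1)" for i
  define J where "J i = x2c (?F i 1)" for i
  have II: "x3c (?F i (Suc m)) = I i" if "m \<le> R + 2" for i m
    using that
  proof (induction m)
    case (Suc m)
    then show ?case using inv3[of m i] k by simp
  qed (simp add: I_def)
  have JJ: "x2c (?F (i + m) (Suc m)) = J i" if "m \<le> R + 2" for i m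
    using that
  proof (induction m)
    case (Suc m)
    then show ?case using inv2[of m "i + m"] k by simp
  qed (simp add: J_def)
  have perI: "I (i + R) = I i" and perJ: "J (i + R) = J i" for i
    using perF[of 1 i] k by (simp_all add: I_def J_def)
  obtain i1 where i1: "\<not> I i1" using r3[of 1] k by (auto simp: I_def)
  obtain j1 where j1: "\<not> J j1" using r1[of 1] k by (auto simp: J_def)
  show False
  proof (cases "\<exists>i. J i")
    case True
    then obtain n where n: "J n" "\<not> J (Suc n)" using periodic_change[of J R] perJ R j1 by metis
    show False
    proof (cases "\<exists>i. I i")
      case True
      then obtain m where m: "\<not> I m" "I (Suc m)"
        using periodic_change[of "\<lambda>i. \<not> I i" R] perI R i1 by metis
      define q where "q = n mod R"
      define p where "p = m + R * (Suc n)"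
      have "n < p" using R by (cases R) (auto simp: p_def)
      \<comment> \<open>The shift after which the end of a run of \<open>J\<close> at
        \<open>n\<close> meets the beginning of a run of \<open>I\<close> at \<open>m\<close>. The
        summand 1 keeps it positive, so that there is a preceding row for comparison.\<close>
      define j where "j = (p - n - 1) mod R + 1"
      have j: "1 \<le> j" "j \<le> R" using R by (auto simp: j_def Suc_leI)
      have "(n + j) mod R = p mod R"
      proof -
        have "(n + j) mod R = (n + 1 + (p - n - 1) mod R) mod R" by (simp add: j_def)
        also have "\<dots> = (n + 1 + (p - n - 1)) mod R" by (rule mod_add_right_eq)
        also have "n + 1 + (p - n - 1) = p" using \<open>n < p\<close> by simp
        finally show ?thesis .
      qed
      also have "p mod R = m mod R" unfolding p_def by (rule mod_mult_self2)
      finally have nj: "(n + j) mod R = m mod R" .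
      have Im: "I (n + j) = I m" "I (Suc (n + j)) = I (Suc m)"
      proof -
        show "I (n + j) = I m"
          using periodic_mod[of I R "n + j"] periodic_mod[of I R m] perI nj by simp
        have "Suc (n + j) mod R = Suc m mod R" using nj by (metis mod_Suc_eq)
        then show "I (Suc (n + j)) = I (Suc m)"
          using periodic_mod[of I R "Suc (n + j)"] periodic_mod[of I R "Suc m"] perI by metis
      qed
      obtain j' where j': "j = Suc j'" using j by (cases j) auto
      have "\<not> x3c (?F (n + j) (Suc j))" "x3c (?F (Suc (n + j)) (Suc j))"
        using II[of j] Im m j by simp_all
      moreover have "x2c (?F (n + j) (Suc j))" using JJ[of j n] n j by simp
      moreover have "\<not> x2c (?F (n + j) j)" using JJ[of j' "Suc n"] n j j' by simp
      moreover have "nb (?F i j) (?F i (Suc j))" "nb (?F i (Suc j)) (?F i (Suc (Suc j)))" for i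
        using nb[of j' i] nb[of j i] j j' k by simp_all
      moreover have "j + 4 \<le> k" using j k by simp
      note w4'[OF this, of "n + j"]
      ultimately show False by blast
    next
      case False
      \<comment> \<open>The end of a run of \<open>J\<close> forces \<open>x3r\<close> along its
        diagonal; from there \<open>x3r\<close> spreads over a full period of row 2.\<close>
      have x3: "x3r (?F (n + Suc m) (Suc (Suc m)))" if "Suc m \<le> R + 2" for m
      proof -
        have "x2c (?F (n + Suc m) (Suc (Suc m)))" "\<not> x2c (?F (n + Suc m) (Suc m))"
          using JJ[of "Suc m" n] JJ[of m "Suc n"] n that by simp_all
        moreover have "\<not> x3c (?F (n + Suc m) (Suc (Suc m)))" using II[of "Suc m"] False that by simp
        ultimately show ?thesis using g2[of m "n + Suc m"] that k by simp
      qed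
      have run: "x3r (?F (n + Suc m + q) (Suc (Suc m)))" if "m + q \<le> R + 1" for m q
        using that
      proof (induction q arbitrary: m)
        case 0
        then show ?case using x3[of m] by simp
      next
        case (Suc q)
        have "x3r (?F (n + Suc m + q) (Suc (Suc m)))" "x3r (?F (Suc (n + Suc m + q)) (Suc (Suc (Suc m))))"
          using Suc.IH[of m] Suc.IH[of "Suc m"] Suc.prems by simp_all
        moreover have "Suc (Suc m) + 4 \<le> k" using Suc.prems k by simp
        note w4'[OF this, of "n + Suc m + q"]
        ultimately have "x3r (?F (Suc (n + Suc m + q)) (Suc (Suc m)))" by blast
        then show ?case by simp
      qed
      have "x3r (?F i 2)" for i
      proof -
        let ?q = "(i + (n + 1) * R - (n + 1)) mod R"
        have nR: "n + 1 \<le> (n + 1) * R" using R by (cases R) auto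
        have "(n + 1 + ?q) mod R = (n + 1 + (i + (n + 1) * R - (n + 1))) mod R" by (rule mod_add_right_eq)
        also have "n + 1 + (i + (n + 1) * R - (n + 1)) = i + (n + 1) * R"
          using nR by simp
        finally have e: "(n + 1 + ?q) mod R = i mod R" by (simp only: mod_mult_self1)
        have "?q \<le> R" using R by (simp add: less_imp_le)
        then have "x3r (?F (n + 1 + ?q) 2)" using run[of 0 ?q] by (simp add: numeral_2_eq_2)
        moreover have "?F (n + 1 + ?q) 2 = ?F i 2"
          using periodic_mod[of "\<lambda>i. ?F i 2" R "n + 1 + ?q"] periodic_mod[of "\<lambda>i. ?F i 2" R i] perF[of 2] e k by simp
        ultimately show ?thesis by simp
      qed
      then show False using r4[of 2] k by auto
    qed
  next
    case noJ: False
    have no2: "\<not> x2c (?F i (Suc m))" if "m \<le> R + 2" for i m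
    proof -
      let ?i = "i + m * R - m"
      have "m \<le> m * R" using R by simp
      then have "?i + m = i + m * R" by linarith
      with JJ[OF that, of ?i] have "x2c (?F (i + m * R) (Suc m)) = J ?i" by (simp only:)
      moreover have "?F (i + m * R) (Suc m) = ?F i (Suc m)"
        using periodic_mult[of "\<lambda>i. ?F i (Suc m)" R i m] perF[of "Suc m"] that k by simp
      ultimately show ?thesis using noJ by simp
    qed
    show False
    proof (cases "\<exists>i. I i")
      case True
      then obtain m where m: "\<not> I m" "I (Suc m)"
        using periodic_change[of "\<lambda>i. \<not> I i" R] perI R i1 by metis
      \<comment> \<open>The beginning of a run of \<open>I\<close> stays in its column and forces
        \<open>x2r\<close> there in every row. Spreading one column per row, \<open>x2r\<close>
        fills row \<open>Suc R\<close>.\<close>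
      have x2: "x2r (?F m (Suc l))" if "l \<le> R + 2" for l
        using g1[of l m] II[OF that] m no2[OF that] that k by simp
      have run: "x2r (?F (m + q) (Suc l))" if "q \<le> l" "l \<le> R + 2" for q l
        using that
      proof (induction q arbitrary: l)
        case 0
        then show ?case using x2 by simp
      next
        case (Suc q)
        then obtain l' where l': "l = Suc l'" by (cases l) auto
        have "x2r (?F (m + q) (Suc l'))" "x2r (?F (m + q) (Suc l))" using Suc l' by simp_all
        moreover have "Suc l' + 4 \<le> k" using Suc.prems k l' by simp
        note w4'[OF this, of "m + q"]
        ultimately have "x2r (?F (Suc (m + q)) (Suc (Suc l')))" unfolding l' by blast
        then show ?case by (simp add: l')
      qed
      have "x2r (?F i (Suc R))" for i
      proof -
        let ?q = "(i + m * R - m) mod R"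
        have mR: "m \<le> m * R" using R by (cases R) auto
        have "(m + ?q) mod R = (m + (i + m * R - m)) mod R" by (rule mod_add_right_eq)
        also have "m + (i + m * R - m) = i + m * R" using mR by linarith
        finally have e: "(m + ?q) mod R = i mod R" by simp
        have "x2r (?F (m + ?q) (Suc R))" using run[of ?q R] R by (simp add: less_imp_le)
        moreover have "?F (m + ?q) (Suc R) = ?F i (Suc R)"
          using periodic_mod[of "\<lambda>i. ?F i (Suc R)" R "m + ?q"] periodic_mod[of "\<lambda>i. ?F i (Suc R)" R i]
            perF[of "Suc R"] e k by simp
        ultimately show ?thesis by simp
      qed
      then show False using r2[of "Suc R"] k by auto
    next
      case False
      have "a (Suc 1) (Suc i) = a (Suc 1) i" for i
        using w2[of 1 i] False noJ k by (auto simp: I_def J_def)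
      then show False using r5[of 1] k by auto
    qed
  qed
qed

section \<open>The graph of words\<close>

text \<open>A vertical edge determines the next one, and periodicity carries this around to the
  positions before \<open>i\<close>.\<close>

lemma strip_determined:
  assumes "strip R Y b Y'" "strip R Y c Z" "0 < R" "b i = c i"
  shows "b = c \<and> Y' = Z"
proof -
  have f: "b (i + n) = c (i + n)" for n
  proof (induction n)
    case (Suc n)
    then show ?case using strip_tl2[OF assms(1), of "i + n"] strip_tl2[OF assms(2), of "i + n"] by simp
  qed (use assms in simp)
  have bc: "b j = c j" for j
  proof -
    have "i \<le> j + i * R" using assms(3) by (cases R) auto
    then have "j + i * R = i + (j + i * R - i)" by simp
    then have "b (j + i * R) = c (j + i * R)" using f[of "j + i * R - i"] by simp
    then show ?thesis
      using periodic_mult[of b R j i] periodic_mult[of c R j i] assms(1,2) by (simp add: strip_def)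
  qed
  moreover have "Y' j = Z j" for j using strip_tl2[OF assms(1), of j] strip_tl2[OF assms(2), of j] bc by simp
  ultimately show ?thesis by blast
qed

lemma strip_aword:
  assumes "aword R Y" "strip R Y b Y'"
  shows "aword R Y'"
  unfolding aword_def
proof (intro conjI allI)
  fix i
  show "0 < R" using assms by (simp add: aword_def)
  have "tl2 (Y (i + R)) (b (i + R)) = tl2 (Y i) (b i)" using assms by (simp add: aword_def strip_def)
  then show "Y' (i + R) = Y' i" using strip_tl2[OF assms(2)] by simp
  show "slen (Y' i) = 1" using tl2_tile(4)[OF strip_tl2[OF assms(2)]] .
  show "lw (Y' i) (Y' (Suc i))"
    using tl2_flip(2)[OF strip_tl2[OF assms(2)] strip_tl2[OF assms(2)]] assms(1) by (simp add: aword_def)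
qed

text \<open>The diagonals of \<open>tl2_flip\<close> as vertical edges of the reverse strip. By
  periodicity \<open>i + (R - 1)\<close> plays the role of i - 1.\<close>

definition bk :: "nat \<Rightarrow> (nat \<Rightarrow> sim) \<Rightarrow> (nat \<Rightarrow> sim) \<Rightarrow> nat \<Rightarrow> sim" where
  "bk R Y b i = cc1 (Y (i + (R - 1))) (b (i + R))"

lemma strip_back:
  assumes "aword R Y" "strip R Y b Y'"
  shows "strip R Y' (bk R Y b) (\<lambda>i. stau (Y (i + (R - 1))))"
  unfolding strip_def
proof (intro conjI allI)
  fix i
  obtain j where j: "j = i + (R - 1)" by blast
  have R: "Suc j = i + R" using assms by (simp add: aword_def j)
  have p: "Y' (i + R) = Y' i" using strip_aword[OF assms] by (simp add: aword_def)
  have "lw (Y j) (Y (Suc j))" using assms(1) by (simp add: aword_def)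
  from tl2_flip(1)[OF strip_tl2[OF assms(2)] strip_tl2[OF assms(2)] this]
  have "tl2 (Y' (i + R)) (cc1 (Y j) (b (i + R))) = Some (cc1 (Y (Suc j)) (b (Suc (i + R))), stau (Y j))"
    by (simp only: R)
  moreover have "Suc i + (R - 1) = Suc j" "Suc i + R = Suc (i + R)" by (simp_all add: j)
  ultimately show "tl2 (Y' i) (bk R Y b i) = Some (bk R Y b (Suc i), stau (Y (i + (R - 1))))"
    unfolding bk_def p j[symmetric] by (simp only:)
  show "bk R Y b (i + R) = bk R Y b i"
  proof -
    have "i + R + (R - 1) = i + (R - 1) + R" by simp
    then have "Y (i + R + (R - 1)) = Y (i + (R - 1))" using assms(1) unfolding aword_def by (simp only:)
    moreover have "b (i + R + R) = b (i + R)" using assms(2) unfolding strip_def by blast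
    ultimately show ?thesis unfolding bk_def by (simp only:)
  qed
qed

lemma extend_check:
  "list_all (\<lambda>y. list_all (\<lambda>s. case tl2 y s of None \<Rightarrow> True | Some (s1, p0) \<Rightarrow>
     list_all (\<lambda>z. case tl2 z s1 of None \<Rightarrow> True | Some (s2, p1) \<Rightarrow>
       list_all (\<lambda>t. case tl2 p0 t of None \<Rightarrow> True | Some (t1, q0) \<Rightarrow>
         tl2 p1 t1 = None \<or> t1 = cc1 y s1 \<or> lw s1 t1) ats) (nx y)) ats) ats"
  by code_simp

text \<open>In each column the table leaves only left-weightedness or the edge of the reverse strip,
  and a single such edge would make the whole strip the reverse one.\<close>

lemma strip_extend:
  assumes "aword R Y" "strip R Y b Y'" "strip R Y' c Z" "c \<noteq> bk R Y b"
  shows "lw (b i) (c i)"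
proof -
  have R: "0 < R" using assms by (simp add: aword_def)
  obtain j where j': "j = i + (R - 1)" by blast
  have j: "Suc j = i + R" using R by (simp add: j')
  have per: "b (i + R) = b i" "c (i + R) = c i" using assms(2,3) by (simp_all add: strip_def)
  have "c i \<noteq> bk R Y b i"
    using strip_determined[OF assms(3) strip_back[OF assms(1,2)] R] assms(4) by blast
  then have ne: "c (Suc j) \<noteq> cc1 (Y j) (b (Suc j))"
    unfolding j by (simp add: bk_def per j')
  have at: "Y j \<in> set ats" "b j \<in> set ats" "c j \<in> set ats" "Y (Suc j) \<in> set (nx (Y j))"
    using tl2_tile[OF strip_tl2[OF assms(2), of j]] tl2_tile[OF strip_tl2[OF assms(3), of j]] assms(1)
    by (auto simp: slen_1[symmetric] aword_def intro!: in_nx)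
  note c1 = bspec[OF bspec[OF extend_check[unfolded list_all_iff] at(1)] at(2)]
  note c2 = bspec[OF c1[unfolded strip_tl2[OF assms(2)] option.case prod.case] at(4)]
  note c3 = bspec[OF c2[unfolded strip_tl2[OF assms(2)] option.case prod.case] at(3)]
  have "lw (b (Suc j)) (c (Suc j))"
    using c3[unfolded strip_tl2[OF assms(3)] option.case prod.case] ne by simp
  then show ?thesis unfolding j per .
qed

text \<open>The rows that can carry three strips, apart from reducible ones.\<close>

definition special :: "(nat \<Rightarrow> sim) \<Rightarrow> bool" where
  "special Y \<longleftrightarrow> (\<forall>i. side (Y i) \<and> (Y (Suc i) = Y i \<or> Y (Suc i) = stau (Y i)))"

lemma triple_check:
  "list_all (\<lambda>y. list_all (\<lambda>s. case tl2 y s of None \<Rightarrow> True | Some (s1, p) \<Rightarrow>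
     list_all (\<lambda>t. case tl2 y t of None \<Rightarrow> True | Some (t1, q) \<Rightarrow> s1 = t1 \<or>
       list_all (\<lambda>u. case tl2 y u of None \<Rightarrow> True | Some (u1, r) \<Rightarrow> u1 = s1 \<or> u1 = t1 \<or>
         list_all (\<lambda>z. tl2 z s1 = None \<or> tl2 z t1 = None \<or> tl2 z u1 = None \<or> z = y
            \<or> side y \<and> z = stau y) (nx y)) ats) ats) ats) ats"
  by code_simp

text \<open>Three strips with different edges behind a letter can continue only along the same
  letter or, for a side letter, its rotation. A row that is not constant contains a side letter, and
  rotation keeps it a side letter.\<close>

lemma three_strips:
  assumes Y: "aword R Y" and s: "strip R Y b B" "strip R Y c C" "strip R Y e E"
    and ne: "b \<noteq> c" "b \<noteq> e" "c \<noteq> e"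
  shows "special Y \<or> red R Y"
proof -
  have R: "0 < R" using Y by (simp add: aword_def)
  have st: "Y (Suc i) = Y i \<or> side (Y i) \<and> Y (Suc i) = stau (Y i)" for i
  proof -
    have ne': "b (Suc i) \<noteq> c (Suc i)" "e (Suc i) \<noteq> b (Suc i)" "e (Suc i) \<noteq> c (Suc i)"
      using strip_determined[OF s(1,2) R] strip_determined[OF s(1,3) R] strip_determined[OF s(2,3) R] ne by metis+
    have at: "Y i \<in> set ats" "b i \<in> set ats" "c i \<in> set ats" "e i \<in> set ats" "Y (Suc i) \<in> set (nx (Y i))"
      using tl2_tile[OF strip_tl2[OF s(1), of i]] tl2_tile[OF strip_tl2[OF s(2), of i]]
        tl2_tile[OF strip_tl2[OF s(3), of i]] Y
      by (auto simp: slen_1[symmetric] aword_def intro!: in_nx)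
    note c1 = bspec[OF bspec[OF triple_check[unfolded list_all_iff] at(1)] at(2)]
    note c2 = bspec[OF c1[unfolded strip_tl2[OF s(1)] option.case prod.case] at(3)]
    have c3: "\<forall>u\<in>set ats. case tl2 (Y i) u of None \<Rightarrow> True | Some (u1, r) \<Rightarrow> u1 = b (Suc i) \<or> u1 = c (Suc i) \<or>
         (\<forall>z\<in>set (nx (Y i)). tl2 z (b (Suc i)) = None \<or> tl2 z (c (Suc i)) = None \<or> tl2 z u1 = None \<or> z = Y i
            \<or> side (Y i) \<and> z = stau (Y i))"
      using c2[unfolded strip_tl2[OF s(2)] option.case prod.case] ne'(1) by blast
    have "\<forall>z\<in>set (nx (Y i)). tl2 z (b (Suc i)) = None \<or> tl2 z (c (Suc i)) = None \<or> tl2 z (e (Suc i)) = None \<or> z = Y i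
            \<or> side (Y i) \<and> z = stau (Y i)"
      using bspec[OF c3 at(4), unfolded strip_tl2[OF s(3)] option.case prod.case] ne'(2,3) by blast
    from bspec[OF this at(5)] show ?thesis
      using strip_tl2[OF s(1), of "Suc i"] strip_tl2[OF s(2), of "Suc i"] strip_tl2[OF s(3), of "Suc i"] by simp
  qed
  show ?thesis
  proof (cases "\<exists>i. Y (Suc i) \<noteq> Y i")
    case True
    then obtain i where i: "side (Y i)" using st by blast
    have "side (stau y)" if "side y" for y using that by (auto simp: side_def stau_def)
    then have "side (Y j) \<Longrightarrow> side (Y (Suc j))" for j using st[of j] by metis
    then have "side (Y i) = side (Y j)" for j
      using periodic_bool_const[where P = "\<lambda>i. side (Y i)" and R = R] Y R by (simp add: aword_def)
    then show ?thesis using i st unfolding special_def by blast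
  next
    case False
    then show ?thesis using red_const[OF Y] by blast
  qed
qed

text \<open>Applies the rotation that takes the side letter \<open>y\<close> to \<open>A12\<close>,
  the last case being \<open>A14\<close>; tables are then needed for one letter only.\<close>

definition nrm :: "sim \<Rightarrow> sim \<Rightarrow> sim" where
  "nrm y s = (if y = A12 then s else if y = A23 then stau s else if y = A34 then stau (stau s) else stau (stau (stau s)))"

definition cmp :: "sim \<Rightarrow> sim \<Rightarrow> sim" where
  "cmp y s = (let t = nrm y s; c = (if t = A34 then A13 else if t = A13 then A14 else A34) in
     if y = A12 then c else if y = A23 then stau (stau (stau c)) else if y = A34 then stau (stau c) else stau c)"

text \<open>On a row of side letters changing only by the rotation, three consecutive strips are
  classified by a level that can only decrease along the row. On even levels the strip
  \<open>cmp\<close> accompanying the first one returns to the same row; on levels 1 and 5 the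
  first strip does; on level 3 the row is constant.\<close>

definition lev :: "sim \<Rightarrow> sim \<Rightarrow> sim \<Rightarrow> sim \<Rightarrow> nat" where
  "lev y s1 s2 s3 = (let t = (nrm y s1, nrm y s2, nrm y s3) in
    if t \<in> set [(A13, A14, A34), (A13, A24, A13), (A13, A24, A34), (A14, A34, A13), (A14, A34, A23),
      (A24, A13, A23), (A24, A13, A24), (A24, A24, A13), (A24, A24, A34), (A24, A34, A23),
      (A34, A13, A14), (A34, A13, A24)] then 0
    else if t \<in> set [(A13, A13, A14), (A13, A13, A24), (A14, A14, A34), (A14, A24, A13), (A14, A24, A34),
      (A34, A23, A12), (A34, A23, A23), (A34, A34, A13), (A34, A34, A23)] then 1
    else if t \<in> set [(A13, A14, A14), (A13, A14, A24), (A13, A24, A12), (A13, A24, A24), (A14, A34, A34),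
      (A24, A13, A13), (A24, A13, A14), (A24, A34, A13), (A24, A34, A34), (A34, A13, A13),
      (A34, A13, A23)] then 2
    else if t \<in> set [(A13, A23, A12), (A13, A23, A23), (A23, A12, A12), (A23, A12, A13), (A23, A12, A14),
      (A23, A23, A12), (A23, A23, A23)] then 3
    else if t \<in> set [(A24, A12, A12), (A24, A12, A14), (A24, A24, A12), (A24, A24, A24)] then 4 else 5)"

lemma lev_check:
  "list_all (\<lambda>y. list_all (\<lambda>s1. case tl2 y s1 of None \<Rightarrow> True | Some (t1, p1) \<Rightarrow>
     list_all (\<lambda>s2. case tl2 p1 s2 of None \<Rightarrow> True | Some (t2, p2) \<Rightarrow>
     list_all (\<lambda>s3. case tl2 p2 s3 of None \<Rightarrow> True | Some (t3, p3) \<Rightarrow>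
     list_all (\<lambda>z. case tl2 z t1 of None \<Rightarrow> True | Some (u1, q1) \<Rightarrow> case tl2 q1 t2 of None \<Rightarrow> True | Some (u2, q2) \<Rightarrow>
       case tl2 q2 t3 of None \<Rightarrow> True | Some (u3, q3) \<Rightarrow>
       (let n = lev y s1 s2 s3; m = lev z t1 t2 t3 in m \<le> n \<and> (m = n \<longrightarrow>
         (if n = 1 \<or> n = 5 then p1 = y else if n = 3 then z = y
          else tl2 y (cmp y s1) = Some (cmp z t1, y))))) [y, stau y]) (nx s2)) (nx s1)) ats) [A12, A14, A23, A34]"
  by code_simp

text \<open>The level is constant by periodicity, and each constant level shows one form of
  reducibility. Hence over an irreducible special row no nonbacktracking sequence has three
  strips.\<close>

lemma special_annulus_red:
  assumes A: "annulus R 3 a b" and S: "special (a 0)"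
  shows "red R (a 0)"
proof -
  note t = annulusD(1)[OF A]
  have R: "0 < R" using annulusD(8)[OF A] .
  define l where "l i = lev (a 0 i) (b 0 i) (b 1 i) (b 2 i)" for i
  have sd: "a 0 i \<in> set [A12, A14, A23, A34]" for i using S by (auto simp: special_def side_def)
  have st: "l (Suc i) \<le> l i \<and> (l (Suc i) = l i \<longrightarrow> (if l i = 1 \<or> l i = 5 then a 1 i = a 0 i
      else if l i = 3 then a 0 (Suc i) = a 0 i
      else tl2 (a 0 i) (cmp (a 0 i) (b 0 i)) = Some (cmp (a 0 (Suc i)) (b 0 (Suc i)), a 0 i)))" for i
  proof -
    have t0: "tl2 (a 0 j) (b 0 j) = Some (b 0 (Suc j), a 1 j)" "tl2 (a 1 j) (b 1 j) = Some (b 1 (Suc j), a 2 j)"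
      "tl2 (a 2 j) (b 2 j) = Some (b 2 (Suc j), a 3 j)" for j
      using t[of 0 j] t[of 1 j] t[of 2 j] by (simp_all add: eval_nat_numeral)
    have b0: "b 0 i \<in> set ats" "b 1 i \<in> set (nx (b 0 i))" "b 2 i \<in> set (nx (b 1 i))"
      using annulusD(4)[OF A, of 0 i] annulusD(4)[OF A, of 1 i] annulusD(4)[OF A, of 2 i]
        annulusD(2)[OF A, of 0 i] annulusD(2)[OF A, of 1 i]
      by (auto simp: slen_1[symmetric] eval_nat_numeral intro!: in_nx)
    have z: "a 0 (Suc i) \<in> set [a 0 i, stau (a 0 i)]" using S by (simp add: special_def)
    note c1 = bspec[OF bspec[OF lev_check[unfolded list_all_iff] sd[of i]] b0(1)]
    note c2 = bspec[OF c1[unfolded t0 option.case prod.case] b0(2)]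
    note c3 = bspec[OF c2[unfolded t0 option.case prod.case] b0(3)]
    note c4 = bspec[OF c3[unfolded t0 option.case prod.case] z]
    show ?thesis using c4[unfolded t0 option.case prod.case Let_def] unfolding l_def .
  qed
  have per: "l (i + R) = l i" for i
    using annulusD(6)[OF A, of 0 i] annulusD(6)[OF A, of 1 i] annulusD(6)[OF A, of 2 i] annulusD(7)[OF A, of 0 i]
    by (simp add: l_def)
  have "(\<lambda>i. - int (l i)) i = (\<lambda>i. - int (l i)) 0" for i
    by (rule periodic_mono_const[where R = R]) (use st per R in auto)
  then have c: "l i = l 0" for i by simp
  have aw: "aword R (a 0)" using A by (simp add: annulus_def)
  show ?thesis
  proof (cases "l 0 = 1 \<or> l 0 = 5")
    case True
    then have "a 1 i = a 0 i" for i using st[of i] c[of i] c[of "Suc i"] by (auto split: if_splits)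
    then have "a 1 = a 0" by blast
    moreover have "strip R (a 0) (b 0) (a (Suc 0))" using A unfolding annulus_def by simp
    ultimately have "strip R (a 0) (b 0) (a 0)" by simp
    then show ?thesis unfolding red_def by blast
  next
    case n15: False
    show ?thesis
    proof (cases "l 0 = 3")
      case True
      then have "a 0 (Suc i) = a 0 i" for i using st[of i] c[of i] c[of "Suc i"] by (auto split: if_splits)
      then show ?thesis using red_const[OF aw] by blast
    next
      case False
      then have "tl2 (a 0 i) (cmp (a 0 i) (b 0 i)) = Some (cmp (a 0 (Suc i)) (b 0 (Suc i)), a 0 i)" for i
        using st[of i] c[of i] c[of "Suc i"] n15 by (auto split: if_splits)
      then have "strip R (a 0) (\<lambda>i. cmp (a 0 i) (b 0 i)) (a 0)"
        using annulusD(6)[OF A, of 0] annulusD(7)[OF A, of 0] by (simp add: strip_def)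
      then show ?thesis unfolding red_def by blast
    qed
  qed
qed

definition shf :: "int \<Rightarrow> nat \<Rightarrow> (nat \<Rightarrow> sim) \<Rightarrow> nat \<Rightarrow> sim" where
  "shf m n Y i = taup m (Y (i + n))"

lemma shf_shf: "shf m n (shf m' n' Y) = shf (m + m') (n + n') Y"
  by (rule ext) (simp add: shf_def taup_add add.assoc add.left_commute)

lemma shf_0: "shf 0 0 Y = Y"
  by (rule ext) (simp add: shf_def taup_0)

lemma shf_period: "\<forall>i. Y (i + R) = Y i \<Longrightarrow> shf m (n * R) Y = shf m 0 Y"
  by (rule ext) (simp add: shf_def periodic_mult)

definition cls :: "(nat \<Rightarrow> sim) \<Rightarrow> (nat \<Rightarrow> sim) set" where
  "cls Y = {shf m n Y | m n. True}"

lemma cls_self: "Y \<in> cls Y"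
  unfolding cls_def using shf_0[of Y] by (metis (mono_tags, lifting) mem_Collect_eq)

lemma shf_cls: "Z \<in> cls Y \<Longrightarrow> shf m n Z \<in> cls Y"
  unfolding cls_def using shf_shf by blast

text \<open>Shifts are natural numbers; \<open>n * R - n\<close> differs from -n by a multiple of
  the period.\<close>

lemma cls_sym:
  assumes "\<forall>i. Y (i + R) = Y i" "0 < R"
  shows "shf (- m) (n * R - n) (shf m n Y) = Y"
proof -
  have "n * R - n + n = n * R" using assms(2) by (cases R) auto
  then show ?thesis by (simp only: shf_shf shf_period[OF assms(1)]) (simp add: shf_0)
qed

lemma card_cls:
  assumes "\<forall>i. Y (i + R) = Y i" "0 < R"
  shows "finite (cls Y)" "card (cls Y) \<le> 4 * R"
proof -
  have "cls Y \<subseteq> (\<lambda>(m, n). shf m n Y) ` ({0..<4} \<times> {0..<R})"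
  proof
    fix Z assume "Z \<in> cls Y"
    then obtain m n where Z: "Z = shf m n Y" by (auto simp: cls_def)
    have "Y (i + n mod R) = Y (i + n)" for i
      using periodic_mod[OF assms(1), of "i + n mod R"] periodic_mod[OF assms(1), of "i + n"]
      by (simp add: mod_add_right_eq)
    moreover have "taup (m mod 4) s = taup m s" for s by (simp add: taup_def)
    ultimately have "Z = shf (m mod 4) (n mod R) Y" unfolding Z by (intro ext) (simp add: shf_def)
    then show "Z \<in> (\<lambda>(m, n). shf m n Y) ` ({0..<4} \<times> {0..<R})"
      using assms(2) by (auto intro!: image_eqI[of _ _ "(m mod 4, n mod R)"])
  qed
  note sub = this
  have f: "finite ({0..<4::int} \<times> {0..<R})" by simp
  show "finite (cls Y)" by (rule finite_subset[OF sub finite_imageI[OF f]])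
  have "card (cls Y) \<le> card ({0..<4::int} \<times> {0..<R})"
    by (rule order_trans[OF card_mono[OF finite_imageI[OF f] sub] card_image_le[OF f]])
  then show "card (cls Y) \<le> 4 * R" by simp
qed

lemma tl2_taup: "tl2 (taup m y) (taup m s) = map_option (map_prod (taup m) (taup m)) (tl2 y s)"
proof -
  have "tl2 ((stau ^^ n) y) ((stau ^^ n) s) = map_option (map_prod (stau ^^ n) (stau ^^ n)) (tl2 y s)" for n
  proof (induction n)
    case 0
    show ?case by (cases "tl2 y s") auto
  next
    case (Suc n)
    then show ?case by (cases "tl2 y s") (auto simp: tl2_stau)
  qed
  moreover have "taup m = stau ^^ nat (m mod 4)" by (rule ext) (simp add: taup_def)
  ultimately show ?thesis by simp
qed

lemma strip_shf: "strip R Y b Z \<Longrightarrow> strip R (shf m n Y) (shf m n b) (shf m n Z)"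
  by (simp add: strip_def shf_def tl2_taup add.assoc add.commute[of R]) (simp add: add.assoc[symmetric])

lemma aword_shf: "aword R Y \<Longrightarrow> aword R (shf m n Y)"
  by (simp add: aword_def shf_def lw_taup slen_taup add.assoc add.commute[of R]) (simp add: add.assoc[symmetric])

definition wstep :: "nat \<Rightarrow> (nat \<Rightarrow> sim) \<Rightarrow> (nat \<Rightarrow> sim) \<Rightarrow> bool" where
  "wstep R Y Z \<longleftrightarrow> Z \<in> cls Y \<or> (\<exists>b. strip R Y b Z)"

lemma wstep_aword: "(wstep R)\<^sup>*\<^sup>* Y Z \<Longrightarrow> aword R Y \<Longrightarrow> aword R Z"
  by (induction rule: rtranclp_induct) (auto simp: wstep_def cls_def aword_shf strip_aword)

text \<open>The reverse of a strip returns to the original word up to \<tau> and a rotation, and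
  steps within a class undo these.\<close>

lemma wstep_sym:
  assumes "(wstep R)\<^sup>*\<^sup>* Y Z" "aword R Y"
  shows "(wstep R)\<^sup>*\<^sup>* Z Y"
  using assms
proof (induction rule: rtranclp_induct)
  case (step W Z)
  have W: "aword R W" using wstep_aword[OF step(1,4)] .
  then have R: "\<forall>i. W (i + R) = W i" "0 < R" by (simp_all add: aword_def)
  have "(wstep R)\<^sup>*\<^sup>* Z W"
  proof (cases "Z \<in> cls W")
    case True
    then obtain m n where "Z = shf m n W" by (auto simp: cls_def)
    then have "W \<in> cls Z" using cls_sym[OF R, of m n] shf_cls[OF cls_self[of Z]] by metis
    then have "wstep R Z W" by (simp add: wstep_def)
    then show ?thesis by (meson rtranclp.rtrancl_into_rtrancl rtranclp.rtrancl_refl)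
  next
    case False
    then obtain b where b: "strip R W b Z" using step(2) by (auto simp: wstep_def)
    have "(\<lambda>i. stau (W (i + (R - 1)))) = shf 1 (R - 1) W" by (rule ext) (simp add: shf_def taup_1)
    then have "wstep R Z (shf 1 (R - 1) W)" using strip_back[OF W b] by (auto simp: wstep_def)
    moreover have "shf (- 1) 1 (shf 1 (R - 1) W) = W"
      using shf_period[OF R(1), of 0 1] R(2) by (simp add: shf_shf shf_0)
    then have "wstep R (shf 1 (R - 1) W) W" unfolding wstep_def cls_def by (metis (mono_tags, lifting) mem_Collect_eq)
    ultimately show ?thesis by (meson rtranclp.rtrancl_into_rtrancl rtranclp.rtrancl_refl)
  qed
  then show ?case using step by (meson rtranclp_trans)
qed simp

text \<open>The last strips of nonbacktracking sequences starting at \<open>Y\<close>. Words alone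
  would not suffice, since the vertical edges decide what backtracking means.\<close>

fun layer :: "nat \<Rightarrow> (nat \<Rightarrow> sim) \<Rightarrow> nat \<Rightarrow> ((nat \<Rightarrow> sim) \<times> (nat \<Rightarrow> sim) \<times> (nat \<Rightarrow> sim)) set" where
  "layer R Y 0 = {(Y, b, Z) | b Z. strip R Y b Z}"
| "layer R Y (Suc n) = (\<Union>(X, b, Z) \<in> layer R Y n. {(Z, c, W) | c W. strip R Z c W \<and> (\<forall>i. lw (b i) (c i))})"

lemma layer_strip: "(X, b, Z) \<in> layer R Y n \<Longrightarrow> strip R X b Z"
  by (cases n) auto

lemma layer_annulus:
  assumes "aword R Y" "(X, b, Z) \<in> layer R Y n"
  shows "\<exists>a \<beta>. annulus R (Suc n) a \<beta> \<and> a 0 = Y \<and> a n = X \<and> \<beta> n = b \<and> a (Suc n) = Z"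
  using assms(2)
proof (induction n arbitrary: X b Z)
  case 0
  then have "strip R Y b Z" "X = Y" by auto
  then have "annulus R (Suc 0) (\<lambda>j. if j = 0 then Y else Z) (\<lambda>j. b)"
    using assms(1) strip_aword by (auto simp: annulus_def)
  with \<open>X = Y\<close> show ?case by (intro exI[of _ "\<lambda>j. if j = 0 then Y else Z"] exI[of _ "\<lambda>j. b"]) simp
next
  case (Suc n)
  then obtain V c where V: "(V, c, X) \<in> layer R Y n" "strip R X b Z" "\<forall>i. lw (c i) (b i)" by auto
  from Suc.IH[OF V(1)] obtain a \<beta> where A: "annulus R (Suc n) a \<beta>" "a 0 = Y" "a n = V" "\<beta> n = c" "a (Suc n) = X"
    by blast
  have aX: "aword R X" using A(1,5) by (auto simp: annulus_def)
  let ?a = "a(Suc (Suc n) := Z)" and ?b = "\<beta>(Suc n := b)"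
  have "annulus R (Suc (Suc n)) ?a ?b"
    unfolding annulus_def
  proof (intro conjI allI impI)
    fix j assume "j \<le> Suc (Suc n)"
    then show "aword R (?a j)"
      using A(1) strip_aword[OF aX V(2)] by (cases "j = Suc (Suc n)") (auto simp: annulus_def)
  next
    fix j assume "j < Suc (Suc n)"
    then show "strip R (?a j) (?b j) (?a (Suc j))"
      using A V(2) by (cases "j = Suc n") (auto simp: annulus_def)
  next
    fix j i assume "Suc j < Suc (Suc n)"
    then show "lw (?b j i) (?b (Suc j) i)"
      using A V(3) by (cases "j = n") (auto simp: annulus_def)
  qed
  moreover have "?a 0 = Y" "?a (Suc n) = X" "?b (Suc n) = b" "?a (Suc (Suc n)) = Z" using A by simp_all
  ultimately show ?case by blast
qed

lemma annulus_reach: "annulus R k a b \<Longrightarrow> j \<le> k \<Longrightarrow> (wstep R)\<^sup>*\<^sup>* (a 0) (a j)"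
proof (induction j)
  case (Suc j)
  then have "strip R (a j) (b j) (a (Suc j))" by (simp add: annulus_def)
  then have "wstep R (a j) (a (Suc j))" unfolding wstep_def by blast
  with Suc show ?case by (meson Suc_leD rtranclp.rtrancl_into_rtrancl)
qed simp

lemma card_strips:
  assumes "0 < R" "\<And>b Z. P b Z \<Longrightarrow> strip R Y b Z"
  shows "finite {(Y, b, Z) | b Z. P b Z}" "card {(Y, b, Z) | b Z. P b Z} \<le> 6"
proof -
  let ?S = "{(Y, b, Z) | b Z. P b Z}" and ?f = "\<lambda>(Y :: nat \<Rightarrow> sim, b :: nat \<Rightarrow> sim, Z :: nat \<Rightarrow> sim). b 0"
  have i: "inj_on ?f ?S"
  proof (rule inj_onI)
    fix u v assume "u \<in> ?S" "v \<in> ?S" and e: "?f u = ?f v"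
    then obtain b Z c W where u: "u = (Y, b, Z)" "P b Z" and v: "v = (Y, c, W)" "P c W" by blast
    from strip_determined[OF assms(2)[OF u(2)] assms(2)[OF v(2)] assms(1), of 0] e
    show "u = v" by (simp add: u(1) v(1))
  qed
  have s: "?f ` ?S \<subseteq> set ats"
  proof
    fix u assume "u \<in> ?f ` ?S"
    then obtain b Z where "u = b 0" "P b Z" by auto
    then show "u \<in> set ats" using tl2_tile(2)[OF strip_tl2[OF assms(2)]] by (simp only: slen_1[symmetric])
  qed
  show "finite ?S" using finite_imageD[OF finite_subset[OF s] i] by simp
  have "card ?S = card (?f ` ?S)" using card_image[OF i] by simp
  also have "\<dots> \<le> card (set ats)" using s by (intro card_mono) auto
  also have "\<dots> = 6" by (simp add: ats_def)
  finally show "card ?S \<le> 6" .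
qed

text \<open>The bound counts the start and at most \<open>R + 8\<close> layers of at most 36 strips,
  each end word standing for a class of at most 4R words. There are at most six strips along a word,
  one for each atom as first edge; 36 covers two free choices at a special start, and otherwise only
  the first choice is free.\<close>

theorem card_reach:
  assumes Y: "aword R Y" and nored: "\<And>Z. (wstep R)\<^sup>*\<^sup>* Y Z \<Longrightarrow> \<not> red R Z"
  shows "finite {Z. (wstep R)\<^sup>*\<^sup>* Y Z}" "card {Z. (wstep R)\<^sup>*\<^sup>* Y Z} \<le> (1 + (R + 8) * 36) * (4 * R)"
proof -
  have R: "0 < R" using Y by (simp add: aword_def)
  define Q where "Q = (\<exists>Z. (wstep R)\<^sup>*\<^sup>* Y Z \<and> special Z)"
  \<comment> \<open>The start is moved to a special word if one can be reached; then there are only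
    two layers. If there is none, no reachable row carries three strips.\<close>
  obtain X where X: "(wstep R)\<^sup>*\<^sup>* Y X" "Q \<longrightarrow> special X" unfolding Q_def by blast
  have aX: "aword R X" using wstep_aword[OF X(1) Y] .
  have nr: "\<not> red R Z" if "(wstep R)\<^sup>*\<^sup>* X Z" for Z using nored X(1) that by (meson rtranclp_trans)
  have nsp: "\<not> special Z" if "\<not> Q" "(wstep R)\<^sup>*\<^sup>* X Z" for Z
    using that X(1) unfolding Q_def by (meson rtranclp_trans)
  have sub: "{Z. (wstep R)\<^sup>*\<^sup>* Y Z} \<subseteq> {Z. (wstep R)\<^sup>*\<^sup>* X Z}"
    using wstep_sym[OF X(1) Y] by (auto intro: rtranclp_trans)
  have empty: "layer R X n = {}" if "R + 8 \<le> Suc n" for n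
  proof (rule ccontr)
    assume "layer R X n \<noteq> {}"
    then obtain V b Z where "(V, b, Z) \<in> layer R X n" by (metis ex_in_conv prod_cases3)
    from layer_annulus[OF aX this] obtain a \<beta> where A: "annulus R (Suc n) a \<beta>" "a 0 = X" by blast
    from annulus_red[OF A(1) that] obtain j where "j \<le> Suc n" "red R (a j)" by blast
    then show False using nr annulus_reach[OF A(1)] A(2) by metis
  qed
  have emptyQ: "layer R X n = {}" if "Q" "2 \<le> n" for n
  proof (rule ccontr)
    assume "layer R X n \<noteq> {}"
    then obtain V b Z where "(V, b, Z) \<in> layer R X n" by (metis ex_in_conv prod_cases3)
    from layer_annulus[OF aX this] obtain a \<beta> where A: "annulus R (Suc n) a \<beta>" "a 0 = X" by blast
    have "annulus R 3 a \<beta>" using A(1) that(2) by (auto simp: annulus_def)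
    then show False using special_annulus_red X(2) that(1) A(2) nr by blast
  qed
  have mem: "aword R V \<and> aword R Z \<and> (wstep R)\<^sup>*\<^sup>* X Z" if "(V, b, Z) \<in> layer R X n" for V b Z n
  proof -
    from layer_annulus[OF aX that] obtain a \<beta> where A: "annulus R (Suc n) a \<beta>" "a 0 = X" "a n = V" "a (Suc n) = Z" by blast
    then show ?thesis using annulus_reach[OF A(1), of "Suc n"] by (auto simp: annulus_def)
  qed
  define ext where "ext = (\<lambda>(V :: nat \<Rightarrow> sim, b, Z). {(Z, c, W) | c W. strip R Z c W \<and> (\<forall>i. lw (b i) (c i))})"
  have Suc_layer: "layer R X (Suc n) = (\<Union>v \<in> layer R X n. ext v)" for n
    by (auto simp: ext_def)
  have ext6: "finite (ext v)" "card (ext v) \<le> 6" for v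
    using card_strips[OF R, of "\<lambda>c W. strip R (snd (snd v)) c W \<and> (\<forall>i. lw (fst (snd v) i) (c i))" "snd (snd v)"]
    by (simp_all add: ext_def case_prod_beta)
  have ext1: "card (ext v) \<le> 1" if v: "v \<in> layer R X n" and "\<not> Q" for v n
  proof -
    obtain V b Z where vv: "v = (V, b, Z)" by (cases v)
    note m = mem[OF v[unfolded vv]] and s = layer_strip[OF v[unfolded vv]]
    have uniq: "c = c' \<and> W = W'" if c: "strip R Z c W" "\<forall>i. lw (b i) (c i)" "strip R Z c' W'" "\<forall>i. lw (b i) (c' i)" for c W c' W'
    proof (rule ccontr)
      assume "\<not> ?thesis"
      then have "c \<noteq> c'" using strip_determined[OF c(1,3) R] by blast
      \<comment> \<open>The reverse strip is never a continuation, so two continuations together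
        with it would be three strips along \<open>Z\<close>.\<close>
      have "\<not> lw (b 0) (bk R V b 0)"
      proof -
        have V: "tl2 (V (R - 1)) (b (R - 1)) = Some (b R, Z (R - 1))"
          using strip_tl2[OF s, of "R - 1"] R by simp
        have "\<not> lw s' (cc1 y s')" if "tl2 y s = Some (s', y')" for y s s' y'
          using that by (cases y; cases s) (auto simp: tl2_def cc1_def lw_def smul_def sdual_def smeet_def)
        from this[OF V] show ?thesis using s R unfolding bk_def strip_def by (metis add_0)
      qed
      then have "c \<noteq> bk R V b" "c' \<noteq> bk R V b" using c by blast+
      from three_strips[OF _ c(1,3) strip_back[OF _ s] \<open>c \<noteq> c'\<close> this] show False
        using m nr nsp \<open>\<not> Q\<close> by blast
    qed
    have "x = y" if "x \<in> ext v" "y \<in> ext v" for x y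
      using that uniq by (auto simp: ext_def vv)
    then show ?thesis using card_le_Suc0_iff_eq[OF ext6(1)[of v]] by simp
  qed
  have fin: "finite (layer R X n)" for n
  proof (induction n)
    case 0
    show ?case using card_strips(1)[OF R, of "strip R X" X] by simp
  next
    case (Suc n)
    then show ?case unfolding Suc_layer using ext6(1) by blast
  qed
  have l0: "card (layer R X 0) \<le> 6" using card_strips(2)[OF R, of "strip R X" X] by simp
  have lSuc: "card (layer R X (Suc n)) \<le> card (layer R X n) * k" if "\<And>v. v \<in> layer R X n \<Longrightarrow> card (ext v) \<le> k" for n k
  proof -
    have "card (layer R X (Suc n)) \<le> (\<Sum>v \<in> layer R X n. card (ext v))"
      unfolding Suc_layer by (rule card_UN_le[OF fin])
    also have "\<dots> \<le> card (layer R X n) * k" using sum_bounded_above[of "layer R X n" "\<lambda>v. card (ext v)" k] that by simp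
    finally show ?thesis .
  qed
  have l36: "card (layer R X n) \<le> 36" for n
  proof (cases Q)
    case True
    consider "n = 0" | "n = 1" | "2 \<le> n" by linarith
    then show ?thesis
    proof cases
      case 2
      then show ?thesis using lSuc[of 0 6] ext6(2) l0 by simp
    qed (use l0 emptyQ[OF True] in auto)
  next
    case False
    have "card (layer R X n) \<le> 6"
    proof (induction n)
      case (Suc n)
      then show ?case using lSuc[of n 1] ext1[OF _ False] by force
    qed (use l0 in simp)
    then show ?thesis by simp
  qed
  define T where "T = insert X (\<Union>n<R + 8. (\<lambda>v. snd (snd v)) ` layer R X n)"
  have fT: "finite T" unfolding T_def using fin by simp
  have cT: "card T \<le> 1 + (R + 8) * 36"
  proof -
    have "card (\<Union>n<R + 8. (\<lambda>v. snd (snd v)) ` layer R X n) \<le> (\<Sum>n<R + 8. card ((\<lambda>v. snd (snd v)) ` layer R X n))"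
      by (rule card_UN_le) simp
    also have "\<dots> \<le> (R + 8) * 36"
      using sum_bounded_above[of "{..<R + 8}" "\<lambda>n. card ((\<lambda>v. snd (snd v)) ` layer R X n)" 36]
        le_trans[OF card_image_le[OF fin] l36, of "\<lambda>v. snd (snd v)"] by (simp add: algebra_simps)
    finally show ?thesis unfolding T_def using card_insert_le_m1 by (simp add: card_insert_if fin)
  qed
  have aT: "aword R Z" if "Z \<in> T" for Z using that aX mem unfolding T_def by force
  \<comment> \<open>A strip leaving a class is shifted to the representative in \<open>T\<close>.
    There it backtracks to the preceding word, again in \<open>T\<close>, or prolongs a
    nonbacktracking sequence, whose end lies in \<open>T\<close> since the layers stop in
    time.\<close>
  have clo: "W \<in> (\<Union>Z \<in> T. cls Z)" if W: "(wstep R)\<^sup>*\<^sup>* X W" for W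
    using W
  proof (induction rule: rtranclp_induct)
    case base
    show ?case unfolding T_def using cls_self by blast
  next
    case (step W W')
    then obtain Z where Z: "Z \<in> T" "W \<in> cls Z" by blast
    show ?case
    proof (cases "W' \<in> cls W")
      case True
      then show ?thesis using Z shf_cls unfolding cls_def[of W] by blast
    next
      case False
      then obtain c where c: "strip R W c W'" using step(2) by (auto simp: wstep_def)
      obtain m n where mn: "W = shf m n Z" using Z by (auto simp: cls_def)
      have pZ: "\<forall>i. Z (i + R) = Z i" using aT[OF Z(1)] by (simp add: aword_def)
      let ?g = "shf (- m) (n * R - n)"
      have sZ: "strip R Z (?g c) (?g W')" using strip_shf[OF c, of "- m" "n * R - n"] cls_sym[OF pZ R] mn by simp
      have "aword R W'" using strip_aword[OF _ c] wstep_aword[OF step(1) aX] by blast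
      then have pW': "\<forall>i. W' (i + R) = W' i" by (simp add: aword_def)
      have "shf m n (?g W') = W'"
        using cls_sym[OF pW' R, of m n] by (simp add: shf_shf add.commute)
      have "\<exists>U \<in> T. ?g W' \<in> cls U"
      proof (cases "Z = X")
        case True
        then have "(X, ?g c, ?g W') \<in> layer R X 0" using sZ by simp
        then have "?g W' \<in> T" unfolding T_def using R by force
        then show ?thesis using cls_self by blast
      next
        case False
        then obtain k v where k: "k < R + 8" "v \<in> layer R X k" "Z = snd (snd v)" using Z(1) unfolding T_def by blast
        then obtain V b where v: "(V, b, Z) \<in> layer R X k" by (metis prod.collapse)
        note s = layer_strip[OF v] and m = mem[OF v]
        show ?thesis
        proof (cases "?g c = bk R V b")
          case True
          have "?g W' = (\<lambda>i. stau (V (i + (R - 1))))"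
            using strip_determined[OF sZ strip_back[OF _ s] R, of 0] m True by simp
          also have "\<dots> = shf 1 (R - 1) V" by (rule ext) (simp add: shf_def taup_1)
          finally have "?g W' \<in> cls V" using cls_self shf_cls by metis
          moreover have "V \<in> T"
          proof (cases k)
            case 0
            then show ?thesis using v unfolding T_def by simp
          next
            case (Suc k')
            then obtain U e where "(U, e, V) \<in> layer R X k'" using v by auto
            then show ?thesis using k(1) Suc unfolding T_def by force
          qed
          ultimately show ?thesis by blast
        next
          case False
          have "\<forall>i. lw (b i) (?g c i)" using strip_extend[OF _ s sZ False] m by blast
          then have l: "(Z, ?g c, ?g W') \<in> layer R X (Suc k)" using v sZ by (auto intro!: bexI[of _ "(V, b, Z)"])
          then have "Suc k < R + 8" using empty[of "Suc k"] by (metis empty_iff le_SucI not_le)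
          then have "?g W' \<in> T" unfolding T_def using imageI[OF l, of "\<lambda>v. snd (snd v)"] by (simp only: snd_conv) blast
          then show ?thesis using cls_self by blast
        qed
      qed
      then obtain U where U: "U \<in> T" "?g W' \<in> cls U" by blast
      have "W' \<in> cls U" using shf_cls[OF U(2), of m n] unfolding \<open>shf m n (?g W') = W'\<close> .
      then show ?thesis using U(1) by blast
    qed
  qed
  then have sub2: "{Z. (wstep R)\<^sup>*\<^sup>* Y Z} \<subseteq> (\<Union>Z \<in> T. cls Z)" using sub by blast
  have fc: "finite (cls Z)" "card (cls Z) \<le> 4 * R" if "Z \<in> T" for Z
    using card_cls[of Z R] aT[OF that] by (simp_all add: aword_def)
  have fu: "finite (\<Union>Z \<in> T. cls Z)" using fT fc by blast
  show "finite {Z. (wstep R)\<^sup>*\<^sup>* Y Z}" using finite_subset[OF sub2 fu] .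
  have "card {Z. (wstep R)\<^sup>*\<^sup>* Y Z} \<le> card (\<Union>Z \<in> T. cls Z)" by (rule card_mono[OF fu sub2])
  also have "\<dots> \<le> (\<Sum>Z \<in> T. card (cls Z))" by (rule card_UN_le[OF fT])
  also have "\<dots> \<le> card T * (4 * R)" using sum_bounded_above[of T "\<lambda>Z. card (cls Z)" "4 * R"] fc by simp
  also have "\<dots> \<le> (1 + (R + 8) * 36) * (4 * R)" using cT by (rule mult_right_mono) simp
  finally show "card {Z. (wstep R)\<^sup>*\<^sup>* Y Z} \<le> (1 + (R + 8) * 36) * (4 * R)" .
qed

section \<open>Conjugations by simple elements as steps between words\<close>

lemma tl2_check:
  "list_all (\<lambda>y. list_all (\<lambda>s. y = s \<or> list_all (\<lambda>t. list_all (\<lambda>z.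
     snorm y t = snorm s z \<longrightarrow> tl2 y s = Some (t, z)) ats) ats) ats) ats"
  by code_simp

lemma tl2_snorm:
  "slen y = 1 \<Longrightarrow> slen s = 1 \<Longrightarrow> slen t = 1 \<Longrightarrow> slen z = 1 \<Longrightarrow> y \<noteq> s \<Longrightarrow> snorm y t = snorm s z \<Longrightarrow> tl2 y s = Some (t, z)"
  using tl2_check unfolding list_all_iff slen_1 by blast

lemma ladder_strip:
  assumes "ladder R a \<sigma> b" "\<And>i. slen (a i) = 1" "\<And>i. slen (b i) = 1" "\<And>i. slen (\<sigma> i) = 1" "\<And>i. a i \<noteq> \<sigma> i"
  shows "strip R a \<sigma> b"
  using assms by (auto simp: strip_def ladder_def intro!: tl2_snorm)

lemma cword_aword: "cword R a \<Longrightarrow> (\<And>i. slen (a i) = 1) \<Longrightarrow> aword R a"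
  by (simp add: cword_def aword_def)

lemma proper_slen: "proper s \<longleftrightarrow> slen s = 1 \<or> slen s = 2"
proof -
  have "slen s \<le> 3" "slen s = 0 \<longleftrightarrow> s = E0" "slen s = 3 \<longleftrightarrow> s = DL" by (simp_all add: unary_tables)
  then show ?thesis unfolding proper_def by linarith
qed

lemma aword_cword: "aword R a \<Longrightarrow> cword R a"
  by (simp add: cword_def aword_def proper_slen)

lemma bw_taup: "bw n a \<cdot> dpow m = dpow m \<cdot> bw n (\<lambda>i. taup m (a i))"
  using bprod_dpow[of "map a [0..<n]" m] by (simp add: bw_def comp_def)

lemma bw_shf:
  assumes "cword R a"
  shows "bconj (bw R a) (bw n a \<cdot> dpow m) = bw R (shf m n a)"
proof -
  have "bconj (bw R a) (bw n a \<cdot> dpow m) = bconj (bw R (\<lambda>i. a (i + n))) (dpow m)"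
    using bw_shift[OF assms] by (simp add: bconj_bconj[symmetric])
  also have "\<dots> = bw R (\<lambda>i. taup m (a (i + n)))" by (simp add: bconj_eq bw_taup)
  finally show ?thesis by (simp add: shf_def[abs_def])
qed

lemma cword_shf: "cword R a \<Longrightarrow> cword R (shf m n a)"
proof -
  have "proper (taup m y) \<longleftrightarrow> proper y" for y by (simp add: proper_slen slen_taup)
  then show "cword R a \<Longrightarrow> cword R (shf m n a)"
    by (simp add: cword_def shf_def lw_taup add.assoc add.commute[of R]) (simp add: add.assoc[symmetric])
qed

text \<open>A conjugation by a proper simple element gives a ladder, and its types match the
  alternatives; only for words of atoms do the rungs need a further distinction by length.\<close>

lemma conj_word:
  assumes a: "cword R a" and b: "cword R b" and ab: "bconj (bw R a) (br s) = bw R b"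
  shows "b \<in> cls a \<or> (\<forall>i. slen (a i) = 1) \<and> (wstep R)\<^sup>*\<^sup>* a b \<or> (\<forall>i. slen (a i) = 2)"
proof -
  have R: "0 < R" and pa: "\<forall>i. a (i + R) = a i" and pb: "\<forall>i. b (i + R) = b i"
    using a b by (simp_all add: cword_def)
  have cyc: "b \<in> cls a" if "\<And>i. b i = a (Suc i)"
  proof -
    have "b = shf 0 1 a" by (rule ext) (simp add: shf_def that taup_0)
    then show ?thesis using shf_cls[OF cls_self] by simp
  qed
  have dec: "b \<in> cls a" if "\<And>i. b (Suc i) = stau (a i)"
  proof -
    have "b i = shf 1 (R - 1) a i" for i
    proof -
      have "Suc (i + (R - 1)) = i + R" using R by simp
      then show ?thesis using that[of "i + (R - 1)"] pb by (simp only: shf_def taup_1)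
    qed
    then have "b = shf 1 (R - 1) a" ..
    then show ?thesis using shf_cls[OF cls_self] by simp
  qed
  show ?thesis
  proof (cases "proper s")
    case False
    then consider "s = E0" | "s = DL" by (auto simp: proper_def)
    then show ?thesis
    proof cases
      case 1
      then have "bw R a = bw R b" using ab by (simp add: br_simps bconj_bone)
      then show ?thesis using bw_inj[OF a b] cls_self by blast
    next
      case 2
      then have "bw R b = bconj (bw R a) (bw 0 a \<cdot> dpow 1)" using ab by (simp add: br_simps bw_0 dpow_1 gsimps)
      then have "b = shf 1 0 a" using bw_inj[OF b cword_shf[OF a]] bw_shf[OF a] by simp
      then show ?thesis using shf_cls[OF cls_self] by simp
    qed
  next
    case True
    obtain \<sigma> where l: "ladder R a \<sigma> b" using ladder_exists[OF a b True ab] by blast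
    from a b l show ?thesis
    proof (cases rule: ladder_cases)
      case cycling
      then show ?thesis using cyc by blast
    next
      case decycling
      then show ?thesis using dec by blast
    next
      case coatoms
      then show ?thesis by blast
    next
      case atoms
      have sc: "slen (\<sigma> i) = slen (\<sigma> 0)" for i by (induction i) (use atoms in auto)
      have a1: "slen (a i) = 1" and b1: "slen (b i) = 1" for i using atoms by blast+
      have "proper (\<sigma> 0)" using l by (simp add: ladder_def)
      then consider "slen (\<sigma> 0) = 1" | "slen (\<sigma> 0) = 2" by (auto simp: proper_slen)
      then show ?thesis
      proof cases
        case 1
        then have "strip R a \<sigma> b" using ladder_strip[OF l a1 b1] sc atoms by metis
        then have "wstep R a b" unfolding wstep_def by blast
        then show ?thesis using a1 by blast
      next
        case 2
        \<comment> \<open>Complements of rungs of length two are atoms and carry \<open>b\<close> to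
          \<tau>(a). The conjugation is thus a strip traversed backwards, up to \<tau>.\<close>
        define c where "c i = sdual (\<sigma> i)" for i
        let ?a = "\<lambda>i. stau (a i)"
        have c1: "slen (c i) = 1" for i using unary_tables(5)[of "\<sigma> i"] 2 sc[of i] by (simp add: c_def unary_tables)
        have sl: "slen s + slen (sdual s) = 3" for s by (simp add: unary_tables)
        have tile: "br (b i) \<cdot> br (c (Suc i)) = br (c i) \<cdot> br (stau (a i))" for i
        proof -
          have t: "br (a i) \<cdot> br (\<sigma> (Suc i)) = br (\<sigma> i) \<cdot> br (b i)" using l by (simp add: snorm_tile ladder_def)
          have "br (\<sigma> i) \<cdot> (br (b i) \<cdot> br (c (Suc i))) = br (a i) \<cdot> (br (\<sigma> (Suc i)) \<cdot> br (c (Suc i)))"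
            using t by (metis bmult_assoc)
          also have "\<dots> = br (a i) \<cdot> delta" by (simp add: c_def br_sdual)
          also have "\<dots> = br (\<sigma> i) \<cdot> (br (c i) \<cdot> br (stau (a i)))"
            by (simp add: br_delta bmult_assoc) (simp add: c_def br_sdual bmult_assoc[symmetric])
          finally show ?thesis by (metis binv_left_assoc)
        qed
        have ca: "cword R ?a" using cword_shf[OF a, of 1 0] by (simp add: shf_def[abs_def] taup_1)
        have l2: "ladder R b c ?a"
          using l tile c1 by (simp add: ladder_def snorm_tile proper_slen) (simp add: c_def)
        from b ca l2 show ?thesis
        proof (cases rule: ladder_cases)
          case cycling
          then show ?thesis using dec by simp
        next
          case decycling
          have "b i = a (Suc i)" for i using decycling[of i] by (metis unary_tables(1))
          then show ?thesis using cyc by blast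
        next
          case coatoms
          then show ?thesis using b1 by simp
        next
          case atoms
          have "strip R b c ?a"
            by (rule ladder_strip[OF l2 b1 _ c1]) (use a1 atoms in \<open>auto simp: unary_tables\<close>)
          then have "wstep R b ?a" unfolding wstep_def by blast
          moreover have "a = shf (- 1) 0 ?a"
            using taup_neg(2)[of 1] by (intro ext) (simp add: shf_def taup_1)
          then have "a \<in> cls ?a" using shf_cls[OF cls_self] by metis
          then have "wstep R ?a a" unfolding wstep_def by blast
          ultimately have "(wstep R)\<^sup>*\<^sup>* b a" by (meson rtranclp.rtrancl_into_rtrancl rtranclp.rtrancl_refl)
          from wstep_sym[OF this cword_aword[OF b b1]] show ?thesis using a1 by blast
        qed
      qed
    qed
  qed
qed

lemma strip_bw:
  assumes "strip R Y b Z"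
  shows "bconj (bw R Y) (br (b 0)) = bw R Z"
proof -
  have "bw n Y \<cdot> br (b n) = br (b 0) \<cdot> bw n Z" for n
  proof (induction n)
    case 0
    show ?case by (simp add: bw_0 gsimps)
  next
    case (Suc n)
    have "bw (Suc n) Y \<cdot> br (b (Suc n)) = bw n Y \<cdot> (br (Y n) \<cdot> br (b (Suc n)))" by (simp add: bw_snoc bmult_assoc)
    also have "\<dots> = bw n Y \<cdot> br (b n) \<cdot> br (Z n)"
      using tl2_tile(6)[OF strip_tl2[OF assms, of n]] by (simp add: bmult_assoc)
    also have "\<dots> = br (b 0) \<cdot> bw (Suc n) Z" using Suc by (simp add: bw_snoc bmult_assoc)
    finally show ?case .
  qed
  from this[of R] show ?thesis using assms unfolding bconj_eq strip_def by (metis add_0)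
qed

lemma conjugate_trans: "conjugate z y \<Longrightarrow> conjugate y x \<Longrightarrow> conjugate z x"
  unfolding conjugate_def by (metis bconj_bconj)

lemma wstep_conjugate:
  assumes "(wstep R)\<^sup>*\<^sup>* Y Z" "aword R Y"
  shows "conjugate (bw R Z) (bw R Y)"
  using assms
proof (induction rule: rtranclp_induct)
  case base
  show ?case unfolding conjugate_def by (metis bconj_bone)
next
  case (step W Z)
  have W: "cword R W" using aword_cword[OF wstep_aword[OF step(1,4)]] .
  have "conjugate (bw R Z) (bw R W)"
  proof (cases "Z \<in> cls W")
    case True
    then obtain m n where "Z = shf m n W" by (auto simp: cls_def)
    then show ?thesis unfolding conjugate_def using bw_shf[OF W, of n m, symmetric] by blast
  next
    case False
    then show ?thesis using step(2) strip_bw unfolding wstep_def conjugate_def by metis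
  qed
  then show ?case using step conjugate_trans by blast
qed

lemma rset_self: "rigid x \<Longrightarrow> x \<in> rset x"
  unfolding rset_def conjugate_def using bconj_bone by (metis (mono_tags, lifting) mem_Collect_eq)

text \<open>Transports \<open>rset_induct\<close> from braids to cyclic words.\<close>

lemma rset_words:
  assumes x: "finf x = 0" "rigid x" and a: "cword (length (nfs x)) a" "x = bw (length (nfs x)) a"
    and base: "P a" and pc: "\<And>b. P b \<Longrightarrow> cword (length (nfs x)) b"
    and step: "\<And>b c s. P b \<Longrightarrow> cword (length (nfs x)) c \<Longrightarrow> bconj (bw (length (nfs x)) b) (br s) = bw (length (nfs x)) c \<Longrightarrow> P c"
  shows "rset x \<subseteq> bw (length (nfs x)) ` {b. P b}"
proof
  fix y assume y: "y \<in> rset x"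
  let ?R = "length (nfs x)"
  show "y \<in> bw ?R ` {b. P b}"
  proof (rule rset_induct[OF x y])
    show "x \<in> bw ?R ` {b. P b}" using a(2) base by blast
  next
    fix u s assume u: "u \<in> bw ?R ` {b. P b}" and us: "bconj u (br s) \<in> rset x"
    obtain b where b: "P b" "u = bw ?R b" using u by blast
    obtain c where c: "cword ?R c" "bconj u (br s) = bw ?R c" using rset_cword[OF x(1) us] by blast
    show "bconj u (br s) \<in> bw ?R ` {b. P b}" using step[OF b(1) c(1)] b(2) c(2) by blast
  qed
qed

definition bnd :: "nat \<Rightarrow> nat" where
  "bnd R = (1 + (R + 8) * 36) * (4 * R)"

lemma rset_atoms:
  assumes x: "finf x = 0" "rigid x" and at: "\<forall>s \<in> set (nfs x). slen s = 1"
    and nored: "\<And>Z. aword (length (nfs x)) Z \<Longrightarrow> conjugate (bw (length (nfs x)) Z) x \<Longrightarrow> \<not> red (length (nfs x)) Z"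
  shows "finite (rset x)" "card (rset x) \<le> bnd (length (nfs x))"
proof -
  let ?R = "length (nfs x)"
  obtain a where a: "cword ?R a" "x = bw ?R a" using rset_cword[OF x(1) rset_self[OF x(2)]] by blast
  have R: "0 < ?R" and per: "\<forall>i. a (i + ?R) = a i" using a(1) by (simp_all add: cword_def)
  have nx: "nfs x = map a [0..<?R]" using nf_bw(1)[OF a(1)] a(2) by (metis snd_conv)
  have "slen (a (i mod ?R)) = 1" for i
  proof -
    have "a (i mod ?R) \<in> set (map a [0..<?R])" using R by simp
    then show ?thesis using at nx by metis
  qed
  then have a1: "slen (a i) = 1" for i using periodic_mod[OF per] by metis
  have aw: "aword ?R a" using cword_aword[OF a(1) a1] .
  have sub: "rset x \<subseteq> bw ?R ` {b. (wstep ?R)\<^sup>*\<^sup>* a b}"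
  proof (rule rset_words[OF x a])
    show "cword ?R b" if "(wstep ?R)\<^sup>*\<^sup>* a b" for b using wstep_aword[OF that aw] aword_cword by blast
    show "(wstep ?R)\<^sup>*\<^sup>* a c" if b: "(wstep ?R)\<^sup>*\<^sup>* a b" and c: "cword ?R c" "bconj (bw ?R b) (br s) = bw ?R c" for b c s
    proof -
      have ab: "aword ?R b" using wstep_aword[OF b aw] .
      from conj_word[OF aword_cword[OF ab] c] have "c \<in> cls b \<or> (wstep ?R)\<^sup>*\<^sup>* b c"
        using ab by (auto simp: aword_def)
      then have "(wstep ?R)\<^sup>*\<^sup>* b c" using r_into_rtranclp[of "wstep ?R"] unfolding wstep_def by blast
      then show ?thesis using b by (meson rtranclp_trans)
    qed
  qed simp
  have "\<not> red ?R Z" if "(wstep ?R)\<^sup>*\<^sup>* a Z" for Z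
    using nored[OF wstep_aword[OF that aw]] wstep_conjugate[OF that aw] a(2) by metis
  note c = card_reach[OF aw this]
  show "finite (rset x)" using finite_subset[OF sub] c(1) by simp
  have "card (rset x) \<le> card (bw ?R ` {b. (wstep ?R)\<^sup>*\<^sup>* a b})" by (rule card_mono[OF _ sub]) (simp add: c(1))
  also have "\<dots> \<le> card {b. (wstep ?R)\<^sup>*\<^sup>* a b}" by (rule card_image_le[OF c(1)])
  finally show "card (rset x) \<le> bnd ?R" using c(2) by (simp add: bnd_def)
qed

text \<open>A letter that is not an atom and a letter not of length two survive rotation and \<tau>.
  So the exceptional cases of \<open>conj_word\<close> never arise, and one class remains.\<close>

lemma rset_mixed:
  assumes x: "finf x = 0" "rigid x" and at: "s \<in> set (nfs x)" "slen s \<noteq> 1" "t \<in> set (nfs x)" "slen t \<noteq> 2"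
  shows "finite (rset x)" "card (rset x) \<le> bnd (length (nfs x))"
proof -
  let ?R = "length (nfs x)"
  obtain a where a: "cword ?R a" "x = bw ?R a" using rset_cword[OF x(1) rset_self[OF x(2)]] by blast
  have R: "0 < ?R" and per: "\<forall>i. a (i + ?R) = a i" using a(1) by (simp_all add: cword_def)
  have nx: "nfs x = map a [0..<?R]" using nf_bw(1)[OF a(1)] a(2) by (metis snd_conv)
  obtain i j where ij: "slen (a i) \<noteq> 1" "slen (a j) \<noteq> 2"
  proof -
    have "s \<in> set (map a [0..<?R])" "t \<in> set (map a [0..<?R])" using at nx by metis+
    then show ?thesis using that at by auto
  qed
  have mix: "\<exists>i. slen (b i) \<noteq> 1" "\<exists>j. slen (b j) \<noteq> 2" if "b \<in> cls a" for b
  proof -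
    obtain m n where b: "b = shf m n a" using \<open>b \<in> cls a\<close> by (auto simp: cls_def)
    have "slen (a k) = slen (b (k + (n * ?R - n)))" for k
    proof -
      have "n * ?R - n + n = n * ?R" using R by (cases ?R) auto
      then have "k + (n * ?R - n) + n = k + n * ?R" by linarith
      then show ?thesis using periodic_mult[OF per, of k n] by (simp only: b shf_def slen_taup)
    qed
    then show "\<exists>i. slen (b i) \<noteq> 1" "\<exists>j. slen (b j) \<noteq> 2" using ij by metis+
  qed
  have sub: "rset x \<subseteq> bw ?R ` {b. b \<in> cls a}"
  proof (rule rset_words[OF x a])
    show "a \<in> cls a" by (rule cls_self)
    show "cword ?R b" if "b \<in> cls a" for b using that cword_shf[OF a(1)] by (auto simp: cls_def)
    then show "c \<in> cls a" if b: "b \<in> cls a" and c: "cword ?R c" "bconj (bw ?R b) (br s) = bw ?R c" for b c s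
      using conj_word[OF _ c] mix[OF b] b shf_cls[OF b] unfolding cls_def[of b] by blast
  qed
  note c = card_cls[OF per R]
  show "finite (rset x)" using finite_subset[OF sub] c(1) by simp
  have "card (rset x) \<le> card (bw ?R ` {b. b \<in> cls a})" by (rule card_mono[OF _ sub]) (simp add: c(1))
  also have "\<dots> \<le> card {b. b \<in> cls a}" by (rule card_image_le) (simp add: c(1))
  also have "\<dots> \<le> 4 * ?R" using c(2) by simp
  also have "\<dots> \<le> bnd ?R" by (simp add: bnd_def)
  finally show "card (rset x) \<le> bnd ?R" .
qed

lemma slen_rdual: "\<forall>s \<in> set xs. slen s = 2 \<Longrightarrow> \<forall>s \<in> set (rdual xs). slen s = 1"
proof (induction xs)
  case (Cons x xs)
  have "slen (sdual x) = 1" using Cons.prems unary_tables by (metis add_left_cancel list.set_intros(1) numeral_Bit1 numeral_One one_add_one)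
  then show ?case using Cons by (simp add: slen_taup)
qed simp

text \<open>Passing to y^-1 \<delta>^R replaces the letters by complements, turning length two into
  length one. Divisibility by 4 makes \<delta>^R central, so the map respects conjugation; words of
  fourth powers have such lengths.\<close>

lemma rset_dual:
  assumes x: "finf x = 0" "rigid x" and R: "4 dvd length (nfs x)"
  defines "d \<equiv> \<lambda>y. binv y \<cdot> dpow (int (length (nfs x)))"
  shows "finf (d x) = 0" "rigid (d x)" "nfs (d x) = rdual (nfs x)" "d ` rset x \<subseteq> rset (d x)" "inj_on d (rset x)"
proof -
  have R4: "4 dvd int (length (nfs x))" using R by presburger
  have dn: "nf (d y) = (0, rdual (nfs y))" if "finf y = 0" "length (nfs y) = length (nfs x)" for y
    using nf_binv_mult[of y] that by (simp add: d_def)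
  have dr: "rigid (d y)" if y: "finf y = 0" "length (nfs y) = length (nfs x)" "rigid y" for y
  proof -
    have ne: "nfs y \<noteq> []" "lw (last (nfs y)) (hd (nfs y))" using y by (simp_all add: rigid_nf taup_0)
    have "rdual (nfs y) \<noteq> []" using length_rdual[of "nfs y"] ne(1) by fastforce
    moreover have "lw (taup (int (length (nfs y)) - 1) (sdual (hd (nfs y)))) (sdual (last (nfs y)))"
    proof -
      have t: "taup (int (length (nfs y)) - 1) s = taup (- 1) s" for s
        using taup_add[of "- 1" "int (length (nfs y))" s] taup_4[of "int (length (nfs y))" s] R4 y(2) by simp
      have "sdual (taup (- 1) (sdual s)) = s" for s
      proof -
        have "stau (sdual (taup (- 1) (sdual s))) = sdual (stau (taup (- 1) (sdual s)))" by (simp add: unary_tables)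
        also have "\<dots> = stau s" using taup_neg(1)[of 1 "sdual s"] by (simp add: taup_1 unary_tables)
        finally show ?thesis by (metis unary_tables(1))
      qed
      then show ?thesis using ne(2) binary_tables(1) by (metis lw_def t)
    qed
    ultimately show ?thesis
      using dn[OF y(1,2)] rdual_last[OF ne(1)] rdual_hd[OF ne(1)] by (simp add: rigid_nf taup_0)
  qed
  show "finf (d x) = 0" "nfs (d x) = rdual (nfs x)" "rigid (d x)" using dn[of x] dr[of x] x by simp_all
  show "d ` rset x \<subseteq> rset (d x)"
  proof
    fix w assume "w \<in> d ` rset x"
    then obtain y where y: "w = d y" "conjugate y x" "rigid y" "finf y = 0" "length (nfs y) = length (nfs x)"
      using x by (auto simp: rset_def)
    obtain z where z: "y = bconj x z" using y(2) by (auto simp: conjugate_def)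
    have "d y = bconj (d x) z"
      using dpow_central[OF R4, of z] by (simp add: d_def z bconj_binv) (simp add: bconj_def bmult_assoc)
    then show "w \<in> rset (d x)" using dn[OF y(4,5)] dn[of x] dr[OF y(4,5,3)] y(1,5) x(1)
      by (auto simp: rset_def conjugate_def length_rdual)
  qed
  have "binv y = binv z \<Longrightarrow> y = z" for y z by (metis binv_binv)
  then show "inj_on d (rset x)"
    unfolding inj_on_def d_def by (metis bmult_assoc binv_right bone_right)
qed

theorem card_rset:
  assumes x: "finf x = 0" "rigid x" and R: "4 dvd length (nfs x)"
    and nored: "\<And>Z. aword (length (nfs x)) Z \<Longrightarrow>
      conjugate (bw (length (nfs x)) Z) x \<or> conjugate (bw (length (nfs x)) Z) (binv x \<cdot> dpow (int (length (nfs x))))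
      \<Longrightarrow> \<not> red (length (nfs x)) Z"
  shows "finite (rset x) \<and> card (rset x) \<le> bnd (length (nfs x))"
proof -
  consider "\<forall>s \<in> set (nfs x). slen s = 1" | "\<forall>s \<in> set (nfs x). slen s = 2"
    | s t where "s \<in> set (nfs x)" "slen s \<noteq> 1" "t \<in> set (nfs x)" "slen t \<noteq> 2" by blast
  then show ?thesis
  proof cases
    case 1
    then show ?thesis using rset_atoms[OF x] nored by blast
  next
    case 2
    note d = rset_dual[OF x R]
    have l: "length (nfs (binv x \<cdot> dpow (int (length (nfs x))))) = length (nfs x)" by (simp add: d(3) length_rdual)
    have at: "\<forall>s \<in> set (nfs (binv x \<cdot> dpow (int (length (nfs x))))). slen s = 1"
      using slen_rdual[OF 2] d(3) by simp
    have f: "finite (rset (binv x \<cdot> dpow (int (length (nfs x)))))"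
      "card (rset (binv x \<cdot> dpow (int (length (nfs x))))) \<le> bnd (length (nfs x))"
      using rset_atoms[OF d(1,2) at] nored unfolding l by blast+
    have "finite (rset x)" using finite_imageD[OF finite_subset[OF d(4) f(1)] d(5)] .
    moreover have "card (rset x) \<le> card (rset (binv x \<cdot> dpow (int (length (nfs x)))))"
      by (rule card_inj_on_le[OF d(5,4) f(1)])
    ultimately show ?thesis using f(2) by simp
  next
    case 3
    then show ?thesis using rset_mixed[OF x 3] by blast
  qed
qed

section \<open>Essential curves\<close>

definition reduced :: "fword \<Rightarrow> bool" where
  "reduced w \<longleftrightarrow> successively (\<lambda>x y. \<not> (fst x = fst y \<and> snd x \<noteq> snd y)) w"

lemma red_step_reduced: "reduced r \<Longrightarrow> reduced (red_step x r)"
  by (cases x; cases r) (auto simp: reduced_def successively_Cons split: if_splits)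

lemma red_step_cancel: "reduced r \<Longrightarrow> red_step (g, b) (red_step (g, \<not> b) r) = r"
proof (cases r)
  case (Cons y s)
  assume "reduced r"
  then show ?thesis using Cons by (cases y; cases s) (auto simp: reduced_def)
qed simp

lemma foldr_reduced: "reduced r \<Longrightarrow> reduced (foldr red_step w r)"
  by (induction w) (simp_all add: red_step_reduced)

lemma freduce_simps: "freduce [] = []" "freduce (x # w) = red_step x (freduce w)"
  by (simp_all add: freduce_def)

lemma freduce_append: "freduce (u @ v) = foldr red_step u (freduce v)"
  by (simp add: freduce_def)

lemma reduced_freduce: "reduced (freduce w)"
  unfolding freduce_def by (rule foldr_reduced) (simp add: reduced_def)

lemma red_step_cases:
  obtains (cons) "red_step x r = x # r" | (cancel) t where "r = (fst x, \<not> snd x) # t" "red_step x r = t"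
proof (cases "\<exists>t. r = (fst x, \<not> snd x) # t")
  case True
  then obtain t where "r = (fst x, \<not> snd x) # t" by blast
  then show thesis by (intro cancel) (cases x, simp_all)
next
  case False
  then have "red_step x r = x # r" by (cases x; cases r) (auto split: if_splits)
  then show thesis by (rule cons)
qed

text \<open>On reduced words the steps of a letter and of its inverse cancel, so reducing the acting
  word changes nothing. This makes \<open>free_eq\<close> a congruence.\<close>

lemma foldr_freduce: "reduced r \<Longrightarrow> foldr red_step (freduce w) r = foldr red_step w r"
proof (induction w)
  case (Cons x w)
  show ?case
  proof (cases rule: red_step_cases[of x "freduce w"])
    case cons
    then show ?thesis using Cons by (simp add: freduce_simps)
  next
    case (cancel t)
    have "foldr red_step (x # w) r = red_step x (foldr red_step (freduce w) r)" using Cons by simp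
    also have "\<dots> = red_step (fst x, snd x) (red_step (fst x, \<not> snd x) (foldr red_step t r))" by (simp add: cancel(1))
    also have "\<dots> = foldr red_step t r" by (rule red_step_cancel[OF foldr_reduced[OF Cons.prems]])
    finally show ?thesis using cancel by (simp add: freduce_simps)
  qed
qed (simp add: freduce_simps)

lemma free_eq_refl: "free_eq u u"
  and free_eq_sym: "free_eq u v \<Longrightarrow> free_eq v u"
  and free_eq_trans [trans]: "free_eq u v \<Longrightarrow> free_eq v w \<Longrightarrow> free_eq u w"
  by (simp_all add: free_eq_def)

lemma free_eq_append: "free_eq u u' \<Longrightarrow> free_eq v v' \<Longrightarrow> free_eq (u @ v) (u' @ v')"
  unfolding free_eq_def freduce_append by (metis foldr_freduce reduced_freduce)

lemma winv_simps: "winv [] = []" "winv (x # w) = winv w @ [(fst x, \<not> snd x)]"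
  by (simp_all add: winv_def case_prod_beta)

lemma free_eq_winv: "free_eq (w @ winv w) []"
proof (induction w)
  case (Cons x w)
  have "free_eq ([x] @ (w @ winv w) @ [(fst x, \<not> snd x)]) ([x] @ [] @ [(fst x, \<not> snd x)])"
    by (intro free_eq_append free_eq_refl Cons)
  also have "free_eq ([x] @ [] @ [(fst x, \<not> snd x)]) []" by (cases x) (simp add: free_eq_def freduce_def)
  finally show ?case by (simp add: winv_simps)
qed (simp add: winv_simps free_eq_refl)

lemma free_eq_winv': "free_eq (winv w @ w) []"
  using free_eq_winv[of "winv w"] by (simp add: winv_winv)

lemma free_eq_winv_cong: "free_eq u v \<Longrightarrow> free_eq (winv u) (winv v)"
proof -
  assume H: "free_eq u v"
  have "free_eq (winv u) (winv u @ v @ winv v)"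
    using free_eq_append[OF free_eq_refl free_eq_sym[OF free_eq_winv], of "winv u" v] by simp
  also have "free_eq (winv u @ v @ winv v) (winv u @ u @ winv v)"
    by (intro free_eq_append free_eq_refl free_eq_sym[OF H])
  also have "free_eq (winv u @ u @ winv v) (winv v)"
    using free_eq_append[OF free_eq_winv'[of u] free_eq_refl[of "winv v"]] by simp
  finally show ?thesis .
qed

lemma fsubst_simps: "fsubst f [] = []"
  "fsubst f (x # w) = (if snd x then f (fst x) else winv (f (fst x))) @ fsubst f w"
  by (simp_all add: fsubst_def case_prod_beta)

lemma fsubst_append: "fsubst f (u @ v) = fsubst f u @ fsubst f v"
  by (simp add: fsubst_def)

lemma fsubst_winv: "fsubst f (winv w) = winv (fsubst f w)"
  by (induction w) (simp_all add: winv_simps fsubst_simps fsubst_append winv_append winv_winv)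

lemma fsubst_freduce: "free_eq (fsubst f w) (fsubst f (freduce w))"
proof (induction w)
  case (Cons x w)
  let ?g = "\<lambda>x. if snd x then f (fst x) else winv (f (fst x))"
  have IH: "free_eq (fsubst f (x # w)) (?g x @ fsubst f (freduce w))"
    using free_eq_append[OF free_eq_refl Cons, of "?g x"] by (simp add: fsubst_simps)
  show ?case
  proof (cases rule: red_step_cases[of x "freduce w"])
    case cons
    then show ?thesis using IH by (simp add: freduce_simps fsubst_simps)
  next
    case (cancel t)
    have "free_eq ((?g x @ ?g (fst x, \<not> snd x)) @ fsubst f t) ([] @ fsubst f t)"
      by (intro free_eq_append free_eq_refl) (auto simp: free_eq_winv free_eq_winv')
    then have "free_eq (?g x @ fsubst f (freduce w)) (fsubst f t)" by (simp add: cancel(1) fsubst_simps)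
    with IH show ?thesis using free_eq_trans cancel by (simp add: freduce_simps)
  qed
qed (simp add: freduce_simps free_eq_refl)

lemma fsubst_free_eq: "free_eq u v \<Longrightarrow> free_eq (fsubst f u) (fsubst f v)"
  by (metis fsubst_freduce free_eq_def)

lemma fsubst_cong: "(\<And>x. x \<in> set w \<Longrightarrow> free_eq (f (fst x)) (g (fst x))) \<Longrightarrow> free_eq (fsubst f w) (fsubst g w)"
  by (induction w) (auto simp: fsubst_simps free_eq_refl intro!: free_eq_append free_eq_winv_cong)

section \<open>Artin's action on the free group\<close>

lemma artin_act_append: "artin_act (u @ v) c = artin_act u (artin_act v c)"
  by (induction u) simp_all

lemma artin_act_free_eq: "free_eq c d \<Longrightarrow> free_eq (artin_act u c) (artin_act u d)"
  by (induction u) (simp_all add: fsubst_free_eq)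

lemma artin_act_word: "artin_act u (c @ d) = artin_act u c @ artin_act u d" "artin_act u (winv c) = winv (artin_act u c)"
  by (induction u) (simp_all add: fsubst_append fsubst_winv)

lemma artin_act_gens: "artin_act u c = fsubst (\<lambda>j. artin_act u [(j, True)]) c"
proof (induction c)
  case Nil
  show ?case by (induction u) (simp_all add: fsubst_simps)
next
  case (Cons x c)
  have "artin_act u [x] = (if snd x then artin_act u [(fst x, True)] else winv (artin_act u [(fst x, True)]))"
    using artin_act_word(2)[of u "[(fst x, True)]"] by (cases x) (auto simp: winv_simps)
  then show ?case using artin_act_word(1)[of u "[x]" c] Cons by (simp add: fsubst_simps)
qed

lemma artin_act_ext:
  assumes "\<And>j. j \<in> fst ` set c \<Longrightarrow> free_eq (artin_act u [(j, True)]) (artin_act v [(j, True)])"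
  shows "free_eq (artin_act u c) (artin_act v c)"
  using fsubst_cong[of c "\<lambda>j. artin_act u [(j, True)]" "\<lambda>j. artin_act v [(j, True)]"] assms
  by (simp add: artin_act_gens[symmetric])

text \<open>Endomorphisms are compared on generators. Letters are arbitrary natural numbers, but
  braids fix all letters except 1 to 4.\<close>

lemma artin_act_rel:
  assumes "list_all (\<lambda>j. free_eq (artin_act u [(j, True)]) (artin_act v [(j, True)])) [1, 2, 3, 4]"
  shows "free_eq (artin_act u c) (artin_act v c)"
proof (rule artin_act_ext)
  fix j
  have other: "artin_act w [(j, True)] = [(j, True)]" if "j \<notin> {1, 2, 3, 4}" for w
  proof (induction w)
    case (Cons l w)
    obtain g b where "l = (g, b)" by (cases l)
    then show ?case using Cons that by (cases g; cases b) (auto simp: fsubst_simps)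
  qed simp
  show "free_eq (artin_act u [(j, True)]) (artin_act v [(j, True)])"
  proof (cases "j \<in> {1, 2, 3, 4}")
    case True
    then show ?thesis using assms by auto
  next
    case False
    then show ?thesis using other by (simp add: free_eq_refl)
  qed
qed

lemma artin_act_cancel: "free_eq (artin_act [(g, b), (g, \<not> b)] c) c"
proof -
  have chk: "list_all (\<lambda>g. list_all (\<lambda>b. list_all (\<lambda>j. free_eq (artin_act [(g, b), (g, \<not> b)] [(j, True)])
      (artin_act [] [(j, True)])) [1, 2, 3, 4]) [True, False]) [S1, S2, S3]"
    by code_simp
  have "g \<in> set [S1, S2, S3]" "b \<in> set [True, False]" by (cases g; simp) (cases b; simp)
  then have "list_all (\<lambda>j. free_eq (artin_act [(g, b), (g, \<not> b)] [(j, True)]) (artin_act [] [(j, True)])) [1, 2, 3, 4]"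
    using chk unfolding list_all_iff[where xs = "[S1, S2, S3]"] list_all_iff[where xs = "[True, False]"] by blast
  then have "free_eq (artin_act [(g, b), (g, \<not> b)] c) (artin_act [] c)" by (rule artin_act_rel)
  then show ?thesis by simp
qed

lemma artin_act_winv: "free_eq (artin_act (w @ winv w) c) c"
proof (induction w arbitrary: c)
  case (Cons x w)
  obtain g b where x: "x = (g, b)" by (cases x)
  have "free_eq (artin_act ((x # w) @ winv (x # w)) c) (artin_act [x] (artin_act [(g, \<not> b)] c))"
    using artin_act_free_eq[OF Cons, of "[x]" "artin_act [(g, \<not> b)] c"]
    by (simp add: winv_simps artin_act_append x)
  also have "free_eq (artin_act [x] (artin_act [(g, \<not> b)] c)) c"
    using artin_act_cancel[of g b c] by (simp add: x)
  finally show ?case .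
qed (simp add: winv_simps free_eq_refl)

lemma artin_act_winv': "free_eq (artin_act (winv w @ w) c) c"
  using artin_act_winv[of "winv w"] by (simp add: winv_winv)

lemma artin_act_beq: "beq u v \<Longrightarrow> free_eq (artin_act u c) (artin_act v c)"
proof (induction arbitrary: c rule: beq.induct)
  case (bcong u u' v v')
  have "free_eq (artin_act u (artin_act v c)) (artin_act u (artin_act v' c))"
    by (rule artin_act_free_eq[OF bcong.IH(2)])
  also have "free_eq (artin_act u (artin_act v' c)) (artin_act u' (artin_act v' c))" by (rule bcong.IH(1))
  finally show ?case by (simp add: artin_act_append)
next
  case (binv_cong u v)
  let ?d = "artin_act (winv u) c"
  have "free_eq (artin_act v ?d) (artin_act u ?d)" by (rule free_eq_sym[OF binv_cong.IH])
  also have "free_eq (artin_act u ?d) c" using artin_act_winv[of u c] by (simp add: artin_act_append)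
  finally have "free_eq (artin_act (winv v) (artin_act v ?d)) (artin_act (winv v) c)" by (rule artin_act_free_eq)
  moreover have "free_eq (artin_act (winv v) (artin_act v ?d)) ?d"
    using artin_act_winv'[of v ?d] by (simp add: artin_act_append)
  ultimately show ?case using free_eq_sym free_eq_trans by blast
next
  case (bcancel g b)
  then show ?case using artin_act_cancel by simp
next
  case bcomm
  show ?case by (rule artin_act_rel) code_simp
next
  case bbr12
  show ?case by (rule artin_act_rel) code_simp
next
  case bbr23
  show ?case by (rule artin_act_rel) code_simp
qed (blast intro: free_eq_refl free_eq_sym free_eq_trans)+

section \<open>Curves mapped and preserved by braids\<close>

lemma fconj_free_eq: "free_eq u v \<Longrightarrow> fconj u v"
  unfolding fconj_def by (rule exI[of _ "[]"]) (simp add: winv_simps)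

lemma fconj_trans:
  assumes "fconj u v" "fconj v w"
  shows "fconj u w"
proof -
  obtain g h where g: "free_eq (g @ u @ winv g) v" and h: "free_eq (h @ v @ winv h) w"
    using assms by (auto simp: fconj_def)
  have "free_eq (h @ (g @ u @ winv g) @ winv h) (h @ v @ winv h)" by (intro free_eq_append free_eq_refl g)
  with h have "free_eq ((h @ g) @ u @ winv (h @ g)) w" using free_eq_trans by (simp add: winv_append)
  then show ?thesis unfolding fconj_def by blast
qed

lemma fconj_sym:
  assumes "fconj u v"
  shows "fconj v u"
proof -
  obtain g where g: "free_eq (g @ u @ winv g) v" using assms by (auto simp: fconj_def)
  have "free_eq (winv g @ v @ winv (winv g)) (winv g @ (g @ u @ winv g) @ winv (winv g))"
    by (intro free_eq_append free_eq_refl free_eq_sym[OF g])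
  also have "free_eq (winv g @ (g @ u @ winv g) @ winv (winv g)) ([] @ u @ [])"
    using free_eq_append[OF free_eq_winv'[of g] free_eq_append[OF free_eq_refl[of u] free_eq_winv'[of g]]]
    by (simp add: winv_winv)
  finally show ?thesis unfolding fconj_def by auto
qed

lemma fconj_artin_act: "fconj c d \<Longrightarrow> fconj (artin_act u c) (artin_act u d)"
  unfolding fconj_def by (metis artin_act_free_eq artin_act_word)

text \<open>Quantifying over all words of the braid fits the definition of pseudo-Anosov; by
  \<open>curveI\<close> a single word is enough.\<close>

definition maps_curve :: "braid \<Rightarrow> fword \<Rightarrow> fword \<Rightarrow> bool" where
  "maps_curve \<beta> c d \<longleftrightarrow> (\<forall>w. abs_braid w = \<beta> \<longrightarrow> fconj (artin_act w c) d)"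

lemma curveI:
  assumes "fconj (artin_act w c) d"
  shows "maps_curve (abs_braid w) c d"
  unfolding maps_curve_def
proof (intro allI impI)
  fix v assume "abs_braid v = abs_braid w"
  then have "beq v w" by (simp add: braid.abs_eq_iff)
  then show "fconj (artin_act v c) d" using artin_act_beq fconj_free_eq fconj_trans assms by blast
qed

lemma braid_word: obtains w where "\<beta> = abs_braid w"
  using braid.abs_induct[of "\<lambda>\<beta>. \<exists>w. \<beta> = abs_braid w" \<beta>] by blast

lemma curve_mult:
  assumes "maps_curve \<beta> c d" "maps_curve \<alpha> d e"
  shows "maps_curve (\<alpha> \<cdot> \<beta>) c e"
proof -
  obtain u v where u: "\<alpha> = abs_braid u" and v: "\<beta> = abs_braid v" by (metis braid_word)
  have "fconj (artin_act (u @ v) c) e"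
    unfolding artin_act_append using assms fconj_artin_act fconj_trans unfolding maps_curve_def u v by blast
  from curveI[OF this] show ?thesis by (simp add: u v bmult.abs_eq)
qed

lemma curve_bone: "maps_curve bone c c"
  unfolding bone.abs_eq by (rule curveI) (simp add: fconj_free_eq free_eq_refl)

lemma curve_binv:
  assumes "maps_curve \<beta> c d"
  shows "maps_curve (binv \<beta>) d c"
proof -
  obtain v where v: "\<beta> = abs_braid v" by (metis braid_word)
  have "fconj (artin_act (winv v) (artin_act v c)) (artin_act (winv v) d)"
    using assms fconj_artin_act unfolding maps_curve_def v by blast
  moreover have "fconj (artin_act (winv v) (artin_act v c)) c"
    using fconj_free_eq[OF artin_act_winv'[of v c]] by (simp add: artin_act_append)
  ultimately have "fconj (artin_act (winv v) d) c" using fconj_sym fconj_trans by blast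
  from curveI[OF this] show ?thesis by (simp add: v binv.abs_eq)
qed

lemma curve_bpow: "maps_curve \<beta> c c \<Longrightarrow> maps_curve (bpow \<beta> n) c c"
  by (induction n) (auto simp: bpow_simps curve_bone intro: curve_mult)

text \<open>The indices decrease because the last letter of a word acts before the others.\<close>

lemma curve_bw: "(\<And>i. maps_curve (br (Y i)) (c (Suc i)) (c i)) \<Longrightarrow> maps_curve (bw n Y) (c n) (c 0)"
  by (induction n) (auto simp: bw_0 bw_snoc curve_bone intro: curve_mult)

fun bwd :: "sim \<Rightarrow> bword" where
  "bwd A12 = [(S1, True)]"
| "bwd A23 = [(S2, True)]"
| "bwd A34 = [(S3, True)]"
| "bwd A13 = [(S2, False), (S1, True), (S2, True)]"
| "bwd A24 = [(S3, False), (S2, True), (S3, True)]"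
| "bwd A14 = [(S3, False), (S2, False), (S1, True), (S2, True), (S3, True)]"
| "bwd _ = []"

lemma br_bwd: "slen s = 1 \<Longrightarrow> br s = abs_braid (bwd s)"
proof -
  have sg: "sigma g = abs_braid [(g, True)]" for g by (rule sigma.abs_eq)
  show "slen s = 1 \<Longrightarrow> br s = abs_braid (bwd s)"
    by (cases s) (simp_all add: slen_def br_simps sg bmult.abs_eq binv.abs_eq winv_simps)
qed

abbreviation xs2 :: "nat list \<Rightarrow> fword" where
  "xs2 l \<equiv> map (\<lambda>k. (k, True)) l"

text \<open>The curve around the two punctures that the atom exchanges; the default case serves
  \<open>A34\<close>.\<close>

fun cv :: "sim \<Rightarrow> fword" where
  "cv A12 = xs2 [1, 2]" | "cv A13 = xs2 [1, 3]" | "cv A14 = xs2 [1, 4]"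
| "cv A23 = xs2 [2, 3]" | "cv A24 = xs2 [2, 4]" | "cv _ = xs2 [3, 4]"

text \<open>The atoms whose square with \<open>s\<close> repeats \<open>s\<close> involve only three
  punctures if \<open>s\<close> is a side, such as 1, 3, 4 for \<open>A12\<close>. If
  \<open>s\<close> is a diagonal, they are two disjoint atoms. The curve goes around these three
  punctures, or around one of the two pairs.\<close>

fun cv' :: "sim \<Rightarrow> fword" where
  "cv' A12 = xs2 [1, 3, 4]" | "cv' A13 = xs2 [2, 3]" | "cv' A14 = xs2 [2, 3, 4]"
| "cv' A23 = xs2 [1, 2, 4]" | "cv' A24 = xs2 [1, 2]" | "cv' _ = xs2 [1, 2, 3]"

lemma round_ess:
  "c \<in> round_curves \<Longrightarrow> c \<in> ess_curves" "c \<in> ess_curves \<Longrightarrow> artin_act w c \<in> ess_curves"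
  unfolding ess_curves_def by (metis (mono_tags, lifting) artin_act.simps(1) mem_Collect_eq)
    (auto, metis artin_act_append)

lemma round_xs: "xs2 [1, 2] \<in> round_curves" "xs2 [2, 3] \<in> round_curves" "xs2 [3, 4] \<in> round_curves"
  "xs2 [1, 2, 3] \<in> round_curves" "xs2 [2, 3, 4] \<in> round_curves"
proof -
  have "xs2 [i..<Suc j] \<in> round_curves" if "1 \<le> i" "i < j" "j \<le> 4" "\<not> (i = 1 \<and> j = 4)" for i j
    unfolding round_curves_def using that by blast
  note r = this
  have u: "[1..<Suc 2] = [1, 2]" "[2..<Suc 3] = [2, 3]" "[3..<Suc 4] = [3, 4]" "[1..<Suc 3] = [1, 2, 3]" "[2..<Suc 4] = [2, 3, 4]"
    by code_simp+
  show "xs2 [1, 2] \<in> round_curves" using r[of 1 2] unfolding u by simp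
  show "xs2 [2, 3] \<in> round_curves" using r[of 2 3] unfolding u by simp
  show "xs2 [3, 4] \<in> round_curves" using r[of 3 4] unfolding u by simp
  show "xs2 [1, 2, 3] \<in> round_curves" using r[of 1 3] unfolding u by simp
  show "xs2 [2, 3, 4] \<in> round_curves" using r[of 2 4] unfolding u by simp
qed

lemma cv_ess: "cv s \<in> ess_curves" "cv' s \<in> ess_curves"
proof -
  note r = round_ess(1)[OF round_xs(1)] round_ess(1)[OF round_xs(2)] round_ess(1)[OF round_xs(3)]
    round_ess(1)[OF round_xs(4)] round_ess(1)[OF round_xs(5)]
  have "xs2 [1, 3] = artin_act [(S2, False)] (xs2 [1, 2])" "xs2 [2, 4] = artin_act [(S3, False)] (xs2 [2, 3])"
    "xs2 [1, 4] = artin_act [(S3, False), (S2, False)] (xs2 [1, 2])"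
    "xs2 [1, 3, 4] = artin_act [(S1, True)] (xs2 [2, 3, 4])" "xs2 [1, 2, 4] = artin_act [(S3, False)] (xs2 [1, 2, 3])"
    by (simp_all add: fsubst_simps)
  then have "xs2 [1, 3] \<in> ess_curves" "xs2 [2, 4] \<in> ess_curves" "xs2 [1, 4] \<in> ess_curves"
    "xs2 [1, 3, 4] \<in> ess_curves" "xs2 [1, 2, 4] \<in> ess_curves"
    using round_ess(2) r by metis+
  with r show "cv s \<in> ess_curves" "cv' s \<in> ess_curves" by (cases s; simp)+
qed

text \<open>If y t = s y, then \<open>y\<close> carries the curve of \<open>t\<close> to the curve
  of \<open>s\<close>. In the free group images agree with their targets up to conjugation only, and
  the short lists contain a conjugator for each case.\<close>

lemma cv_check:
  "list_all (\<lambda>y. list_all (\<lambda>s. case tl2 y s of None \<Rightarrow> True | Some (t, z) \<Rightarrow>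
     (z = y \<longrightarrow> list_ex (\<lambda>g. free_eq (g @ artin_act (bwd y) (cv t) @ winv g) (cv s))
        [[], [(1, False)], [(2, False)], [(4, True), (1, False)]])
   \<and> (t = s \<longrightarrow> list_ex (\<lambda>g. free_eq (g @ artin_act (bwd y) (cv' s) @ winv g) (cv' s))
        [[], [(4, True), (1, False)]])) ats) ats"
  by code_simp

lemma tile_curve:
  "tl2 y s = Some (t, y) \<Longrightarrow> maps_curve (br y) (cv t) (cv s)"
  "tl2 y s = Some (s, z) \<Longrightarrow> maps_curve (br y) (cv' s) (cv' s)"
proof -
  have c: "(z = y \<longrightarrow> fconj (artin_act (bwd y) (cv t)) (cv s)) \<and> (t = s \<longrightarrow> fconj (artin_act (bwd y) (cv' s)) (cv' s))"
    if "tl2 y s = Some (t, z)" for y s t z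
  proof -
    have "y \<in> set ats" "s \<in> set ats" using tl2_tile[OF that] by (simp_all add: slen_1[symmetric])
    from bspec[OF bspec[OF cv_check[unfolded list_all_iff] this(1)] this(2), unfolded that option.case prod.case]
    show ?thesis unfolding list_ex_iff fconj_def by blast
  qed
  show "tl2 y s = Some (t, y) \<Longrightarrow> maps_curve (br y) (cv t) (cv s)"
    using c[of y s t y] br_bwd[OF tl2_tile(1)] curveI by auto
  show "tl2 y s = Some (s, z) \<Longrightarrow> maps_curve (br y) (cv' s) (cv' s)"
    using c[of y s s z] br_bwd[OF tl2_tile(1)] curveI by auto
qed

text \<open>In the first alternative each letter carries the curve of the next vertical edge to that
  of the present one, and the edges close up; in the second, all letters preserve one curve.\<close>

lemma red_curve:
  assumes "red R Y"
  obtains c where "c \<in> ess_curves" "maps_curve (bw R Y) c c"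
proof -
  from assms consider s where "strip R Y s Y" | s where "\<forall>i. \<exists>y'. tl2 (Y i) s = Some (s, y')"
    unfolding red_def by blast
  then show thesis
  proof cases
    case 1
    have "maps_curve (bw R Y) (cv (s R)) (cv (s 0))"
      by (rule curve_bw[where c = "\<lambda>i. cv (s i)"]) (rule tile_curve(1)[OF strip_tl2[OF 1]])
    moreover have "s R = s 0" using 1 unfolding strip_def by (metis add_0)
    ultimately show thesis using that cv_ess(1) by metis
  next
    case 2
    have "maps_curve (bw R Y) (cv' s) (cv' s)"
      by (rule curve_bw[where c = "\<lambda>i. cv' s"]) (use 2 tile_curve(2) in blast)
    then show thesis using that cv_ess(2) by metis
  qed
qed

text \<open>The full twist acts by conjugation on words in the four generators of the disk, not on
  words with other letters.\<close>

definition fin4 :: "fword \<Rightarrow> bool" where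
  "fin4 w \<longleftrightarrow> fst ` set w \<subseteq> {1, 2, 3, 4}"

lemma fin4_winv: "fin4 (winv w) \<longleftrightarrow> fin4 w"
  by (force simp: fin4_def winv_def)

lemma fin4_append: "fin4 (u @ v) \<longleftrightarrow> fin4 u \<and> fin4 v"
  by (auto simp: fin4_def)

lemma fin4_artin_act: "fin4 c \<Longrightarrow> fin4 (artin_act u c)"
proof (induction u)
  case (Cons l u)
  obtain g b where l: "l = (g, b)" by (cases l)
  have "fin4 (art l j)" if "j \<in> {1, 2, 3, 4}" for j
    using that by (cases g; cases b) (auto simp: l fin4_def)
  note a = this
  have "fin4 (fsubst (art l) w)" if "fin4 w" for w
    using that
  proof (induction w)
    case (Cons x w)
    then have "fin4 (art l (fst x))" "fin4 (fsubst (art l) w)" using a by (auto simp: fin4_def)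
    then show ?case by (simp add: fsubst_simps fin4_append fin4_winv)
  qed (simp add: fsubst_simps fin4_def)
  then show ?case using Cons by simp
qed simp

lemma fin4_ess:
  assumes "c \<in> ess_curves"
  shows "fin4 c"
proof -
  obtain w i j where c: "c = artin_act w (xs2 [i..<Suc j])" "1 \<le> i" "j \<le> 4"
    using assms unfolding ess_curves_def round_curves_def by blast
  have "k \<in> {1, 2, 3, 4}" if "k \<in> set [i..<Suc j]" for k using that c(2,3) by auto
  moreover have "fst ` set (xs2 l) = set l" for l by force
  ultimately have "fin4 (xs2 [i..<Suc j])" unfolding fin4_def by blast
  then show ?thesis unfolding c(1) by (rule fin4_artin_act)
qed

text \<open>The full twist acts as conjugation by the boundary word x_1 x_2 x_3 x_4, which preserves
  every conjugacy class.\<close>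

lemma curve_delta4:
  assumes "c \<in> ess_curves"
  shows "maps_curve (bpow delta 4) c c"
proof -
  let ?d = "[(S1, True), (S2, True), (S3, True)]"
  have dd: "delta = abs_braid ?d" by (simp add: delta_def sigma.abs_eq bmult.abs_eq)
  have d: "bpow delta 4 = abs_braid (?d @ ?d @ ?d @ ?d)"
    unfolding dd by (simp add: eval_nat_numeral bpow_simps bmult.abs_eq bone.abs_eq)
  let ?g = "xs2 [1, 2, 3, 4]"
  have chk: "list_all (\<lambda>j. free_eq (artin_act (?d @ ?d @ ?d @ ?d) [(j, True)]) (?g @ [(j, True)] @ winv ?g)) [1, 2, 3, 4]"
    by code_simp
  have "free_eq (artin_act (?d @ ?d @ ?d @ ?d) c) (fsubst (\<lambda>j. ?g @ [(j, True)] @ winv ?g) c)"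
    unfolding artin_act_gens[of "?d @ ?d @ ?d @ ?d" c]
  proof (rule fsubst_cong)
    fix x assume "x \<in> set c"
    then have "fst x \<in> set [1, 2, 3, 4]" using fin4_ess[OF assms] by (auto simp: fin4_def)
    then show "free_eq (artin_act (?d @ ?d @ ?d @ ?d) [(fst x, True)]) (?g @ [(fst x, True)] @ winv ?g)"
      using chk unfolding list_all_iff by blast
  qed
  moreover have "free_eq (fsubst (\<lambda>j. g @ [(j, True)] @ winv g) c) (g @ c @ winv g)" for g
  proof (induction c)
    case Nil
    show ?case using free_eq_sym[OF free_eq_winv[of g]] by (simp add: fsubst_simps)
  next
    case (Cons x c)
    have "fsubst (\<lambda>j. g @ [(j, True)] @ winv g) (x # c) = (g @ [x] @ winv g) @ fsubst (\<lambda>j. g @ [(j, True)] @ winv g) c"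
      by (cases x) (simp add: fsubst_simps winv_append winv_simps winv_winv)
    also have "free_eq \<dots> ((g @ [x] @ winv g) @ (g @ c @ winv g))" by (intro free_eq_append free_eq_refl Cons)
    also have "(g @ [x] @ winv g) @ (g @ c @ winv g) = (g @ [x]) @ (winv g @ g) @ (c @ winv g)" by simp
    also have "free_eq \<dots> ((g @ [x]) @ [] @ (c @ winv g))" by (intro free_eq_append free_eq_refl free_eq_winv')
    finally show ?case by simp
  qed
  ultimately have "free_eq (?g @ c @ winv ?g) (artin_act (?d @ ?d @ ?d @ ?d) c)"
    using free_eq_sym free_eq_trans by blast
  then have "fconj c (artin_act (?d @ ?d @ ?d @ ?d) c)" unfolding fconj_def by blast
  then show ?thesis unfolding d by (rule curveI[OF fconj_sym])
qed

lemma curve_dpow4: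
  assumes "c \<in> ess_curves" "4 dvd k"
  shows "maps_curve (dpow k) c c"
proof -
  have p: "bpow x (4 * n) = bpow (bpow x 4) n" for x n
  proof (induction n)
    case (Suc n)
    have "bpow x (4 * Suc n) = bpow x (4 + 4 * n)" by (simp only: mult_Suc_right)
    then show ?case unfolding bpow_add by (simp only: Suc bpow_simps(2)[of "bpow x 4"])
  qed (simp add: bpow_simps)
  have pos: "maps_curve (bpow delta (4 * n)) c c" for n
    unfolding p by (intro curve_bpow curve_delta4 assms)
  obtain m where m: "k = 4 * m" using assms(2) by blast
  show ?thesis
  proof (cases "0 \<le> k")
    case True
    then have "nat k = 4 * nat m" using m by simp
    then show ?thesis using pos[of "nat m"] True by (simp add: dpow_def)
  next
    case False
    then have "nat (- k) = 4 * nat (- m)" using m by simp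
    then show ?thesis using curve_binv[OF pos[of "nat (- m)"]] False by (simp add: dpow_def binv_bpow)
  qed
qed

lemma curve_conj:
  assumes "c \<in> ess_curves" "maps_curve (bconj x z) c c"
  obtains d where "d \<in> ess_curves" "maps_curve x d d"
proof -
  obtain w where w: "z = abs_braid w" by (metis braid_word)
  let ?d = "artin_act w c"
  have z: "maps_curve z c ?d" unfolding w by (rule curveI) (simp add: fconj_free_eq free_eq_refl)
  have "maps_curve (z \<cdot> bconj x z \<cdot> binv z) ?d ?d"
    using curve_mult[OF curve_binv[OF z] curve_mult[OF assms(2) z]] .
  moreover have "z \<cdot> bconj x z \<cdot> binv z = x" by (simp add: bconj_def gsimps)
  ultimately show thesis using that[of ?d] round_ess(2)[OF assms(1)] by simp
qed

lemma pseudo_anosov_no_curve: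
  assumes "pseudo_anosov x" "c \<in> ess_curves"
  shows "\<not> maps_curve (bpow x 4) c c"
proof
  assume H: "maps_curve (bpow x 4) c c"
  obtain w where w: "x = abs_braid w" by (metis braid_word)
  have "bpow x n = abs_braid (concat (replicate n w))" for n
    by (induction n) (simp_all add: bpow_simps bone.abs_eq bmult.abs_eq w)
  then have "fconj (artin_act (concat (replicate 4 w)) c) c" using H unfolding maps_curve_def by metis
  then show False using assms w unfolding pseudo_anosov_def by (metis one_le_numeral)
qed

text \<open>A curve preserved by a conjugate of \<open>fourth x\<close>, or of its inverse times
  \<delta>^R, gives one preserved by the fourth power of \<open>x\<close>, since the powers of
  \<delta> involved preserve all curves.\<close>

lemma pseudo_anosov_not_red:
  assumes x: "pseudo_anosov x" "rigid x"
    and Z: "conjugate (bw R Z) (fourth x) \<or> conjugate (bw R Z) (binv (fourth x) \<cdot> dpow (int R))" and R: "4 dvd R"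
  shows "\<not> red R Z"
proof
  assume "red R Z"
  then obtain c where c: "c \<in> ess_curves" "maps_curve (bw R Z) c c" by (rule red_curve)
  have R4: "4 dvd int R" using R by presburger
  obtain d where d: "d \<in> ess_curves" "maps_curve (fourth x) d d"
  proof (cases "conjugate (bw R Z) (fourth x)")
    case True
    then obtain z where "bw R Z = bconj (fourth x) z" by (auto simp: conjugate_def)
    then show thesis using that curve_conj[of c "fourth x" z] c by metis
  next
    case False
    then obtain z where "bw R Z = bconj (binv (fourth x) \<cdot> dpow (int R)) z" using Z by (auto simp: conjugate_def)
    then obtain d where d: "d \<in> ess_curves" "maps_curve (binv (fourth x) \<cdot> dpow (int R)) d d"
      using curve_conj[of c _ z] c by metis
    have "maps_curve (dpow (int R) \<cdot> binv (binv (fourth x) \<cdot> dpow (int R))) d d"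
      using curve_mult[OF curve_binv[OF d(2)] curve_dpow4[OF d(1) R4]] .
    moreover have "dpow (int R) \<cdot> binv (binv (fourth x) \<cdot> dpow (int R)) = fourth x"
      by (simp add: gsimps)
    ultimately show thesis using that d(1) by simp
  qed
  have "maps_curve (dpow (4 * finf x) \<cdot> fourth x) d d"
    by (rule curve_mult[OF d(2) curve_dpow4[OF d(1)]]) simp
  moreover have "dpow (4 * finf x) \<cdot> fourth x = bpow x 4"
    by (simp add: fourth_def bmult_assoc[symmetric] dpow_add[symmetric] dpow_0 gsimps)
  ultimately show False using pseudo_anosov_no_curve[OF x(1) d(1)] by simp
qed

theorem theorem1p2:
  shows "\<exists>K::real. K > 0 \<and>
    (\<forall>x::braid. pseudo_anosov x \<and> rigid x \<longrightarrow>
       finite (SC x) \<and> real (card (SC x)) \<le> K * (real (clen x))^2)"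
proof (intro exI[of _ "10000::real"] conjI allI impI)
  fix x :: braid assume x: "pseudo_anosov x \<and> rigid x"
  let ?X = "fourth x" and ?n = "clen x"
  have len: "length (nfs ?X) = 4 * ?n"
    using nf_fourth(1)[of x] x by (simp add: clen_nf length_pw)
  have n: "1 \<le> ?n" using x by (simp add: rigid_def)
  have "finite (rset ?X) \<and> card (rset ?X) \<le> bnd (4 * ?n)"
    using card_rset[of ?X] nf_fourth[of x] pseudo_anosov_not_red[of x] x unfolding len by simp
  then have f: "finite (rset ?X)" "card (rset ?X) \<le> bnd (4 * ?n)" by blast+
  note r = rset_fourth[of x]
  have fr: "finite (rset x)" using finite_imageD[OF finite_subset[OF r(1) f(1)] r(2)] x by blast
  have sub: "SC x \<subseteq> rset x" using SC_subset_rset x by blast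
  show "finite (SC x)" using finite_subset[OF sub fr] .
  have "card (SC x) \<le> card (rset x)" by (rule card_mono[OF fr sub])
  also have "\<dots> \<le> card (rset ?X)" using card_inj_on_le[OF r(2,1) f(1)] x by blast
  also have "\<dots> \<le> bnd (4 * ?n)" by (rule f(2))
  \<comment> \<open>The word of the fourth power has four times as many letters as \<open>x\<close>,
    whence \<open>bnd (4 * ?n)\<close>; 10000 is a round number above the sum of the two
    coefficients.\<close>
  also have "\<dots> = 2304 * ?n ^ 2 + 4624 * ?n" by (simp add: bnd_def power2_eq_square algebra_simps)
  also have "\<dots> \<le> 2304 * ?n ^ 2 + 4624 * ?n ^ 2" using n by (simp add: power2_eq_square)
  also have "\<dots> \<le> 10000 * ?n ^ 2" by simp
  finally have "real (card (SC x)) \<le> real (10000 * ?n ^ 2)" by (rule of_nat_mono)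
  then show "real (card (SC x)) \<le> 10000 * (real ?n)^2" by simp
qed simp

end
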